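(* Let $\mathbf{C}$ be a category with finite limits and coequalisers, such that coequalisers are preserved by the functors $C\times(-)$ for all $C\in\mathbf{C}$. Let $Q\in\mathrm{Graph}(\mathbf{C})$, assume that the diagonal functor $\Delta\colon\mathrm{Grp}(\mathbf{C})\to\mathrm{Grp}(\mathrm{Graph}(\mathbf{C})_{/Q})$ has a left adjoint $\operatorname{colim}$, and let $\mathcal{G}\in\mathrm{Grp}(\mathrm{Graph}(\mathbf{C})_{/Q})$ be a graph of groups with fundamental group $\pi=\operatorname{colim}\mathcal{G}$ and standard graph $T=T(\mathcal{G})$. Suppose that $\mathbf{C}$ is also locally action Barr-exact and that the unit map $\mathcal{G}\to\Delta(\pi)$ is monic in $\mathrm{Graph}(\mathbf{C})_{/Q}$. Then there is a canonical isomorphism $\mathcal{G}\cong t^*\pi_T$, where $\pi_T$ is the stabiliser of the action of $\pi$ on $T$ and $t\colon Q=\pi\backslash T\to T$ is the canonical section.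
   Context: Basic notation. $\mathrm{Grp}(\mathbf{C})$ is the category of group objects in $\mathbf{C}$, with structure maps $m_G,i_G,e_G$; $*$ is the terminal object. $\mathrm{Graph}(\mathbf{C})$ is the category of internal directed graphs $X=(d_0,d_1\colon EX\rightrightarrows VX)$, i.e. functors from the parallel-pair category to $\mathbf{C}$; limits and colimits are computed on $E$ and $V$ separately. An object $C$ of $\mathbf{C}$ is also regarded as the constant graph $(C\rightrightarrows C)$, so $C\times X=(C\times EX\rightrightarrows C\times VX)$. For a group object $G$ acting on a graph $X$ (actions on $EX$ and $VX$ with $d_0,d_1$ equivariant; action map $a\colon G\times X\to X$), the quotient $G\backslash X$ is the coequaliser of $a,\mathrm{pr}_X\colon G\times X\rightrightarrows X$, and the stabiliser $G_X$ is the equaliser of $a,\mathrm{pr}_X\colon G\times X\rightrightarrows X$; with its map to $X$ it is a group object in the slice over $X$, with multiplication induced by $m_G$. Graphs of groups. $\Delta$ is the functor $H\mapsto H\times Q$. The standard graph $T$ is the coequaliser in $\mathrm{Graph}(\mathbf{C})$ of the two maps $\pi\times\mathcal{G}\rightrightarrows\pi\times Q$ given by $\mathrm{id}_\pi\times(\mathcal{G}\to Q)$ and by $\pi\times\mathcal{G}\to\pi\times\Delta(\pi)=\pi\times\pi\times Q\xrightarrow{m_\pi\times\mathrm{id}_Q}\pi\times Q$. Left multiplication of $\pi$ on the factor $\pi$ induces an action of $\pi$ on $T$, and $\pi\backslash T\cong Q$ canonically (induced by the projection $\pi\times Q\to Q$). The map $t\colon Q=*\times Q\xrightarrow{e_\pi\times\mathrm{id}}\pi\times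 Q\to T$ is a section of the quotient map $T\to\pi\backslash T=Q$. $t^*$ denotes pullback along $t$. The canonical map $\mathcal{G}\to t^*\pi_T$ is the one through which the unit $\mathcal{G}\to\pi\times Q$ factors, $t^*\pi_T$ being the subobject of $\pi\times Q$ obtained by pulling back $\pi_T\hookrightarrow\pi\times T$ along $t$. Action Barr-exactness. In a regular category $\mathbf{D}$, if $H\in\mathrm{Grp}(\mathbf{D})$ acts on $Y$, then the image $R\hookrightarrow Y\times Y$ in the (regular epi)-mono factorisation of $(a,\mathrm{pr}_Y)\colon H\times Y\to Y\times Y$ is a congruence (internal equivalence relation) on $Y$. A regular category $\mathbf{D}$ is action Barr-exact if every such congruence is effective (has a coequaliser and is the kernel pair of it). $\mathbf{C}$ is locally action Barr-exact if every slice $\mathbf{C}_{/Y}$ is action Barr-exact. *)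

theory Defs
  imports Main
begin

section \<open>Categories, functors, adjunctions\<close>

record ('o, 'm) cat =
  Ob :: "'o set"
  Ar :: "'m set"
  Dom :: "'m \<Rightarrow> 'o"
  Cod :: "'m \<Rightarrow> 'o"
  Idn :: "'o \<Rightarrow> 'm"
  Cmp :: "'m \<Rightarrow> 'm \<Rightarrow> 'm"  (infixl "\<cdot>\<index>" 70)

definition hom :: "('o, 'm) cat \<Rightarrow> 'o \<Rightarrow> 'o \<Rightarrow> 'm set" where
  "hom C A B = {f \<in> Ar C. Dom C f = A \<and> Cod C f = B}"

locale category =
  fixes C :: "('o, 'm) cat"  (structure)
  assumes dom_in_Ob: "f \<in> Ar C \<Longrightarrow> Dom C f \<in> Ob C"
    and cod_in_Ob: "f \<in> Ar C \<Longrightarrow> Cod C f \<in> Ob C"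
    and id_in_hom: "A \<in> Ob C \<Longrightarrow> Idn C A \<in> hom C A A"
    and comp_in_hom: "f \<in> hom C X Y \<Longrightarrow> g \<in> hom C Y Z \<Longrightarrow> g \<cdot> f \<in> hom C X Z"
    and comp_id: "f \<in> hom C X Y \<Longrightarrow> f \<cdot> Idn C X = f"
    and id_comp: "f \<in> hom C X Y \<Longrightarrow> Idn C Y \<cdot> f = f"
    and comp_assoc: "f \<in> hom C W X \<Longrightarrow> g \<in> hom C X Y \<Longrightarrow> h \<in> hom C Y Z
      \<Longrightarrow> (h \<cdot> g) \<cdot> f = h \<cdot> (g \<cdot> f)"

record ('o, 'm, 'p, 'n) fctr =
  FOb :: "'o \<Rightarrow> 'p"
  FAr :: "'m \<Rightarrow> 'n"

definition is_functor :: "('o, 'm) cat \<Rightarrow> ('p, 'n) cat \<Rightarrow> ('o, 'm, 'p, 'n) fctr \<Rightarrow> bool" where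
  "is_functor C D F \<longleftrightarrow>
     (\<forall>A \<in> Ob C. FOb F A \<in> Ob D \<and> FAr F (Idn C A) = Idn D (FOb F A)) \<and>
     (\<forall>f \<in> Ar C. FAr F f \<in> hom D (FOb F (Dom C f)) (FOb F (Cod C f))) \<and>
     (\<forall>f \<in> Ar C. \<forall>g \<in> Ar C. Dom C g = Cod C f \<longrightarrow>
        FAr F (g \<cdot>\<^bsub>C\<^esub> f) = FAr F g \<cdot>\<^bsub>D\<^esub> FAr F f)"

definition functor_comp ::
  "('p, 'n, 'q, 'k) fctr \<Rightarrow> ('o, 'm, 'p, 'n) fctr \<Rightarrow> ('o, 'm, 'q, 'k) fctr" where
  "functor_comp F' F = \<lparr>FOb = FOb F' \<circ> FOb F, FAr = FAr F' \<circ> FAr F\<rparr>"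

text \<open>\<open>L : C \<rightarrow> D\<close> is left adjoint to \<open>R : D \<rightarrow> C\<close>, with unit \<open>\<eta> : 1 \<rightarrow> R L\<close>.\<close>

definition adjunction ::
  "('o, 'm) cat \<Rightarrow> ('p, 'n) cat \<Rightarrow> ('o, 'm, 'p, 'n) fctr \<Rightarrow> ('p, 'n, 'o, 'm) fctr
    \<Rightarrow> ('o \<Rightarrow> 'm) \<Rightarrow> bool" where
  "adjunction C D L R \<eta> \<longleftrightarrow>
     is_functor C D L \<and> is_functor D C R \<and>
     (\<forall>X \<in> Ob C. \<eta> X \<in> hom C X (FOb R (FOb L X))) \<and>
     (\<forall>f \<in> Ar C. \<eta> (Cod C f) \<cdot>\<^bsub>C\<^esub> f = FAr R (FAr L f) \<cdot>\<^bsub>C\<^esub> \<eta> (Dom C f)) \<and>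
     (\<forall>X \<in> Ob C. \<forall>Y \<in> Ob D.
        bij_betw (\<lambda>g. FAr R g \<cdot>\<^bsub>C\<^esub> \<eta> X) (hom D (FOb L X) Y) (hom C X (FOb R Y)))"

definition monic :: "('o, 'm) cat \<Rightarrow> 'm \<Rightarrow> bool" where
  "monic C f \<longleftrightarrow> f \<in> Ar C \<and>
     (\<forall>W \<in> Ob C. \<forall>g \<in> hom C W (Dom C f). \<forall>h \<in> hom C W (Dom C f).
        f \<cdot>\<^bsub>C\<^esub> g = f \<cdot>\<^bsub>C\<^esub> h \<longrightarrow> g = h)"

definition iso_in :: "('o, 'm) cat \<Rightarrow> 'o \<Rightarrow> 'o \<Rightarrow> 'm \<Rightarrow> bool" where
  "iso_in C A B f \<longleftrightarrow> f \<in> hom C A B \<and>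
     (\<exists>g \<in> hom C B A. g \<cdot>\<^bsub>C\<^esub> f = Idn C A \<and> f \<cdot>\<^bsub>C\<^esub> g = Idn C B)"


section \<open>Limits and coequalisers\<close>

definition is_cone ::
  "('j, 'k) cat \<Rightarrow> ('o, 'm) cat \<Rightarrow> ('j, 'k, 'o, 'm) fctr \<Rightarrow> 'o \<Rightarrow> ('j \<Rightarrow> 'm) \<Rightarrow> bool" where
  "is_cone J C F N c \<longleftrightarrow> N \<in> Ob C \<and>
     (\<forall>j \<in> Ob J. c j \<in> hom C N (FOb F j)) \<and>
     (\<forall>u \<in> Ar J. FAr F u \<cdot>\<^bsub>C\<^esub> c (Dom J u) = c (Cod J u))"

definition is_limit ::
  "('j, 'k) cat \<Rightarrow> ('o, 'm) cat \<Rightarrow> ('j, 'k, 'o, 'm) fctr \<Rightarrow> 'o \<Rightarrow> ('j \<Rightarrow> 'm) \<Rightarrow> bool" where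
  "is_limit J C F N c \<longleftrightarrow> is_cone J C F N c \<and>
     (\<forall>M d. is_cone J C F M d \<longrightarrow>
        (\<exists>!h. h \<in> hom C M N \<and> (\<forall>j \<in> Ob J. c j \<cdot>\<^bsub>C\<^esub> h = d j)))"

text \<open>Every finite category is isomorphic to one whose objects and arrows are natural numbers,
  so it is enough to let the shape range over categories on \<open>nat\<close>.\<close>

definition has_finite_limits :: "('o, 'm) cat \<Rightarrow> bool" where
  "has_finite_limits C \<longleftrightarrow>
     (\<forall>(J :: (nat, nat) cat) F. category J \<and> finite (Ob J) \<and> finite (Ar J) \<and> is_functor J C F
        \<longrightarrow> (\<exists>N c. is_limit J C F N c))"

definition is_terminal :: "('o, 'm) cat \<Rightarrow> 'o \<Rightarrow> bool" where
  "is_terminal C T \<longleftrightarrow> T \<in> Ob C \<and> (\<forall>A \<in> Ob C. \<exists>!h. h \<in> hom C A T)"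

definition is_product :: "('o, 'm) cat \<Rightarrow> 'o \<Rightarrow> 'o \<Rightarrow> 'o \<Rightarrow> 'm \<Rightarrow> 'm \<Rightarrow> bool" where
  "is_product C A B P p q \<longleftrightarrow>
     P \<in> Ob C \<and> p \<in> hom C P A \<and> q \<in> hom C P B \<and>
     (\<forall>W \<in> Ob C. \<forall>f \<in> hom C W A. \<forall>g \<in> hom C W B.
        \<exists>!h. h \<in> hom C W P \<and> p \<cdot>\<^bsub>C\<^esub> h = f \<and> q \<cdot>\<^bsub>C\<^esub> h = g)"

definition is_equaliser :: "('o, 'm) cat \<Rightarrow> 'm \<Rightarrow> 'm \<Rightarrow> 'm \<Rightarrow> bool" where
  "is_equaliser C f g e \<longleftrightarrow>
     f \<in> Ar C \<and> g \<in> hom C (Dom C f) (Cod C f) \<and>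
     e \<in> Ar C \<and> Cod C e = Dom C f \<and> f \<cdot>\<^bsub>C\<^esub> e = g \<cdot>\<^bsub>C\<^esub> e \<and>
     (\<forall>W \<in> Ob C. \<forall>k \<in> hom C W (Dom C f). f \<cdot>\<^bsub>C\<^esub> k = g \<cdot>\<^bsub>C\<^esub> k \<longrightarrow>
        (\<exists>!h. h \<in> hom C W (Dom C e) \<and> e \<cdot>\<^bsub>C\<^esub> h = k))"

definition is_coequaliser :: "('o, 'm) cat \<Rightarrow> 'm \<Rightarrow> 'm \<Rightarrow> 'm \<Rightarrow> bool" where
  "is_coequaliser C f g q \<longleftrightarrow>
     f \<in> Ar C \<and> g \<in> hom C (Dom C f) (Cod C f) \<and>
     q \<in> Ar C \<and> Dom C q = Cod C f \<and> q \<cdot>\<^bsub>C\<^esub> f = q \<cdot>\<^bsub>C\<^esub> g \<and>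
     (\<forall>W \<in> Ob C. \<forall>k \<in> hom C (Cod C f) W. k \<cdot>\<^bsub>C\<^esub> f = k \<cdot>\<^bsub>C\<^esub> g \<longrightarrow>
        (\<exists>!h. h \<in> hom C (Cod C q) W \<and> h \<cdot>\<^bsub>C\<^esub> q = k))"

definition is_pullback :: "('o, 'm) cat \<Rightarrow> 'm \<Rightarrow> 'm \<Rightarrow> 'o \<Rightarrow> 'm \<Rightarrow> 'm \<Rightarrow> bool" where
  "is_pullback C f g P p q \<longleftrightarrow>
     f \<in> Ar C \<and> g \<in> Ar C \<and> Cod C f = Cod C g \<and>
     P \<in> Ob C \<and> p \<in> hom C P (Dom C f) \<and> q \<in> hom C P (Dom C g) \<and> f \<cdot>\<^bsub>C\<^esub> p = g \<cdot>\<^bsub>C\<^esub> q \<and>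
     (\<forall>W \<in> Ob C. \<forall>k \<in> hom C W (Dom C f). \<forall>l \<in> hom C W (Dom C g).
        f \<cdot>\<^bsub>C\<^esub> k = g \<cdot>\<^bsub>C\<^esub> l \<longrightarrow>
        (\<exists>!h. h \<in> hom C W P \<and> p \<cdot>\<^bsub>C\<^esub> h = k \<and> q \<cdot>\<^bsub>C\<^esub> h = l))"

definition has_coequalisers :: "('o, 'm) cat \<Rightarrow> bool" where
  "has_coequalisers C \<longleftrightarrow>
     (\<forall>A \<in> Ob C. \<forall>B \<in> Ob C. \<forall>f \<in> hom C A B. \<forall>g \<in> hom C A B. \<exists>q. is_coequaliser C f g q)"

text \<open>Limits are only determined up to isomorphism; the constructions below use
  an arbitrary but fixed choice.\<close>

definition term_ob :: "('o, 'm) cat \<Rightarrow> 'o"  ("\<one>\<index>") where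
  "\<one>\<^bsub>C\<^esub> = (SOME T. is_terminal C T)"

definition bang :: "('o, 'm) cat \<Rightarrow> 'o \<Rightarrow> 'm" where
  "bang C A = (THE h. h \<in> hom C A \<one>\<^bsub>C\<^esub>)"

definition chosen_prod :: "('o, 'm) cat \<Rightarrow> 'o \<Rightarrow> 'o \<Rightarrow> 'o \<times> 'm \<times> 'm" where
  "chosen_prod C A B = (SOME (P, p, q). is_product C A B P p q)"

definition prod_ob :: "('o, 'm) cat \<Rightarrow> 'o \<Rightarrow> 'o \<Rightarrow> 'o"  (infixr "\<otimes>\<index>" 75) where
  "A \<otimes>\<^bsub>C\<^esub> B = fst (chosen_prod C A B)"

definition pr1 :: "('o, 'm) cat \<Rightarrow> 'o \<Rightarrow> 'o \<Rightarrow> 'm" where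
  "pr1 C A B = fst (snd (chosen_prod C A B))"

definition pr2 :: "('o, 'm) cat \<Rightarrow> 'o \<Rightarrow> 'o \<Rightarrow> 'm" where
  "pr2 C A B = snd (snd (chosen_prod C A B))"

definition pairing :: "('o, 'm) cat \<Rightarrow> 'm \<Rightarrow> 'm \<Rightarrow> 'm"  ("\<langle>_,/ _\<rangle>\<index>") where
  "\<langle>f, g\<rangle>\<^bsub>C\<^esub> = (THE h. h \<in> hom C (Dom C f) (Cod C f \<otimes>\<^bsub>C\<^esub> Cod C g) \<and>
      pr1 C (Cod C f) (Cod C g) \<cdot>\<^bsub>C\<^esub> h = f \<and> pr2 C (Cod C f) (Cod C g) \<cdot>\<^bsub>C\<^esub> h = g)"

definition prod_ar :: "('o, 'm) cat \<Rightarrow> 'm \<Rightarrow> 'm \<Rightarrow> 'm"  (infixr "\<otimes>\<^sub>a\<index>" 75) where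
  "f \<otimes>\<^sub>a\<^bsub>C\<^esub> g =
     \<langle>f \<cdot>\<^bsub>C\<^esub> pr1 C (Dom C f) (Dom C g), g \<cdot>\<^bsub>C\<^esub> pr2 C (Dom C f) (Dom C g)\<rangle>\<^bsub>C\<^esub>"

text \<open>The canonical isomorphism \<open>A \<times> (B \<times> X) \<rightarrow> (A \<times> B) \<times> X\<close>.\<close>

definition assoc :: "('o, 'm) cat \<Rightarrow> 'o \<Rightarrow> 'o \<Rightarrow> 'o \<Rightarrow> 'm" where
  "assoc C A B X =
     \<langle>\<langle>pr1 C A (B \<otimes>\<^bsub>C\<^esub> X), pr1 C B X \<cdot>\<^bsub>C\<^esub> pr2 C A (B \<otimes>\<^bsub>C\<^esub> X)\<rangle>\<^bsub>C\<^esub>,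
      pr2 C B X \<cdot>\<^bsub>C\<^esub> pr2 C A (B \<otimes>\<^bsub>C\<^esub> X)\<rangle>\<^bsub>C\<^esub>"

definition chosen_pb :: "('o, 'm) cat \<Rightarrow> 'm \<Rightarrow> 'm \<Rightarrow> 'o \<times> 'm \<times> 'm" where
  "chosen_pb C f g = (SOME (P, p, q). is_pullback C f g P p q)"

definition pb_ob :: "('o, 'm) cat \<Rightarrow> 'm \<Rightarrow> 'm \<Rightarrow> 'o" where
  "pb_ob C f g = fst (chosen_pb C f g)"

definition pb1 :: "('o, 'm) cat \<Rightarrow> 'm \<Rightarrow> 'm \<Rightarrow> 'm" where
  "pb1 C f g = fst (snd (chosen_pb C f g))"

definition pb2 :: "('o, 'm) cat \<Rightarrow> 'm \<Rightarrow> 'm \<Rightarrow> 'm" where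
  "pb2 C f g = snd (snd (chosen_pb C f g))"

definition products_preserve_coequalisers :: "('o, 'm) cat \<Rightarrow> bool" where
  "products_preserve_coequalisers C \<longleftrightarrow>
     (\<forall>A \<in> Ob C. \<forall>f g q. is_coequaliser C f g q \<longrightarrow>
        is_coequaliser C (Idn C A \<otimes>\<^sub>a\<^bsub>C\<^esub> f) (Idn C A \<otimes>\<^sub>a\<^bsub>C\<^esub> g) (Idn C A \<otimes>\<^sub>a\<^bsub>C\<^esub> q))"


section \<open>Group objects and actions\<close>

datatype ('o, 'm) grp = Grp (gob: 'o) (gmul: 'm) (ginv: 'm) (gone: 'm)

definition is_group :: "('o, 'm) cat \<Rightarrow> ('o, 'm) grp \<Rightarrow> bool" where
  "is_group C G \<longleftrightarrow>
     (let A = gob G; m = gmul G; i = ginv G; e = gone G; I = Idn C A; u = e \<cdot>\<^bsub>C\<^esub> bang C A in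
      A \<in> Ob C \<and> m \<in> hom C (A \<otimes>\<^bsub>C\<^esub> A) A \<and> i \<in> hom C A A \<and> e \<in> hom C \<one>\<^bsub>C\<^esub> A \<and>
      m \<cdot>\<^bsub>C\<^esub> (m \<otimes>\<^sub>a\<^bsub>C\<^esub> I) \<cdot>\<^bsub>C\<^esub> assoc C A A A = m \<cdot>\<^bsub>C\<^esub> (I \<otimes>\<^sub>a\<^bsub>C\<^esub> m) \<and>
      m \<cdot>\<^bsub>C\<^esub> \<langle>u, I\<rangle>\<^bsub>C\<^esub> = I \<and> m \<cdot>\<^bsub>C\<^esub> \<langle>I, u\<rangle>\<^bsub>C\<^esub> = I \<and>
      m \<cdot>\<^bsub>C\<^esub> \<langle>i, I\<rangle>\<^bsub>C\<^esub> = u \<and> m \<cdot>\<^bsub>C\<^esub> \<langle>I, i\<rangle>\<^bsub>C\<^esub> = u)"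

datatype ('o, 'm) grp_ar = GrpAr (gdom: "('o, 'm) grp") (gcod: "('o, 'm) grp") (gmap: 'm)

definition is_group_hom :: "('o, 'm) cat \<Rightarrow> ('o, 'm) grp_ar \<Rightarrow> bool" where
  "is_group_hom C \<phi> \<longleftrightarrow>
     (let G = gdom \<phi>; H = gcod \<phi>; f = gmap \<phi> in
      is_group C G \<and> is_group C H \<and> f \<in> hom C (gob G) (gob H) \<and>
      f \<cdot>\<^bsub>C\<^esub> gmul G = gmul H \<cdot>\<^bsub>C\<^esub> (f \<otimes>\<^sub>a\<^bsub>C\<^esub> f) \<and>
      f \<cdot>\<^bsub>C\<^esub> ginv G = ginv H \<cdot>\<^bsub>C\<^esub> f \<and> f \<cdot>\<^bsub>C\<^esub> gone G = gone H)"

definition grp_cat :: "('o, 'm) cat \<Rightarrow> (('o, 'm) grp, ('o, 'm) grp_ar) cat" where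
  "grp_cat C =
     \<lparr>Ob = {G. is_group C G}, Ar = {\<phi>. is_group_hom C \<phi>}, Dom = gdom, Cod = gcod,
      Idn = (\<lambda>G. GrpAr G G (Idn C (gob G))),
      Cmp = (\<lambda>\<psi> \<phi>. GrpAr (gdom \<phi>) (gcod \<psi>) (gmap \<psi> \<cdot>\<^bsub>C\<^esub> gmap \<phi>))\<rparr>"

text \<open>A functor \<open>F : C \<rightarrow> D\<close> that preserves finite products carries group objects to group objects:
  the multiplication of \<open>F G\<close> is \<open>F G \<times> F G \<cong> F (G \<times> G) \<rightarrow> F G\<close>, the unit is
  \<open>1 \<cong> F 1 \<rightarrow> F G\<close>.\<close>

definition grp_functor_ob ::
  "('o, 'm) cat \<Rightarrow> ('p, 'n) cat \<Rightarrow> ('o, 'm, 'p, 'n) fctr \<Rightarrow> ('o, 'm) grp \<Rightarrow> ('p, 'n) grp" where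
  "grp_functor_ob C D F G =
     (let A = gob G; B = FOb F A in
      Grp B
        (FAr F (gmul G) \<cdot>\<^bsub>D\<^esub> (THE k. k \<in> hom D (B \<otimes>\<^bsub>D\<^esub> B) (FOb F (A \<otimes>\<^bsub>C\<^esub> A)) \<and>
            FAr F (pr1 C A A) \<cdot>\<^bsub>D\<^esub> k = pr1 D B B \<and> FAr F (pr2 C A A) \<cdot>\<^bsub>D\<^esub> k = pr2 D B B))
        (FAr F (ginv G))
        (FAr F (gone G) \<cdot>\<^bsub>D\<^esub> (THE k. k \<in> hom D \<one>\<^bsub>D\<^esub> (FOb F \<one>\<^bsub>C\<^esub>))))"

definition grp_functor ::
  "('o, 'm) cat \<Rightarrow> ('p, 'n) cat \<Rightarrow> ('o, 'm, 'p, 'n) fctr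
    \<Rightarrow> (('o, 'm) grp, ('o, 'm) grp_ar, ('p, 'n) grp, ('p, 'n) grp_ar) fctr" where
  "grp_functor C D F =
     \<lparr>FOb = grp_functor_ob C D F,
      FAr = (\<lambda>\<phi>. GrpAr (grp_functor_ob C D F (gdom \<phi>)) (grp_functor_ob C D F (gcod \<phi>))
                       (FAr F (gmap \<phi>)))\<rparr>"

definition is_action :: "('o, 'm) cat \<Rightarrow> ('o, 'm) grp \<Rightarrow> 'o \<Rightarrow> 'm \<Rightarrow> bool" where
  "is_action C G X a \<longleftrightarrow>
     is_group C G \<and> X \<in> Ob C \<and> a \<in> hom C (gob G \<otimes>\<^bsub>C\<^esub> X) X \<and>
     a \<cdot>\<^bsub>C\<^esub> (gmul G \<otimes>\<^sub>a\<^bsub>C\<^esub> Idn C X) \<cdot>\<^bsub>C\<^esub> assoc C (gob G) (gob G) X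
       = a \<cdot>\<^bsub>C\<^esub> (Idn C (gob G) \<otimes>\<^sub>a\<^bsub>C\<^esub> a) \<and>
     a \<cdot>\<^bsub>C\<^esub> \<langle>gone G \<cdot>\<^bsub>C\<^esub> bang C X, Idn C X\<rangle>\<^bsub>C\<^esub> = Idn C X"


section \<open>Slices\<close>

datatype 'm slice_ar = SliceAr (sdom: 'm) (scod: 'm) (smap: 'm)

definition slice :: "('o, 'm) cat \<Rightarrow> 'o \<Rightarrow> ('m, 'm slice_ar) cat" where
  "slice C Y =
     \<lparr>Ob = {f \<in> Ar C. Cod C f = Y},
      Ar = {\<sigma>. sdom \<sigma> \<in> Ar C \<and> Cod C (sdom \<sigma>) = Y \<and> scod \<sigma> \<in> Ar C \<and> Cod C (scod \<sigma>) = Y \<and>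
               smap \<sigma> \<in> hom C (Dom C (sdom \<sigma>)) (Dom C (scod \<sigma>)) \<and>
               scod \<sigma> \<cdot>\<^bsub>C\<^esub> smap \<sigma> = sdom \<sigma>},
      Dom = sdom, Cod = scod,
      Idn = (\<lambda>f. SliceAr f f (Idn C (Dom C f))),
      Cmp = (\<lambda>\<tau> \<sigma>. SliceAr (sdom \<sigma>) (scod \<tau>) (smap \<tau> \<cdot>\<^bsub>C\<^esub> smap \<sigma>))\<rparr>"

text \<open>\<open>Y \<mapsto> (Y \<times> X \<rightarrow> X)\<close>, a functor from \<open>C\<close> to \<open>C / X\<close>.\<close>

definition times_over ::
  "('o, 'm) cat \<Rightarrow> 'o \<Rightarrow> ('o, 'm, 'm, 'm slice_ar) fctr" where
  "times_over C X =
     \<lparr>FOb = (\<lambda>Y. pr2 C Y X),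
      FAr = (\<lambda>f. SliceAr (pr2 C (Dom C f) X) (pr2 C (Cod C f) X) (f \<otimes>\<^sub>a\<^bsub>C\<^esub> Idn C X))\<rparr>"

text \<open>Pullback along \<open>t : X \<rightarrow> Y\<close>, a functor from \<open>C / Y\<close> to \<open>C / X\<close>.\<close>

definition pullback_functor ::
  "('o, 'm) cat \<Rightarrow> 'm \<Rightarrow> ('m, 'm slice_ar, 'm, 'm slice_ar) fctr" where
  "pullback_functor C t =
     \<lparr>FOb = (\<lambda>f. pb2 C f t),
      FAr = (\<lambda>\<sigma>. SliceAr (pb2 C (sdom \<sigma>) t) (pb2 C (scod \<sigma>) t)
               (THE k. k \<in> hom C (pb_ob C (sdom \<sigma>) t) (pb_ob C (scod \<sigma>) t) \<and>
                  pb1 C (scod \<sigma>) t \<cdot>\<^bsub>C\<^esub> k = smap \<sigma> \<cdot>\<^bsub>C\<^esub> pb1 C (sdom \<sigma>) t \<and>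
                  pb2 C (scod \<sigma>) t \<cdot>\<^bsub>C\<^esub> k = pb2 C (sdom \<sigma>) t))\<rparr>"


section \<open>Action Barr-exactness\<close>

definition regular_epi :: "('o, 'm) cat \<Rightarrow> 'm \<Rightarrow> bool" where
  "regular_epi C e \<longleftrightarrow> (\<exists>f g. is_coequaliser C f g e)"

definition regular_category :: "('o, 'm) cat \<Rightarrow> bool" where
  "regular_category C \<longleftrightarrow> category C \<and> has_finite_limits C \<and>
     (\<forall>f R p q. is_pullback C f f R p q \<longrightarrow> (\<exists>c. is_coequaliser C p q c)) \<and>
     (\<forall>e g P p q. is_pullback C e g P p q \<and> regular_epi C e \<longrightarrow> regular_epi C q)"

text \<open>In the following definition \<open>r : R \<rightarrow> Y \<times> Y\<close> is the image of \<open>(a, pr\<^sub>Y)\<close>, a congruence on \<open>Y\<close>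
  with projections \<open>r1\<close> and \<open>r2\<close>.\<close>

definition action_barr_exact :: "('o, 'm) cat \<Rightarrow> bool" where
  "action_barr_exact D \<longleftrightarrow> regular_category D \<and>
     (\<forall>H Y a e r. is_action D H Y a \<and> regular_epi D e \<and> monic D r \<and> Cod D e = Dom D r \<and>
          r \<cdot>\<^bsub>D\<^esub> e = \<langle>a, pr2 D (gob H) Y\<rangle>\<^bsub>D\<^esub> \<longrightarrow>
        (let r1 = pr1 D Y Y \<cdot>\<^bsub>D\<^esub> r; r2 = pr2 D Y Y \<cdot>\<^bsub>D\<^esub> r in
         \<exists>q. is_coequaliser D r1 r2 q \<and> is_pullback D q q (Dom D r) r1 r2))"

definition locally_action_barr_exact :: "('o, 'm) cat \<Rightarrow> bool" where
  "locally_action_barr_exact C \<longleftrightarrow> (\<forall>Y \<in> Ob C. action_barr_exact (slice C Y))"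


section \<open>Internal graphs\<close>

datatype ('o, 'm) graph = Graph (edges: 'o) (verts: 'o) (d0: 'm) (d1: 'm)

datatype ('o, 'm) graph_ar =
  GraphAr (grdom: "('o, 'm) graph") (grcod: "('o, 'm) graph") (emap: 'm) (vmap: 'm)

definition is_graph :: "('o, 'm) cat \<Rightarrow> ('o, 'm) graph \<Rightarrow> bool" where
  "is_graph C X \<longleftrightarrow> edges X \<in> Ob C \<and> verts X \<in> Ob C \<and>
     d0 X \<in> hom C (edges X) (verts X) \<and> d1 X \<in> hom C (edges X) (verts X)"

definition graph_cat :: "('o, 'm) cat \<Rightarrow> (('o, 'm) graph, ('o, 'm) graph_ar) cat" where
  "graph_cat C =
     \<lparr>Ob = {X. is_graph C X},
      Ar = {f. is_graph C (grdom f) \<and> is_graph C (grcod f) \<and>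
               emap f \<in> hom C (edges (grdom f)) (edges (grcod f)) \<and>
               vmap f \<in> hom C (verts (grdom f)) (verts (grcod f)) \<and>
               d0 (grcod f) \<cdot>\<^bsub>C\<^esub> emap f = vmap f \<cdot>\<^bsub>C\<^esub> d0 (grdom f) \<and>
               d1 (grcod f) \<cdot>\<^bsub>C\<^esub> emap f = vmap f \<cdot>\<^bsub>C\<^esub> d1 (grdom f)},
      Dom = grdom, Cod = grcod,
      Idn = (\<lambda>X. GraphAr X X (Idn C (edges X)) (Idn C (verts X))),
      Cmp = (\<lambda>g f. GraphAr (grdom f) (grcod g) (emap g \<cdot>\<^bsub>C\<^esub> emap f) (vmap g \<cdot>\<^bsub>C\<^esub> vmap f))\<rparr>"

definition const_graph :: "('o, 'm) cat \<Rightarrow> 'o \<Rightarrow> ('o, 'm) graph" where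
  "const_graph C A = Graph A A (Idn C A) (Idn C A)"

definition const_functor ::
  "('o, 'm) cat \<Rightarrow> ('o, 'm, ('o, 'm) graph, ('o, 'm) graph_ar) fctr" where
  "const_functor C =
     \<lparr>FOb = const_graph C,
      FAr = (\<lambda>f. GraphAr (const_graph C (Dom C f)) (const_graph C (Cod C f)) f f)\<rparr>"


section \<open>Stabilisers\<close>

text \<open>The inclusion \<open>\<iota> : G\<^sub>X \<rightarrow> G \<times> X\<close> of the stabiliser of an action \<open>a : G \<times> X \<rightarrow> X\<close>.\<close>

definition stab_incl :: "('o, 'm) cat \<Rightarrow> ('o, 'm) grp \<Rightarrow> 'o \<Rightarrow> 'm \<Rightarrow> 'm" where
  "stab_incl C G X a = (SOME e. is_equaliser C a (pr2 C (gob G) X) e)"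

text \<open>The stabiliser as a group object of \<open>C / X\<close>: its structure is the restriction of that of the
  group object \<open>G \<times> X \<rightarrow> X\<close>, hence it is the only one for which \<open>\<iota>\<close> is a homomorphism.\<close>

definition stabiliser ::
  "('o, 'm) cat \<Rightarrow> ('o, 'm) grp \<Rightarrow> 'o \<Rightarrow> 'm \<Rightarrow> ('m, 'm slice_ar) grp" where
  "stabiliser C G X a =
     (let \<iota> = stab_incl C G X a; p = pr2 C (gob G) X in
      THE S. is_group (slice C X) S \<and> gob S = p \<cdot>\<^bsub>C\<^esub> \<iota> \<and>
        is_group_hom (slice C X)
          (GrpAr S (FOb (grp_functor C (slice C X) (times_over C X)) G)
             (SliceAr (p \<cdot>\<^bsub>C\<^esub> \<iota>) p \<iota>)))"


section \<open>Graphs of groups\<close>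

abbreviation graph_over :: "('o, 'm) cat \<Rightarrow> ('o, 'm) graph
    \<Rightarrow> (('o, 'm) graph_ar, ('o, 'm) graph_ar slice_ar) cat" where
  "graph_over C Q \<equiv> slice (graph_cat C) Q"

type_synonym ('o, 'm) graph_of_groups =
  "(('o, 'm) graph_ar, ('o, 'm) graph_ar slice_ar) grp"

type_synonym ('o, 'm) graph_of_groups_ar =
  "(('o, 'm) graph_ar, ('o, 'm) graph_ar slice_ar) grp_ar"

definition const_group ::
  "('o, 'm) cat \<Rightarrow> ('o, 'm) grp \<Rightarrow> (('o, 'm) graph, ('o, 'm) graph_ar) grp" where
  "const_group C H = FOb (grp_functor C (graph_cat C) (const_functor C)) H"

definition diagonal_functor ::
  "('o, 'm) cat \<Rightarrow> ('o, 'm) graph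
    \<Rightarrow> (('o, 'm) grp, ('o, 'm) grp_ar, ('o, 'm) graph_of_groups, ('o, 'm) graph_of_groups_ar) fctr"
  where
  "diagonal_functor C Q =
     functor_comp (grp_functor (graph_cat C) (graph_over C Q) (times_over (graph_cat C) Q))
                  (grp_functor C (graph_cat C) (const_functor C))"

text \<open>In this section \<open>\<pi>\<close> is a group object of \<open>C\<close>, regarded also as a constant graph, and
  \<open>u : \<G> \<rightarrow> \<Delta>(\<pi>)\<close> is an arrow of \<open>Grp(Graph(C) / Q)\<close> (the unit, in the application).
  The underlying graph of \<open>\<G>\<close> is the domain of its structure map \<open>gob (gdom u)\<close> to \<open>Q\<close>.\<close>

definition left_mult ::
  "('o, 'm) cat \<Rightarrow> ('o, 'm) graph \<Rightarrow> ('o, 'm) grp \<Rightarrow> ('o, 'm) graph_ar" where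
  "left_mult C Q \<pi> =
     (let D = graph_cat C; P = const_group C \<pi> in
      (gmul P \<otimes>\<^sub>a\<^bsub>D\<^esub> Idn D Q) \<cdot>\<^bsub>D\<^esub> assoc D (gob P) (gob P) Q)"

text \<open>The quotient map \<open>\<pi> \<times> Q \<rightarrow> T\<close>.\<close>

definition std_quot ::
  "('o, 'm) cat \<Rightarrow> ('o, 'm) graph \<Rightarrow> ('o, 'm) grp \<Rightarrow> ('o, 'm) graph_of_groups_ar
    \<Rightarrow> ('o, 'm) graph_ar" where
  "std_quot C Q \<pi> u =
     (let D = graph_cat C; I = Idn D (gob (const_group C \<pi>)) in
      SOME \<tau>. is_coequaliser D
        (I \<otimes>\<^sub>a\<^bsub>D\<^esub> gob (gdom u))
        (left_mult C Q \<pi> \<cdot>\<^bsub>D\<^esub> (I \<otimes>\<^sub>a\<^bsub>D\<^esub> smap (gmap u))) \<tau>)"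

definition std_graph ::
  "('o, 'm) cat \<Rightarrow> ('o, 'm) graph \<Rightarrow> ('o, 'm) grp \<Rightarrow> ('o, 'm) graph_of_groups_ar
    \<Rightarrow> ('o, 'm) graph" where
  "std_graph C Q \<pi> u = Cod (graph_cat C) (std_quot C Q \<pi> u)"

text \<open>The action \<open>\<pi> \<times> T \<rightarrow> T\<close> induced by left multiplication on \<open>\<pi> \<times> Q\<close>.\<close>

definition std_action ::
  "('o, 'm) cat \<Rightarrow> ('o, 'm) graph \<Rightarrow> ('o, 'm) grp \<Rightarrow> ('o, 'm) graph_of_groups_ar
    \<Rightarrow> ('o, 'm) graph_ar" where
  "std_action C Q \<pi> u =
     (let D = graph_cat C; P = gob (const_group C \<pi>); T = std_graph C Q \<pi> u; \<tau> = std_quot C Q \<pi> u in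
      THE a. a \<in> hom D (P \<otimes>\<^bsub>D\<^esub> T) T \<and> a \<cdot>\<^bsub>D\<^esub> (Idn D P \<otimes>\<^sub>a\<^bsub>D\<^esub> \<tau>) = \<tau> \<cdot>\<^bsub>D\<^esub> left_mult C Q \<pi>)"

text \<open>The canonical section \<open>t : Q = 1 \<times> Q \<rightarrow> \<pi> \<times> Q \<rightarrow> T\<close> of \<open>T \<rightarrow> Q\<close>.\<close>

definition std_section ::
  "('o, 'm) cat \<Rightarrow> ('o, 'm) graph \<Rightarrow> ('o, 'm) grp \<Rightarrow> ('o, 'm) graph_of_groups_ar
    \<Rightarrow> ('o, 'm) graph_ar" where
  "std_section C Q \<pi> u =
     (let D = graph_cat C in
      std_quot C Q \<pi> u \<cdot>\<^bsub>D\<^esub> \<langle>gone (const_group C \<pi>) \<cdot>\<^bsub>D\<^esub> bang D Q, Idn D Q\<rangle>\<^bsub>D\<^esub>)"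

text \<open>The group object \<open>t\<^sup>*\<pi>\<^sub>T\<close> of \<open>Graph(C) / Q\<close>.\<close>

definition pulled_back_stabiliser ::
  "('o, 'm) cat \<Rightarrow> ('o, 'm) graph \<Rightarrow> ('o, 'm) grp \<Rightarrow> ('o, 'm) graph_of_groups_ar
    \<Rightarrow> ('o, 'm) graph_of_groups" where
  "pulled_back_stabiliser C Q \<pi> u =
     (let D = graph_cat C; T = std_graph C Q \<pi> u in
      FOb (grp_functor (slice D T) (slice D Q) (pullback_functor D (std_section C Q \<pi> u)))
        (stabiliser D (const_group C \<pi>) T (std_action C Q \<pi> u)))"

text \<open>The inclusion \<open>t\<^sup>*\<pi>\<^sub>T \<rightarrow> \<pi> \<times> Q\<close> over \<open>Q\<close>, that is, the pullback of \<open>\<iota> : \<pi>\<^sub>T \<rightarrow> \<pi> \<times> T\<close> along \<open>t\<close>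
  where \<open>t\<^sup>*(\<pi> \<times> T) = \<pi> \<times> Q\<close>.\<close>

definition pulled_back_incl ::
  "('o, 'm) cat \<Rightarrow> ('o, 'm) graph \<Rightarrow> ('o, 'm) grp \<Rightarrow> ('o, 'm) graph_of_groups_ar
    \<Rightarrow> ('o, 'm) graph_ar slice_ar" where
  "pulled_back_incl C Q \<pi> u =
     (let D = graph_cat C; P = const_group C \<pi>; T = std_graph C Q \<pi> u; t = std_section C Q \<pi> u;
          a = std_action C Q \<pi> u; \<iota> = stab_incl D P T a; s = gob (stabiliser D P T a) in
      SliceAr (pb2 D s t) (pr2 D (gob P) Q)
        \<langle>pr1 D (gob P) T \<cdot>\<^bsub>D\<^esub> \<iota> \<cdot>\<^bsub>D\<^esub> pb1 D s t, pb2 D s t\<rangle>\<^bsub>D\<^esub>)"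

end

theory Submission
  imports Defs
begin

text \<open>
  Write \<open>(\<gamma>, p) : \<G> \<rightarrow> \<pi> \<times> Q\<close> for the unit. The standard graph is the coequaliser
  \<open>\<tau> : \<pi> \<times> Q \<rightarrow> T\<close> of the two arrows that send a point \<open>(x, g)\<close> of \<open>\<pi> \<times> \<G>\<close>, with \<open>g\<close> over \<open>q\<close>,
  to \<open>(x, q)\<close> and to \<open>(x \<gamma>(g), q)\<close>. Suppose that \<open>\<tau>\<close> identifies nothing else, that is, that the two
  arrows are the kernel pair of \<open>\<tau>\<close>. A point \<open>(x, q)\<close> of \<open>\<pi> \<times> Q\<close> lies in \<open>t\<^sup>*\<pi>\<^sub>T\<close> if and only if
  \<open>x\<close> fixes \<open>t(q) = \<tau>(1, q)\<close>, that is, \<open>\<tau>(x, q) = \<tau>(1, q)\<close>. By the supposition this happens if and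
  only if \<open>x = \<gamma>(g)\<close> for a \<open>g\<close> over \<open>q\<close>, and \<open>g\<close> is unique because the unit is monic. So \<open>\<G>\<close> and
  \<open>t\<^sup>*\<pi>\<^sub>T\<close> are the same subgroup of \<open>\<pi> \<times> Q\<close>. This argument works for the points of any category with
  finite limits (\<open>stabiliser_along_section\<close>).

  What has to be proved is the statement about the kernel pair. Limits and colimits of graphs are
  computed levelwise, so it may be checked on edges and on vertices, in \<open>C\<close> itself. Over the object
  of edges (or of vertices) of \<open>Q\<close> the monic unit makes \<open>\<G>\<close> a subgroup of \<open>\<pi> \<times> Q\<close>, which acts on
  \<open>\<pi> \<times> Q\<close> by translation. This action is free, so its graph is a monomorphism and is its own image;
  up to a change of variables it is the pair above. Action Barr-exactness of the slice of \<open>C\<close>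
  therefore makes the pair a kernel pair in the slice (\<open>translation_kernel_pair\<close>), and comparison of
  the coequaliser in the slice with the one in \<open>C\<close> shows that it is the kernel pair of the
  corresponding level of \<open>\<tau>\<close> (\<open>standard_kernel_pair\<close>).

  Group objects in \<open>C\<close>, in graphs and in slices are treated uniformly through their points
  with values in an arbitrary object. The stabiliser is a subgroup (\<open>subgroup_ex1\<close>), and the other
  group objects that are built from \<open>\<pi>\<close> and \<open>\<G>\<close> arise by applying functors that preserve finite
  products; \<open>functor_mul\<close> computes with their points. Since products preserve coequalisers, the translation action descends along \<open>\<tau>\<close> (\<open>quotient_action\<close>).
\<close>

section \<open>Categories with finite products\<close>

lemma in_hom: "f \<in> hom C A B \<longleftrightarrow> f \<in> Ar C \<and> Dom C f = A \<and> Cod C f = B"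
  by (simp add: hom_def)

context category
begin

lemma hom_obD: "f \<in> hom C A B \<Longrightarrow> A \<in> Ob C \<and> B \<in> Ob C"
  using dom_in_Ob cod_in_Ob by (auto simp: in_hom)

lemma comp_simps [simp]:
  assumes "f \<in> Ar C" "g \<in> Ar C" "Dom C g = Cod C f"
  shows "g \<cdot> f \<in> Ar C" "Dom C (g \<cdot> f) = Dom C f" "Cod C (g \<cdot> f) = Cod C g"
  using comp_in_hom[of f "Dom C f" "Cod C f" g "Cod C g"] assms by (auto simp: in_hom)

lemma id_simps [simp]:
  assumes "A \<in> Ob C"
  shows "Idn C A \<in> Ar C" "Dom C (Idn C A) = A" "Cod C (Idn C A) = A"
  using id_in_hom[OF assms] by (auto simp: in_hom)

lemma ob_simps [simp]:
  assumes "f \<in> Ar C"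
  shows "Dom C f \<in> Ob C" "Cod C f \<in> Ob C"
  using assms dom_in_Ob cod_in_Ob by auto

lemma comp_id_simps [simp]:
  shows "f \<in> Ar C \<Longrightarrow> Dom C f = A \<Longrightarrow> f \<cdot> Idn C A = f"
    and "f \<in> Ar C \<Longrightarrow> Cod C f = B \<Longrightarrow> Idn C B \<cdot> f = f"
  using comp_id id_comp by (auto simp: in_hom)

lemma assoc_simp [simp]:
  assumes "f \<in> Ar C" "g \<in> Ar C" "h \<in> Ar C" "Dom C g = Cod C f" "Dom C h = Cod C g"
  shows "(h \<cdot> g) \<cdot> f = h \<cdot> (g \<cdot> f)"
  using comp_assoc[of f "Dom C f" "Cod C f" g "Cod C g" h "Cod C h"] assms by (auto simp: in_hom)

text \<open>The simplifier nests composites to the right and so hides a known composite \<open>g \<circ> f = k\<close> in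
  \<open>g \<circ> (f \<circ> h)\<close>; this lemma turns it into a rule that applies there.\<close>

lemma comp_reduce:
  assumes "g \<cdot> f = k" "f \<in> Ar C" "g \<in> Ar C" "Dom C g = Cod C f" "h \<in> Ar C" "Dom C f = Cod C h"
  shows "g \<cdot> (f \<cdot> h) = k \<cdot> h"
  using assoc_simp[of h f g] assms by simp

lemma monicD:
  assumes "monic C f" "f \<cdot> g = f \<cdot> h" "g \<in> Ar C" "h \<in> Ar C"
    "Cod C g = Dom C f" "Cod C h = Dom C f" "Dom C g = Dom C h"
  shows "g = h"
proof -
  have "Dom C h \<in> Ob C" "g \<in> hom C (Dom C h) (Dom C f)" "h \<in> hom C (Dom C h) (Dom C f)"
    using assms by (auto simp: in_hom)
  then show ?thesis using assms(1,2) unfolding monic_def by blast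
qed

lemma product_ex1:
  assumes "is_product C A B P p q" "f \<in> hom C W A" "g \<in> hom C W B"
  shows "\<exists>!h. h \<in> hom C W P \<and> p \<cdot> h = f \<and> q \<cdot> h = g"
proof -
  have "W \<in> Ob C" using hom_obD assms(2) by blast
  then show ?thesis using assms unfolding is_product_def by blast
qed

lemma product_arrows:
  assumes "is_product C A B P p q"
  shows "P \<in> Ob C" "A \<in> Ob C" "B \<in> Ob C" "p \<in> Ar C" "Dom C p = P" "Cod C p = A"
    "q \<in> Ar C" "Dom C q = P" "Cod C q = B"
proof -
  have pq: "P \<in> Ob C" "p \<in> hom C P A" "q \<in> hom C P B" using assms by (simp_all add: is_product_def)
  show "P \<in> Ob C" "A \<in> Ob C" "B \<in> Ob C" using pq hom_obD by blast+
  show "p \<in> Ar C" "Dom C p = P" "Cod C p = A" "q \<in> Ar C" "Dom C q = P" "Cod C q = B"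
    using pq by (simp_all add: in_hom)
qed

lemma product_factor:
  assumes "is_product C A B P p q" "f \<in> Ar C" "g \<in> Ar C" "Dom C f = W" "Dom C g = W"
    "Cod C f = A" "Cod C g = B"
  obtains h where "h \<in> Ar C" "Dom C h = W" "Cod C h = P" "p \<cdot> h = f" "q \<cdot> h = g"
  using product_ex1[OF assms(1), of f W g] assms by (auto simp: in_hom)

lemma product_eq:
  assumes "is_product C A B P p q" "h \<in> Ar C" "k \<in> Ar C" "Dom C h = Dom C k"
    "Cod C h = P" "Cod C k = P" "p \<cdot> h = p \<cdot> k" "q \<cdot> h = q \<cdot> k"
  shows "h = k"
proof -
  note [simp] = product_arrows[OF assms(1)]
  have "\<exists>!l. l \<in> hom C (Dom C k) P \<and> p \<cdot> l = p \<cdot> k \<and> q \<cdot> l = q \<cdot> k"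
    by (rule product_ex1[OF assms(1)]) (use assms in \<open>simp_all add: in_hom\<close>)
  moreover have "h \<in> hom C (Dom C k) P" "k \<in> hom C (Dom C k) P" using assms by (simp_all add: in_hom)
  ultimately show ?thesis using assms(7,8) by blast
qed

lemma monicI:
  assumes "f \<in> Ar C"
    and "\<And>g h. g \<in> Ar C \<Longrightarrow> h \<in> Ar C \<Longrightarrow> Cod C g = Dom C f \<Longrightarrow> Cod C h = Dom C f \<Longrightarrow>
      Dom C g = Dom C h \<Longrightarrow> f \<cdot> g = f \<cdot> h \<Longrightarrow> g = h"
  shows "monic C f"
  unfolding monic_def
proof (intro conjI ballI impI)
  fix W g h assume "g \<in> hom C W (Dom C f)" "h \<in> hom C W (Dom C f)" "f \<cdot> g = f \<cdot> h"
  then show "g = h" by - (rule assms(2), simp_all add: in_hom)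
qed (rule assms(1))

lemma iso_regular_epi:
  assumes "e \<in> hom C A B" "e' \<in> hom C B A" "e \<cdot> e' = Idn C B" "e' \<cdot> e = Idn C A"
  shows "regular_epi C e"
proof -
  have [simp]: "A \<in> Ob C" "B \<in> Ob C" using hom_obD[OF assms(1)] by simp_all
  have [simp]: "e \<in> Ar C" "Dom C e = A" "Cod C e = B" "e' \<in> Ar C" "Dom C e' = B" "Cod C e' = A"
    using assms by (simp_all add: in_hom)
  have "is_coequaliser C (Idn C A) (Idn C A) e"
    unfolding is_coequaliser_def
  proof (intro conjI ballI impI)
    fix W k assume "k \<in> hom C (Cod C (Idn C A)) W"
    then have k [simp]: "k \<in> Ar C" "Dom C k = A" "Cod C k = W" by (simp_all add: in_hom)
    show "\<exists>!h. h \<in> hom C (Cod C e) W \<and> h \<cdot> e = k"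
    proof (rule ex1I[of _ "k \<cdot> e'"])
      show "k \<cdot> e' \<in> hom C (Cod C e) W \<and> k \<cdot> e' \<cdot> e = k" using assms(4) by (simp add: in_hom)
      fix h assume h: "h \<in> hom C (Cod C e) W \<and> h \<cdot> e = k"
      then have [simp]: "h \<in> Ar C" "Dom C h = B" by (simp_all add: in_hom)
      from h have "k \<cdot> e' = (h \<cdot> e) \<cdot> e'" by simp
      also have "\<dots> = h" using assms(3) by simp
      finally show "h = k \<cdot> e'" by simp
    qed
  qed (simp_all add: in_hom)
  then show ?thesis unfolding regular_epi_def by blast
qed

end

locale cartesian = category +
  assumes ex_terminal: "\<exists>T. is_terminal C T"
    and ex_product: "A \<in> Ob C \<Longrightarrow> B \<in> Ob C \<Longrightarrow> \<exists>P p q. is_product C A B P p q"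
begin

lemma terminal_chosen: "is_terminal C \<one>"
  unfolding term_ob_def using ex_terminal by (rule someI_ex)

lemma term_ob [simp]: "\<one> \<in> Ob C"
  using terminal_chosen by (simp add: is_terminal_def)

lemma bang_hom: "A \<in> Ob C \<Longrightarrow> bang C A \<in> hom C A \<one>"
  using terminal_chosen theI'[of "\<lambda>h. h \<in> hom C A \<one>"] unfolding is_terminal_def bang_def by blast

lemma bang_simps [simp]:
  assumes "A \<in> Ob C"
  shows "bang C A \<in> Ar C" "Dom C (bang C A) = A" "Cod C (bang C A) = \<one>"
  using bang_hom[OF assms] by (auto simp: in_hom)

lemma bang_unique: "f \<in> Ar C \<Longrightarrow> Cod C f = \<one> \<Longrightarrow> Dom C f = A \<Longrightarrow> f = bang C A"
proof -
  assume f: "f \<in> Ar C" "Cod C f = \<one>" "Dom C f = A"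
  then have "A \<in> Ob C" "f \<in> hom C A \<one>" by (auto simp: in_hom)
  then show ?thesis using terminal_chosen bang_hom[of A] unfolding is_terminal_def by blast
qed

lemma bang_comp [simp]:
  "f \<in> Ar C \<Longrightarrow> Cod C f = A \<Longrightarrow> bang C A \<cdot> f = bang C (Dom C f)"
  by (rule bang_unique) auto

lemma product_chosen:
  assumes "A \<in> Ob C" "B \<in> Ob C"
  shows "is_product C A B (A \<otimes> B) (pr1 C A B) (pr2 C A B)"
proof -
  have "\<exists>x. case x of (P, p, q) \<Rightarrow> is_product C A B P p q"
    using ex_product[OF assms] by auto
  from someI_ex[OF this] show ?thesis
    unfolding prod_ob_def pr1_def pr2_def chosen_prod_def by (auto split: prod.splits)
qed

lemma product_simps [simp]:
  assumes "A \<in> Ob C" "B \<in> Ob C"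
  shows "A \<otimes> B \<in> Ob C"
    "pr1 C A B \<in> Ar C" "Dom C (pr1 C A B) = A \<otimes> B" "Cod C (pr1 C A B) = A"
    "pr2 C A B \<in> Ar C" "Dom C (pr2 C A B) = A \<otimes> B" "Cod C (pr2 C A B) = B"
  using product_chosen[OF assms] unfolding is_product_def hom_def by auto

lemma pairing_prop:
  assumes "f \<in> Ar C" "g \<in> Ar C" "Dom C f = Dom C g"
  shows "\<langle>f, g\<rangle> \<in> hom C (Dom C f) (Cod C f \<otimes> Cod C g) \<and>
    pr1 C (Cod C f) (Cod C g) \<cdot> \<langle>f, g\<rangle> = f \<and> pr2 C (Cod C f) (Cod C g) \<cdot> \<langle>f, g\<rangle> = g"
proof -
  have "\<exists>!h. h \<in> hom C (Dom C f) (Cod C f \<otimes> Cod C g) \<and>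
      pr1 C (Cod C f) (Cod C g) \<cdot> h = f \<and> pr2 C (Cod C f) (Cod C g) \<cdot> h = g"
    using assms product_ex1[OF product_chosen[of "Cod C f" "Cod C g"]] by (simp only: in_hom ob_simps simp_thms)
  then show ?thesis unfolding pairing_def by (rule theI')
qed

lemma pairing_simps [simp]:
  assumes "f \<in> Ar C" "g \<in> Ar C" "Dom C f = Dom C g"
  shows "\<langle>f, g\<rangle> \<in> Ar C" "Dom C \<langle>f, g\<rangle> = Dom C g" "Cod C \<langle>f, g\<rangle> = Cod C f \<otimes> Cod C g"
  using pairing_prop[OF assms] assms(3) by (auto simp: in_hom)

lemma pr_pairing [simp]:
  assumes "f \<in> Ar C" "g \<in> Ar C" "Dom C f = Dom C g" "Cod C f = A" "Cod C g = B"
  shows "pr1 C A B \<cdot> \<langle>f, g\<rangle> = f" "pr2 C A B \<cdot> \<langle>f, g\<rangle> = g"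
  using pairing_prop[OF assms(1-3)] assms by (auto simp: in_hom)

lemma product_ext:
  assumes "h \<in> Ar C" "k \<in> Ar C" "Dom C h = Dom C k" "Cod C h = A \<otimes> B" "Cod C k = A \<otimes> B"
    "A \<in> Ob C" "B \<in> Ob C"
    "pr1 C A B \<cdot> h = pr1 C A B \<cdot> k" "pr2 C A B \<cdot> h = pr2 C A B \<cdot> k"
  shows "h = k"
proof -
  have "\<exists>!l. l \<in> hom C (Dom C h) (A \<otimes> B) \<and> pr1 C A B \<cdot> l = pr1 C A B \<cdot> k
      \<and> pr2 C A B \<cdot> l = pr2 C A B \<cdot> k"
    by (rule product_ex1[OF product_chosen]) (use assms in \<open>simp_all add: in_hom\<close>)
  moreover have "h \<in> hom C (Dom C h) (A \<otimes> B)" "k \<in> hom C (Dom C h) (A \<otimes> B)"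
    using assms by (simp_all add: in_hom)
  ultimately show ?thesis using assms(8,9) by blast
qed

lemma pairing_comp [simp]:
  assumes "f \<in> Ar C" "g \<in> Ar C" "Dom C f = Dom C g" "h \<in> Ar C" "Cod C h = Dom C g"
  shows "\<langle>f, g\<rangle> \<cdot> h = \<langle>f \<cdot> h, g \<cdot> h\<rangle>"
  by (rule product_ext[where A = "Cod C f" and B = "Cod C g"])
    (use assms in \<open>simp_all add: comp_reduce[OF pr_pairing(1)] comp_reduce[OF pr_pairing(2)]\<close>)

lemma pairing_eta [simp]:
  assumes "A \<in> Ob C" "B \<in> Ob C" "h \<in> Ar C" "Cod C h = A \<otimes> B"
  shows "\<langle>pr1 C A B \<cdot> h, pr2 C A B \<cdot> h\<rangle> = h"
  by (rule product_ext[where A = A and B = B]) (use assms in simp_all)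

lemma pairing_pr [simp]:
  assumes "A \<in> Ob C" "B \<in> Ob C"
  shows "\<langle>pr1 C A B, pr2 C A B\<rangle> = Idn C (A \<otimes> B)"
  by (rule product_ext[where A = A and B = B]) (use assms in simp_all)

lemma pairing_inject:
  assumes "\<langle>f, g\<rangle> = \<langle>f', g'\<rangle>" "f \<in> Ar C" "g \<in> Ar C" "Dom C f = Dom C g"
    "f' \<in> Ar C" "g' \<in> Ar C" "Dom C f' = Dom C g'" "Cod C f = Cod C f'" "Cod C g = Cod C g'"
  shows "f = f'" "g = g'"
  by (metis assms pr_pairing(1), metis assms pr_pairing(2))

lemma prod_ar_simps [simp]:
  assumes "f \<in> Ar C" "g \<in> Ar C"
  shows "f \<otimes>\<^sub>a g \<in> Ar C" "Dom C (f \<otimes>\<^sub>a g) = Dom C f \<otimes> Dom C g"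
    "Cod C (f \<otimes>\<^sub>a g) = Cod C f \<otimes> Cod C g"
    "A = Cod C f \<Longrightarrow> B = Cod C g \<Longrightarrow> pr1 C A B \<cdot> (f \<otimes>\<^sub>a g) = f \<cdot> pr1 C (Dom C f) (Dom C g)"
    "A = Cod C f \<Longrightarrow> B = Cod C g \<Longrightarrow> pr2 C A B \<cdot> (f \<otimes>\<^sub>a g) = g \<cdot> pr2 C (Dom C f) (Dom C g)"
  using assms unfolding prod_ar_def by simp_all

lemma prod_ar_pairing [simp]:
  assumes "f \<in> Ar C" "g \<in> Ar C" "h \<in> Ar C" "k \<in> Ar C" "Dom C h = Dom C k"
    "Cod C h = Dom C f" "Cod C k = Dom C g"
  shows "(f \<otimes>\<^sub>a g) \<cdot> \<langle>h, k\<rangle> = \<langle>f \<cdot> h, g \<cdot> k\<rangle>"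
  using assms unfolding prod_ar_def by simp

lemma prod_ar_comp [simp]:
  assumes "f \<in> Ar C" "g \<in> Ar C" "h \<in> Ar C" "Cod C h = Dom C f \<otimes> Dom C g"
  shows "(f \<otimes>\<^sub>a g) \<cdot> h
    = \<langle>f \<cdot> (pr1 C (Dom C f) (Dom C g) \<cdot> h), g \<cdot> (pr2 C (Dom C f) (Dom C g) \<cdot> h)\<rangle>"
  using assms unfolding prod_ar_def by simp

lemma assoc_simps [simp]:
  assumes "A \<in> Ob C" "B \<in> Ob C" "X \<in> Ob C"
  shows "assoc C A B X \<in> Ar C" "Dom C (assoc C A B X) = A \<otimes> (B \<otimes> X)"
    "Cod C (assoc C A B X) = (A \<otimes> B) \<otimes> X"
  using assms unfolding assoc_def by simp_all

lemma assoc_pairing [simp]: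
  assumes "f \<in> Ar C" "g \<in> Ar C" "h \<in> Ar C" "Dom C f = Dom C h" "Dom C g = Dom C h"
    "Cod C f = A" "Cod C g = B" "Cod C h = X"
  shows "assoc C A B X \<cdot> \<langle>f, \<langle>g, h\<rangle>\<rangle> = \<langle>\<langle>f, g\<rangle>, h\<rangle>"
proof -
  have "A \<in> Ob C" "B \<in> Ob C" "X \<in> Ob C" using assms by auto
  then show ?thesis using assms unfolding assoc_def by simp
qed

end

section \<open>Group objects and actions through generalised elements\<close>

context cartesian
begin

lemma group_arrows [simp]:
  assumes "is_group C G"
  shows "gob G \<in> Ob C"
    "gmul G \<in> Ar C" "Dom C (gmul G) = gob G \<otimes> gob G" "Cod C (gmul G) = gob G"
    "ginv G \<in> Ar C" "Dom C (ginv G) = gob G" "Cod C (ginv G) = gob G"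
    "gone G \<in> Ar C" "Dom C (gone G) = \<one>" "Cod C (gone G) = gob G"
  using assms unfolding is_group_def Let_def by (simp_all add: in_hom)

text \<open>The axioms of a group object are equations between arrows out of powers of \<open>G\<close>. They are
  equivalent to the group laws for the points \<open>W \<rightarrow> G\<close>: one direction is composition with a tuple
  of points, the other is the case of the projections.\<close>

lemma mul_assoc:
  assumes "is_group C G" "x \<in> Ar C" "y \<in> Ar C" "z \<in> Ar C" "Dom C x = Dom C z" "Dom C y = Dom C z"
    "Cod C x = gob G" "Cod C y = gob G" "Cod C z = gob G"
  shows "gmul G \<cdot> \<langle>gmul G \<cdot> \<langle>x, y\<rangle>, z\<rangle> = gmul G \<cdot> \<langle>x, gmul G \<cdot> \<langle>y, z\<rangle>\<rangle>"
proof -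
  let ?m = "gmul G" and ?I = "Idn C (gob G)"
  have "?m \<cdot> (?m \<otimes>\<^sub>a ?I) \<cdot> assoc C (gob G) (gob G) (gob G) = ?m \<cdot> (?I \<otimes>\<^sub>a ?m)"
    using assms(1) unfolding is_group_def Let_def by simp
  from arg_cong[OF this, of "\<lambda>h. h \<cdot> \<langle>x, \<langle>y, z\<rangle>\<rangle>"] show ?thesis using assms by simp
qed

lemma mul_unit_inv:
  assumes "is_group C G" "x \<in> Ar C" "Cod C x = gob G" "Dom C x = W"
  shows "gmul G \<cdot> \<langle>gone G \<cdot> bang C W, x\<rangle> = x" "gmul G \<cdot> \<langle>x, gone G \<cdot> bang C W\<rangle> = x"
    "gmul G \<cdot> \<langle>ginv G \<cdot> x, x\<rangle> = gone G \<cdot> bang C W"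
    "gmul G \<cdot> \<langle>x, ginv G \<cdot> x\<rangle> = gone G \<cdot> bang C W"
proof -
  let ?m = "gmul G" and ?I = "Idn C (gob G)" and ?i = "ginv G"
    and ?u = "gone G \<cdot> bang C (gob G)"
  have laws: "?m \<cdot> \<langle>?u, ?I\<rangle> = ?I" "?m \<cdot> \<langle>?I, ?u\<rangle> = ?I" "?m \<cdot> \<langle>?i, ?I\<rangle> = ?u" "?m \<cdot> \<langle>?I, ?i\<rangle> = ?u"
    using assms(1) unfolding is_group_def Let_def by simp_all
  note precomp = arg_cong[where f = "\<lambda>h. h \<cdot> x"]
  from precomp[OF laws(1)] show "gmul G \<cdot> \<langle>gone G \<cdot> bang C W, x\<rangle> = x" using assms by simp
  from precomp[OF laws(2)] show "gmul G \<cdot> \<langle>x, gone G \<cdot> bang C W\<rangle> = x" using assms by simp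
  from precomp[OF laws(3)] show "gmul G \<cdot> \<langle>ginv G \<cdot> x, x\<rangle> = gone G \<cdot> bang C W" using assms by simp
  from precomp[OF laws(4)] show "gmul G \<cdot> \<langle>x, ginv G \<cdot> x\<rangle> = gone G \<cdot> bang C W" using assms by simp
qed

lemma is_groupI:
  assumes ob: "gob G \<in> Ob C"
    and mul: "gmul G \<in> hom C (gob G \<otimes> gob G) (gob G)"
    and inv: "ginv G \<in> hom C (gob G) (gob G)"
    and one: "gone G \<in> hom C \<one> (gob G)"
    and assoc: "\<And>W x y z. x \<in> hom C W (gob G) \<Longrightarrow> y \<in> hom C W (gob G) \<Longrightarrow> z \<in> hom C W (gob G) \<Longrightarrow>
      gmul G \<cdot> \<langle>gmul G \<cdot> \<langle>x, y\<rangle>, z\<rangle> = gmul G \<cdot> \<langle>x, gmul G \<cdot> \<langle>y, z\<rangle>\<rangle>"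
    and laws: "\<And>W x. x \<in> hom C W (gob G) \<Longrightarrow>
      gmul G \<cdot> \<langle>gone G \<cdot> bang C W, x\<rangle> = x \<and> gmul G \<cdot> \<langle>x, gone G \<cdot> bang C W\<rangle> = x \<and>
      gmul G \<cdot> \<langle>ginv G \<cdot> x, x\<rangle> = gone G \<cdot> bang C W \<and>
      gmul G \<cdot> \<langle>x, ginv G \<cdot> x\<rangle> = gone G \<cdot> bang C W"
  shows "is_group C G"
proof -
  let ?A = "gob G"
  have typed: "gmul G \<in> Ar C" "Dom C (gmul G) = ?A \<otimes> ?A" "Cod C (gmul G) = ?A"
    "ginv G \<in> Ar C" "Dom C (ginv G) = ?A" "Cod C (ginv G) = ?A"
    "gone G \<in> Ar C" "Dom C (gone G) = \<one>" "Cod C (gone G) = ?A"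
    using mul inv one by (simp_all add: in_hom)
  have "gmul G \<cdot> (gmul G \<otimes>\<^sub>a Idn C ?A) \<cdot> assoc C ?A ?A ?A = gmul G \<cdot> (Idn C ?A \<otimes>\<^sub>a gmul G)"
  proof -
    let ?p = "pr1 C ?A (?A \<otimes> ?A)" and ?q = "pr1 C ?A ?A \<cdot> pr2 C ?A (?A \<otimes> ?A)"
      and ?r = "pr2 C ?A ?A \<cdot> pr2 C ?A (?A \<otimes> ?A)"
    show ?thesis
      using assoc[of ?p "?A \<otimes> (?A \<otimes> ?A)" ?q ?r] ob typed
      unfolding prod_ar_def assoc_def by (simp add: in_hom)
  qed
  moreover note laws[of "Idn C ?A" ?A]
  ultimately show ?thesis
    unfolding is_group_def Let_def using ob typed by (simp add: in_hom)
qed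

text \<open>Composition with the inverse point solves equations between points for an unknown.\<close>

lemma mul_cancel:
  assumes "is_group C G" "x \<in> Ar C" "y \<in> Ar C" "z \<in> Ar C" "Dom C x = Dom C z" "Dom C y = Dom C z"
    "Cod C x = gob G" "Cod C y = gob G" "Cod C z = gob G"
    and eq: "gmul G \<cdot> \<langle>x, y\<rangle> = gmul G \<cdot> \<langle>x, z\<rangle>"
  shows "y = z"
proof -
  have "gmul G \<cdot> \<langle>ginv G \<cdot> x, gmul G \<cdot> \<langle>x, w\<rangle>\<rangle> = w"
    if "w \<in> Ar C" "Dom C w = Dom C z" "Cod C w = gob G" for w
    using mul_assoc[of G "ginv G \<cdot> x" x w, symmetric] that assms by (simp add: mul_unit_inv)
  from this[of y] this[of z] show ?thesis using assms by metis
qed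

lemma group_hom_arrows:
  assumes "is_group_hom C (GrpAr G H f)"
  shows "is_group C G" "is_group C H" "f \<in> Ar C" "Dom C f = gob G" "Cod C f = gob H"
  using assms unfolding is_group_hom_def Let_def by (simp_all add: in_hom)

lemma group_hom_mul:
  assumes "is_group_hom C (GrpAr G H f)" "x \<in> Ar C" "y \<in> Ar C" "Dom C x = Dom C y"
    "Cod C x = gob G" "Cod C y = gob G"
  shows "f \<cdot> (gmul G \<cdot> \<langle>x, y\<rangle>) = gmul H \<cdot> \<langle>f \<cdot> x, f \<cdot> y\<rangle>"
proof -
  note [simp] = group_hom_arrows[OF assms(1)]
  have "f \<cdot> gmul G = gmul H \<cdot> (f \<otimes>\<^sub>a f)" using assms(1) unfolding is_group_hom_def Let_def by simp
  from arg_cong[OF this, of "\<lambda>h. h \<cdot> \<langle>x, y\<rangle>"] show ?thesis using assms by simp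
qed

lemma group_hom_unit_inv:
  assumes "is_group_hom C (GrpAr G H f)"
  shows "f \<cdot> gone G = gone H" "f \<cdot> ginv G = ginv H \<cdot> f"
  using assms unfolding is_group_hom_def Let_def by simp_all

text \<open>As for abstract groups, an arrow that respects multiplication respects units and inverses.\<close>

lemma is_group_homI:
  assumes G: "is_group C G" and H: "is_group C H" and f: "f \<in> hom C (gob G) (gob H)"
    and mul: "\<And>W x y. x \<in> hom C W (gob G) \<Longrightarrow> y \<in> hom C W (gob G) \<Longrightarrow>
      f \<cdot> (gmul G \<cdot> \<langle>x, y\<rangle>) = gmul H \<cdot> \<langle>f \<cdot> x, f \<cdot> y\<rangle>"
  shows "is_group_hom C (GrpAr G H f)"
proof -
  let ?A = "gob G"
  note [simp] = G H
  have ft [simp]: "f \<in> Ar C" "Dom C f = ?A" "Cod C f = gob H"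
    using f by (simp_all add: in_hom)
  have "f \<cdot> gmul G = gmul H \<cdot> (f \<otimes>\<^sub>a f)"
    using mul[of "pr1 C ?A ?A" "?A \<otimes> ?A" "pr2 C ?A ?A"] unfolding prod_ar_def by (simp add: in_hom)
  moreover
  \<comment> \<open>The image of the unit is idempotent.\<close>
  have unit: "f \<cdot> (gone G \<cdot> bang C W) = gone H \<cdot> bang C W" if "W \<in> Ob C" for W
  proof (rule mul_cancel[OF H])
    let ?e = "gone G \<cdot> bang C W"
    have "f \<cdot> ?e = f \<cdot> (gmul G \<cdot> \<langle>?e, ?e\<rangle>)" using that by (simp add: mul_unit_inv)
    also have "\<dots> = gmul H \<cdot> \<langle>f \<cdot> ?e, f \<cdot> ?e\<rangle>" using that by (intro mul) (simp_all add: in_hom)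
    finally show "gmul H \<cdot> \<langle>f \<cdot> ?e, f \<cdot> ?e\<rangle> = gmul H \<cdot> \<langle>f \<cdot> ?e, gone H \<cdot> bang C W\<rangle>"
      using that by (simp add: mul_unit_inv)
  qed (use that in simp_all)
  have "bang C \<one> = Idn C \<one>" by (rule bang_unique[symmetric]) simp_all
  then have "f \<cdot> gone G = gone H" using unit[of \<one>] by simp
  moreover have "f \<cdot> ginv G = ginv H \<cdot> f"
  proof (rule mul_cancel[OF H])
    have "gmul H \<cdot> \<langle>f, f \<cdot> ginv G\<rangle> = f \<cdot> (gmul G \<cdot> \<langle>Idn C ?A, ginv G\<rangle>)"
      using mul[of "Idn C ?A" ?A "ginv G"] by (simp add: in_hom)
    also have "\<dots> = gone H \<cdot> bang C ?A"
      using mul_unit_inv(4)[OF G, of "Idn C ?A"] unit[of ?A] by simp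
    finally show "gmul H \<cdot> \<langle>f, f \<cdot> ginv G\<rangle> = gmul H \<cdot> \<langle>f, ginv H \<cdot> f\<rangle>"
      by (simp add: mul_unit_inv)
  qed simp_all
  ultimately show ?thesis unfolding is_group_hom_def Let_def using f by simp
qed

lemma is_actionI:
  assumes G: "is_group C G" and X: "X \<in> Ob C" and a: "a \<in> hom C (gob G \<otimes> X) X"
    and mul: "\<And>W g h x. g \<in> hom C W (gob G) \<Longrightarrow> h \<in> hom C W (gob G) \<Longrightarrow> x \<in> hom C W X \<Longrightarrow>
      a \<cdot> \<langle>gmul G \<cdot> \<langle>g, h\<rangle>, x\<rangle> = a \<cdot> \<langle>g, a \<cdot> \<langle>h, x\<rangle>\<rangle>"
    and unit: "\<And>W x. x \<in> hom C W X \<Longrightarrow> a \<cdot> \<langle>gone G \<cdot> bang C W, x\<rangle> = x"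
  shows "is_action C G X a"
proof -
  let ?A = "gob G"
  note [simp] = G X
  have at [simp]: "a \<in> Ar C" "Dom C a = ?A \<otimes> X" "Cod C a = X" using a by (simp_all add: in_hom)
  let ?p = "pr1 C ?A (?A \<otimes> X)" and ?q = "pr1 C ?A X \<cdot> pr2 C ?A (?A \<otimes> X)"
    and ?r = "pr2 C ?A X \<cdot> pr2 C ?A (?A \<otimes> X)"
  have "a \<cdot> (gmul G \<otimes>\<^sub>a Idn C X) \<cdot> assoc C ?A ?A X = a \<cdot> (Idn C ?A \<otimes>\<^sub>a a)"
    using mul[of ?p "?A \<otimes> (?A \<otimes> X)" ?q ?r]
    unfolding prod_ar_def assoc_def by (simp add: in_hom)
  moreover have "a \<cdot> \<langle>gone G \<cdot> bang C X, Idn C X\<rangle> = Idn C X"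
    using unit[of "Idn C X" X] by (simp add: in_hom)
  ultimately show ?thesis unfolding is_action_def using a by simp
qed

lemma action_el:
  assumes act: "is_action C G X a"
  shows "is_group C G" "X \<in> Ob C" "a \<in> Ar C" "Dom C a = gob G \<otimes> X" "Cod C a = X"
    and "\<And>g h x. g \<in> Ar C \<Longrightarrow> h \<in> Ar C \<Longrightarrow> x \<in> Ar C \<Longrightarrow> Dom C g = Dom C x \<Longrightarrow> Dom C h = Dom C x \<Longrightarrow>
      Cod C g = gob G \<Longrightarrow> Cod C h = gob G \<Longrightarrow> Cod C x = X \<Longrightarrow>
      a \<cdot> \<langle>gmul G \<cdot> \<langle>g, h\<rangle>, x\<rangle> = a \<cdot> \<langle>g, a \<cdot> \<langle>h, x\<rangle>\<rangle>"
    and "\<And>x W. x \<in> Ar C \<Longrightarrow> Cod C x = X \<Longrightarrow> Dom C x = W \<Longrightarrow> a \<cdot> \<langle>gone G \<cdot> bang C W, x\<rangle> = x"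
proof -
  show [simp]: "is_group C G" "X \<in> Ob C" "a \<in> Ar C" "Dom C a = gob G \<otimes> X" "Cod C a = X"
    using act by (simp_all add: is_action_def in_hom)
  have mul: "a \<cdot> (gmul G \<otimes>\<^sub>a Idn C X) \<cdot> assoc C (gob G) (gob G) X = a \<cdot> (Idn C (gob G) \<otimes>\<^sub>a a)"
    and unit: "a \<cdot> \<langle>gone G \<cdot> bang C X, Idn C X\<rangle> = Idn C X"
    using act by (simp_all only: is_action_def)
  show "a \<cdot> \<langle>gmul G \<cdot> \<langle>g, h\<rangle>, x\<rangle> = a \<cdot> \<langle>g, a \<cdot> \<langle>h, x\<rangle>\<rangle>"
    if "g \<in> Ar C" "h \<in> Ar C" "x \<in> Ar C" "Dom C g = Dom C x" "Dom C h = Dom C x"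
      "Cod C g = gob G" "Cod C h = gob G" "Cod C x = X" for g h x
    using arg_cong[OF mul, of "\<lambda>z. z \<cdot> \<langle>g, \<langle>h, x\<rangle>\<rangle>"] that by simp
  show "a \<cdot> \<langle>gone G \<cdot> bang C W, x\<rangle> = x" if "x \<in> Ar C" "Cod C x = X" "Dom C x = W" for x W
    using arg_cong[OF unit, of "\<lambda>z. z \<cdot> x"] that by simp
qed

text \<open>The multiplication on the subobject is the factorisation of the product of the two projections;
  the laws, and uniqueness, hold because they hold after composition with the monomorphism \<open>i\<close>.\<close>

lemma subgroup_ex1:
  assumes H: "is_group C H" and i: "monic C i" "Cod C i = gob H"
    and mul: "\<And>W x y. x \<in> hom C W (Dom C i) \<Longrightarrow> y \<in> hom C W (Dom C i) \<Longrightarrow>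
      \<exists>z \<in> hom C W (Dom C i). i \<cdot> z = gmul H \<cdot> \<langle>i \<cdot> x, i \<cdot> y\<rangle>"
    and inv: "\<And>W x. x \<in> hom C W (Dom C i) \<Longrightarrow> \<exists>z \<in> hom C W (Dom C i). i \<cdot> z = ginv H \<cdot> (i \<cdot> x)"
    and one: "\<exists>z \<in> hom C \<one> (Dom C i). i \<cdot> z = gone H"
  shows "\<exists>!S. is_group C S \<and> gob S = Dom C i \<and> is_group_hom C (GrpAr S H i)"
proof (rule ex_ex1I)
  define A where "A = Dom C i"
  have iAr: "i \<in> Ar C" using i(1) by (simp add: monic_def)
  then have A [simp]: "A \<in> Ob C" and it [simp]: "i \<in> Ar C" "Dom C i = A" "Cod C i = gob H"
    using i(2) by (simp_all add: A_def)
  note [simp] = H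
  obtain m where m: "m \<in> hom C (A \<otimes> A) A" "i \<cdot> m = gmul H \<cdot> \<langle>i \<cdot> pr1 C A A, i \<cdot> pr2 C A A\<rangle>"
    using mul[of "pr1 C A A" "A \<otimes> A" "pr2 C A A"] by (auto simp: in_hom)
  obtain v where v: "v \<in> hom C A A" "i \<cdot> v = ginv H \<cdot> i"
    using inv[of "Idn C A" A] by (auto simp: in_hom)
  obtain e where e: "e \<in> hom C \<one> A" "i \<cdot> e = gone H"
    using one by (auto simp: in_hom)
  have mt [simp]: "m \<in> Ar C" "Dom C m = A \<otimes> A" "Cod C m = A"
    and vt [simp]: "v \<in> Ar C" "Dom C v = A" "Cod C v = A"
    and et [simp]: "e \<in> Ar C" "Dom C e = \<one>" "Cod C e = A"
    using m(1) v(1) e(1) by (simp_all add: in_hom)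
  have im [simp]: "i \<cdot> (m \<cdot> \<langle>x, y\<rangle>) = gmul H \<cdot> \<langle>i \<cdot> x, i \<cdot> y\<rangle>"
    if "x \<in> Ar C" "y \<in> Ar C" "Dom C x = Dom C y" "Cod C x = A" "Cod C y = A" for x y
    using that by (simp add: comp_reduce[OF m(2)])
  have iv [simp]: "i \<cdot> (v \<cdot> x) = ginv H \<cdot> (i \<cdot> x)" if "x \<in> Ar C" "Cod C x = A" for x
    using that by (simp add: comp_reduce[OF v(2)])
  have ie [simp]: "i \<cdot> (e \<cdot> x) = gone H \<cdot> x" if "x \<in> Ar C" "Cod C x = \<one>" for x
    using that by (simp add: comp_reduce[OF e(2)])
  have cancel: "x = y" if "i \<cdot> x = i \<cdot> y" "x \<in> Ar C" "y \<in> Ar C" "Cod C x = A" "Cod C y = A"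
    "Dom C x = Dom C y" for x y
    using monicD[OF i(1) that(1)] that by simp
  let ?S = "Grp A m v e"
  have S: "is_group C ?S"
  proof (rule is_groupI)
    fix W x y z assume "x \<in> hom C W (gob ?S)" "y \<in> hom C W (gob ?S)" "z \<in> hom C W (gob ?S)"
    then show "gmul ?S \<cdot> \<langle>gmul ?S \<cdot> \<langle>x, y\<rangle>, z\<rangle> = gmul ?S \<cdot> \<langle>x, gmul ?S \<cdot> \<langle>y, z\<rangle>\<rangle>"
      by - (rule cancel, simp_all add: in_hom mul_assoc)
  next
    fix W x assume x: "x \<in> hom C W (gob ?S)"
    then have "W \<in> Ob C" using hom_obD by blast
    with x show "gmul ?S \<cdot> \<langle>gone ?S \<cdot> bang C W, x\<rangle> = x \<and> gmul ?S \<cdot> \<langle>x, gone ?S \<cdot> bang C W\<rangle> = x \<and>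
        gmul ?S \<cdot> \<langle>ginv ?S \<cdot> x, x\<rangle> = gone ?S \<cdot> bang C W \<and>
        gmul ?S \<cdot> \<langle>x, ginv ?S \<cdot> x\<rangle> = gone ?S \<cdot> bang C W"
      by - (intro conjI; rule cancel; simp add: in_hom mul_unit_inv)
  qed (simp_all add: in_hom)
  moreover have "is_group_hom C (GrpAr ?S H i)"
    by (rule is_group_homI[OF S]) (simp_all add: in_hom)
  ultimately show "\<exists>S. is_group C S \<and> gob S = Dom C i \<and> is_group_hom C (GrpAr S H i)"
    by (intro exI[of _ ?S]) simp
next
  fix S S'
  assume S: "is_group C S \<and> gob S = Dom C i \<and> is_group_hom C (GrpAr S H i)"
    and S': "is_group C S' \<and> gob S' = Dom C i \<and> is_group_hom C (GrpAr S' H i)"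
  define A where "A = Dom C i"
  have iAr: "i \<in> Ar C" using i(1) by (simp add: monic_def)
  note [simp] = H iAr i(2) S[THEN conjunct1] S'[THEN conjunct1] A_def[symmetric]
  have A [simp]: "A \<in> Ob C" "gob S = A" "gob S' = A" using ob_simps(1)[OF iAr] S S' by simp_all
  note hom = conjunct2[OF conjunct2[OF S]] and hom' = conjunct2[OF conjunct2[OF S']]
  have "gmul S = gmul S'"
    by (rule monicD[OF i(1)])
      (use group_hom_mul[OF hom, of "pr1 C A A" "pr2 C A A"]
        group_hom_mul[OF hom', of "pr1 C A A" "pr2 C A A"] in simp_all)
  moreover have "ginv S = ginv S'"
    by (rule monicD[OF i(1)])
      (use group_hom_unit_inv[OF hom] group_hom_unit_inv[OF hom'] in simp_all)
  moreover have "gone S = gone S'"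
    by (rule monicD[OF i(1)])
      (use group_hom_unit_inv[OF hom] group_hom_unit_inv[OF hom'] in simp_all)
  ultimately show "S = S'" by (cases S; cases S') (use A in simp)
qed

text \<open>That \<open>f\<close> is multiplicative may be checked after composition with the monomorphism \<open>j\<close>.\<close>

lemma group_hom_factor:
  assumes u: "is_group_hom C (GrpAr G H u)" and j: "is_group_hom C (GrpAr S H j)" "monic C j"
    and f: "f \<in> hom C (gob G) (gob S)" "j \<cdot> f = u"
  shows "is_group_hom C (GrpAr G S f)"
proof (rule is_group_homI)
  note [simp] = group_hom_arrows[OF u] group_hom_arrows[OF j(1)]
  have ft [simp]: "f \<in> Ar C" "Dom C f = gob G" "Cod C f = gob S" using f(1) by (simp_all add: in_hom)
  have jf: "j \<cdot> (f \<cdot> x) = u \<cdot> x" if "x \<in> Ar C" "Cod C x = gob G" for x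
    using that by (simp add: comp_reduce[OF f(2)])
  fix W x y assume xy: "x \<in> hom C W (gob G)" "y \<in> hom C W (gob G)"
  then have "j \<cdot> (f \<cdot> (gmul G \<cdot> \<langle>x, y\<rangle>)) = j \<cdot> (gmul S \<cdot> \<langle>f \<cdot> x, f \<cdot> y\<rangle>)"
    by (simp add: in_hom jf group_hom_mul[OF u] group_hom_mul[OF j(1)])
  then show "f \<cdot> (gmul G \<cdot> \<langle>x, y\<rangle>) = gmul S \<cdot> \<langle>f \<cdot> x, f \<cdot> y\<rangle>"
    by (rule monicD[OF j(2)]) (use xy in \<open>simp_all add: in_hom\<close>)
qed (use f group_hom_arrows[OF u] group_hom_arrows[OF j(1)] in simp_all)

end

section \<open>Free actions by translation are effective\<close>

context cartesian
begin

lemma mul_inv_cancel: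
  assumes "is_group C G" "x \<in> Ar C" "y \<in> Ar C" "Dom C x = Dom C y" "Cod C x = gob G" "Cod C y = gob G"
  shows "gmul G \<cdot> \<langle>gmul G \<cdot> \<langle>x, y\<rangle>, ginv G \<cdot> y\<rangle> = x"
    "gmul G \<cdot> \<langle>gmul G \<cdot> \<langle>x, ginv G \<cdot> y\<rangle>, y\<rangle> = x"
    "gmul G \<cdot> \<langle>ginv G \<cdot> x, gmul G \<cdot> \<langle>x, y\<rangle>\<rangle> = y"
    "gmul G \<cdot> \<langle>x, gmul G \<cdot> \<langle>ginv G \<cdot> x, y\<rangle>\<rangle> = y"
proof -
  define W where "W = Dom C y"
  have [simp]: "Dom C x = W" "Dom C y = W" using assms by (simp_all add: W_def)
  note [simp] = assms(1,2,3,5,6)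
  show "gmul G \<cdot> \<langle>gmul G \<cdot> \<langle>x, y\<rangle>, ginv G \<cdot> y\<rangle> = x"
    "gmul G \<cdot> \<langle>gmul G \<cdot> \<langle>x, ginv G \<cdot> y\<rangle>, y\<rangle> = x"
    by (simp_all add: mul_assoc mul_unit_inv)
  show "gmul G \<cdot> \<langle>ginv G \<cdot> x, gmul G \<cdot> \<langle>x, y\<rangle>\<rangle> = y"
    "gmul G \<cdot> \<langle>x, gmul G \<cdot> \<langle>ginv G \<cdot> x, y\<rangle>\<rangle> = y"
    by (simp_all add: mul_assoc[symmetric] mul_unit_inv)
qed

lemma inv_mul:
  assumes "is_group C G" "x \<in> Ar C" "y \<in> Ar C" "Dom C x = Dom C y" "Cod C x = gob G" "Cod C y = gob G"
  shows "ginv G \<cdot> (gmul G \<cdot> \<langle>x, y\<rangle>) = gmul G \<cdot> \<langle>ginv G \<cdot> y, ginv G \<cdot> x\<rangle>"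
  by (rule mul_cancel[OF assms(1), of "gmul G \<cdot> \<langle>x, y\<rangle>"])
    (use assms in \<open>simp_all add: mul_unit_inv mul_assoc mul_inv_cancel\<close>)

lemma inv_unit:
  assumes "is_group C G" "W \<in> Ob C"
  shows "ginv G \<cdot> (gone G \<cdot> bang C W) = gone G \<cdot> bang C W"
proof -
  let ?e = "gone G \<cdot> bang C W"
  have "ginv G \<cdot> ?e = gmul G \<cdot> \<langle>?e, ginv G \<cdot> ?e\<rangle>"
    by (rule mul_unit_inv(1)[symmetric]) (use assms in simp_all)
  also have "\<dots> = ?e" by (rule mul_unit_inv(4)) (use assms in simp_all)
  finally show ?thesis .
qed

text \<open>The two arrows send \<open>(g, h)\<close> to \<open>h\<close> and to \<open>h u(g)\<close>. The left action \<open>(g, h) \<mapsto> h u(g)\<^sup>-\<^sup>1\<close> of \<open>G\<close>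
  on \<open>H\<close> has the same graph, up to the change of variables that sends \<open>(g, h)\<close> to \<open>(g, h u(g)\<^sup>-\<^sup>1)\<close>.
  Since \<open>u\<close> is monic, the action is free and the pair is jointly monic. So the pair is already the image in
  the exactness axiom: the change of variables \<open>e\<close> is an isomorphism, hence a regular
  epimorphism.\<close>

lemma translation_kernel_pair:
  assumes exact: "action_barr_exact C" and u: "is_group_hom C (GrpAr G H u)" and mono: "monic C u"
    and R: "is_product C (gob G) (gob H) R \<rho> \<sigma>"
  shows "\<exists>q. is_coequaliser C \<sigma> (gmul H \<cdot> \<langle>\<sigma>, u \<cdot> \<rho>\<rangle>) q \<and> is_pullback C q q R \<sigma> (gmul H \<cdot> \<langle>\<sigma>, u \<cdot> \<rho>\<rangle>)"
proof -
  note [simp] = group_hom_arrows[OF u] product_arrows[OF R]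
  note laws = mul_assoc mul_unit_inv mul_inv_cancel inv_mul inv_unit group_hom_mul[OF u]
  let ?G = "gob G" and ?H = "gob H" and ?s = "gmul H \<cdot> \<langle>\<sigma>, u \<cdot> \<rho>\<rangle>"
  define a where "a = gmul H \<cdot> \<langle>pr2 C ?G ?H, ginv H \<cdot> (u \<cdot> pr1 C ?G ?H)\<rangle>"
  have [simp]: "a \<in> Ar C" "Dom C a = ?G \<otimes> ?H" "Cod C a = ?H" by (simp_all add: a_def)
  have a_el [simp]: "a \<cdot> \<langle>g, h\<rangle> = gmul H \<cdot> \<langle>h, ginv H \<cdot> (u \<cdot> g)\<rangle>"
    if "g \<in> Ar C" "h \<in> Ar C" "Dom C g = Dom C h" "Cod C g = ?G" "Cod C h = ?H" for g h
    using that by (simp add: a_def)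
  have act: "is_action C G ?H a"
  proof (rule is_actionI)
    fix W x assume x: "x \<in> hom C W ?H"
    have "W \<in> Ob C" using hom_obD[OF x] by simp
    moreover have "u \<cdot> (gone G \<cdot> bang C W) = gone H \<cdot> bang C W" if "W \<in> Ob C"
      using that by (simp add: comp_reduce[OF group_hom_unit_inv(1)[OF u]])
    ultimately show "a \<cdot> \<langle>gone G \<cdot> bang C W, x\<rangle> = x" using x by (simp add: in_hom laws)
  next
    fix W g h x assume "g \<in> hom C W ?G" "h \<in> hom C W ?G" "x \<in> hom C W ?H"
    then show "a \<cdot> \<langle>gmul G \<cdot> \<langle>g, h\<rangle>, x\<rangle> = a \<cdot> \<langle>g, a \<cdot> \<langle>h, x\<rangle>\<rangle>"
      by (simp add: in_hom laws)
  qed (simp_all add: in_hom)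
  obtain e where e [simp]: "e \<in> Ar C" "Dom C e = ?G \<otimes> ?H" "Cod C e = R"
    and e_eq [simp]: "\<rho> \<cdot> e = pr1 C ?G ?H" "\<sigma> \<cdot> e = a"
    by (rule product_factor[OF R, of "pr1 C ?G ?H" a "?G \<otimes> ?H"]) simp_all
  have s_e: "?s \<cdot> e = pr2 C ?G ?H"
    by (simp add: a_def laws)
  have epi: "regular_epi C e"
  proof (rule iso_regular_epi)
    show "e \<cdot> \<langle>\<rho>, ?s\<rangle> = Idn C R"
      by (rule product_eq[OF R]) (simp_all add: comp_reduce[OF e_eq(1)] comp_reduce[OF e_eq(2)] laws)
    show "\<langle>\<rho>, ?s\<rangle> \<cdot> e = Idn C (?G \<otimes> ?H)" using s_e by simp
  qed (simp_all add: in_hom)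
  let ?r = "\<langle>\<sigma>, ?s\<rangle>"
  have mono_r: "monic C ?r"
  proof (rule monicI)
    fix g h assume gh [simp]: "g \<in> Ar C" "h \<in> Ar C" and
      cod: "Cod C g = Dom C ?r" "Cod C h = Dom C ?r" and dom: "Dom C g = Dom C h"
      and eq: "?r \<cdot> g = ?r \<cdot> h"
    have [simp]: "Cod C g = R" "Cod C h = R" using cod by simp_all
    have eq': "\<langle>\<sigma> \<cdot> g, gmul H \<cdot> \<langle>\<sigma> \<cdot> g, u \<cdot> (\<rho> \<cdot> g)\<rangle>\<rangle> = \<langle>\<sigma> \<cdot> h, gmul H \<cdot> \<langle>\<sigma> \<cdot> h, u \<cdot> (\<rho> \<cdot> h)\<rangle>\<rangle>"
      using eq by simp
    have \<sigma>: "\<sigma> \<cdot> g = \<sigma> \<cdot> h" by (rule pairing_inject(1)[OF eq']) (simp_all add: dom)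
    have "gmul H \<cdot> \<langle>\<sigma> \<cdot> g, u \<cdot> (\<rho> \<cdot> g)\<rangle> = gmul H \<cdot> \<langle>\<sigma> \<cdot> h, u \<cdot> (\<rho> \<cdot> h)\<rangle>"
      by (rule pairing_inject(2)[OF eq']) (simp_all add: dom)
    then have "u \<cdot> (\<rho> \<cdot> g) = u \<cdot> (\<rho> \<cdot> h)"
      unfolding \<sigma> by - (rule mul_cancel[of H "\<sigma> \<cdot> h"], simp_all add: dom)
    then have "\<rho> \<cdot> g = \<rho> \<cdot> h" by (rule monicD[OF mono]) (simp_all add: dom)
    then show "g = h" using \<sigma> by - (rule product_eq[OF R], simp_all add: dom)
  qed simp
  have "?r \<cdot> e = \<langle>a, pr2 C ?G ?H\<rangle>" using s_e by simp
  then have "\<exists>q. is_coequaliser C (pr1 C ?H ?H \<cdot> ?r) (pr2 C ?H ?H \<cdot> ?r) q \<and>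
      is_pullback C q q (Dom C ?r) (pr1 C ?H ?H \<cdot> ?r) (pr2 C ?H ?H \<cdot> ?r)"
    using exact[unfolded action_barr_exact_def Let_def, THEN conjunct2, rule_format, of G ?H a e ?r]
      act epi mono_r by simp
  then show ?thesis by simp
qed

end

section \<open>Pullbacks, equalisers and coequalisers\<close>

context category
begin

lemma pullback_arrows:
  assumes "is_pullback C f g P p q"
  shows "f \<in> Ar C" "g \<in> Ar C" "Cod C f = Cod C g" "P \<in> Ob C" "p \<in> Ar C" "Dom C p = P" "Cod C p = Dom C f"
    "q \<in> Ar C" "Dom C q = P" "Cod C q = Dom C g" "f \<cdot> p = g \<cdot> q"
  using assms unfolding is_pullback_def by (simp_all add: in_hom)

lemma pullback_factor:
  assumes "is_pullback C f g P p q" "k \<in> Ar C" "l \<in> Ar C" "Dom C k = W" "Dom C l = W"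
    "Cod C k = Dom C f" "Cod C l = Dom C g" "f \<cdot> k = g \<cdot> l"
  obtains h where "h \<in> Ar C" "Dom C h = W" "Cod C h = P" "p \<cdot> h = k" "q \<cdot> h = l"
proof -
  have "W \<in> Ob C" "k \<in> hom C W (Dom C f)" "l \<in> hom C W (Dom C g)" using assms by (auto simp: in_hom)
  then have "\<exists>!h. h \<in> hom C W P \<and> p \<cdot> h = k \<and> q \<cdot> h = l"
    using assms(1,8) unfolding is_pullback_def by blast
  then show ?thesis using that by (auto simp: in_hom)
qed

lemma pullback_eq:
  assumes "is_pullback C f g P p q" "h \<in> Ar C" "k \<in> Ar C" "Dom C h = Dom C k"
    "Cod C h = P" "Cod C k = P" "p \<cdot> h = p \<cdot> k" "q \<cdot> h = q \<cdot> k"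
  shows "h = k"
proof -
  note pb [simp] = pullback_arrows(1,2,4-10)[OF assms(1)]
  have "Dom C k \<in> Ob C" "p \<cdot> k \<in> hom C (Dom C k) (Dom C f)" "q \<cdot> k \<in> hom C (Dom C k) (Dom C g)"
    using assms(2-6) by (simp_all add: in_hom)
  moreover have "f \<cdot> (p \<cdot> k) = g \<cdot> (q \<cdot> k)"
    using arg_cong[OF pullback_arrows(11)[OF assms(1)], of "\<lambda>h. h \<cdot> k"] assms(3,6)
      pullback_arrows(3)[OF assms(1)] by simp
  ultimately have "\<exists>!l. l \<in> hom C (Dom C k) P \<and> p \<cdot> l = p \<cdot> k \<and> q \<cdot> l = q \<cdot> k"
    using assms(1) unfolding is_pullback_def by blast
  moreover have "h \<in> hom C (Dom C k) P" "k \<in> hom C (Dom C k) P" using assms(2-6) by (simp_all add: in_hom)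
  ultimately show ?thesis using assms(7,8) by blast
qed

lemma is_pullbackI:
  assumes "f \<in> Ar C" "g \<in> Ar C" "Cod C f = Cod C g" "p \<in> Ar C" "Dom C p = P" "Cod C p = Dom C f"
    "q \<in> Ar C" "Dom C q = P" "Cod C q = Dom C g" "f \<cdot> p = g \<cdot> q"
    and ex: "\<And>W k l. k \<in> Ar C \<Longrightarrow> l \<in> Ar C \<Longrightarrow> Dom C k = W \<Longrightarrow> Dom C l = W \<Longrightarrow> Cod C k = Dom C f \<Longrightarrow>
      Cod C l = Dom C g \<Longrightarrow> f \<cdot> k = g \<cdot> l \<Longrightarrow>
      \<exists>h. h \<in> Ar C \<and> Dom C h = W \<and> Cod C h = P \<and> p \<cdot> h = k \<and> q \<cdot> h = l"
    and uniq: "\<And>h k. h \<in> Ar C \<Longrightarrow> k \<in> Ar C \<Longrightarrow> Dom C h = Dom C k \<Longrightarrow> Cod C h = P \<Longrightarrow> Cod C k = P \<Longrightarrow>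
      p \<cdot> h = p \<cdot> k \<Longrightarrow> q \<cdot> h = q \<cdot> k \<Longrightarrow> h = k"
  shows "is_pullback C f g P p q"
  unfolding is_pullback_def
proof (intro conjI ballI impI)
  fix W k l assume "k \<in> hom C W (Dom C f)" "l \<in> hom C W (Dom C g)" "f \<cdot> k = g \<cdot> l"
  then obtain h where h: "h \<in> hom C W P \<and> p \<cdot> h = k \<and> q \<cdot> h = l" using ex[of k l W] by (auto simp: in_hom)
  show "\<exists>!h. h \<in> hom C W P \<and> p \<cdot> h = k \<and> q \<cdot> h = l"
    by (rule ex1I[of _ h], rule h, rule uniq) (use h in \<open>simp_all add: in_hom\<close>)
next
  show "P \<in> Ob C" using ob_simps(1)[OF assms(4)] assms(5) by simp
qed (use assms(1-10) in \<open>simp_all add: in_hom\<close>)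

lemma pullback_iso:
  assumes pb: "is_pullback C f g P p q" and \<theta>: "\<theta> \<in> hom C P' P" "\<theta>' \<in> hom C P P'"
    "\<theta> \<cdot> \<theta>' = Idn C P" "\<theta>' \<cdot> \<theta> = Idn C P'" and pq: "p' = p \<cdot> \<theta>" "q' = q \<cdot> \<theta>"
  shows "is_pullback C f g P' p' q'"
proof -
  note [simp] = pullback_arrows(1,2,4-10)[OF pb]
  have [simp]: "\<theta> \<in> Ar C" "Dom C \<theta> = P'" "Cod C \<theta> = P" "\<theta>' \<in> Ar C" "Dom C \<theta>' = P" "Cod C \<theta>' = P'"
    using \<theta> by (simp_all add: in_hom)
  show ?thesis
  proof (rule is_pullbackI)
    show "f \<cdot> p' = g \<cdot> q'"
      using arg_cong[OF pullback_arrows(11)[OF pb], of "\<lambda>z. z \<cdot> \<theta>"] pullback_arrows(3)[OF pb] by (simp add: pq)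
  next
    fix W k l assume kl: "k \<in> Ar C" "l \<in> Ar C" "Dom C k = W" "Dom C l = W" "Cod C k = Dom C f" "Cod C l = Dom C g"
      "f \<cdot> k = g \<cdot> l"
    obtain h where "h \<in> Ar C" "Dom C h = W" "Cod C h = P" "p \<cdot> h = k" "q \<cdot> h = l"
      by (rule pullback_factor[OF pb kl])
    then show "\<exists>h. h \<in> Ar C \<and> Dom C h = W \<and> Cod C h = P' \<and> p' \<cdot> h = k \<and> q' \<cdot> h = l"
      by (intro exI[of _ "\<theta>' \<cdot> h"]) (simp add: pq comp_reduce[OF \<theta>(3)])
  next
    fix h k assume hk: "h \<in> Ar C" "k \<in> Ar C" "Dom C h = Dom C k" "Cod C h = P'" "Cod C k = P'"
      "p' \<cdot> h = p' \<cdot> k" "q' \<cdot> h = q' \<cdot> k"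
    have "\<theta> \<cdot> h = \<theta> \<cdot> k" by (rule pullback_eq[OF pb]) (use hk pq in simp_all)
    then have "\<theta>' \<cdot> (\<theta> \<cdot> h) = \<theta>' \<cdot> (\<theta> \<cdot> k)" by simp
    then show "h = k" using hk by (simp add: comp_reduce[OF \<theta>(4)])
  qed (use pq pullback_arrows(3)[OF pb] in simp_all)
qed

lemma equaliser_arrows:
  assumes "is_equaliser C f g e"
  shows "e \<in> Ar C" "Cod C e = Dom C f" "f \<cdot> e = g \<cdot> e"
  using assms unfolding is_equaliser_def by blast+

lemma equaliser_factor:
  assumes "is_equaliser C f g e" "k \<in> Ar C" "Cod C k = Dom C f" "f \<cdot> k = g \<cdot> k"
  obtains h where "h \<in> Ar C" "Dom C h = Dom C k" "Cod C h = Dom C e" "e \<cdot> h = k"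
proof -
  have "Dom C k \<in> Ob C" "k \<in> hom C (Dom C k) (Dom C f)" using assms by (simp_all add: in_hom)
  then have "\<exists>!h. h \<in> hom C (Dom C k) (Dom C e) \<and> e \<cdot> h = k"
    using assms(1,4) unfolding is_equaliser_def by simp
  then obtain h where "h \<in> hom C (Dom C k) (Dom C e)" "e \<cdot> h = k" by blast
  then show ?thesis using that unfolding in_hom by blast
qed

lemma equaliser_monic:
  assumes e: "is_equaliser C f g e"
  shows "monic C e"
proof (rule monicI)
  note [simp] = equaliser_arrows(1,2)[OF e]
  have [simp]: "f \<in> Ar C" "g \<in> Ar C" "Dom C g = Dom C f" "Cod C g = Cod C f"
    using e unfolding is_equaliser_def in_hom by blast+
  fix h k assume hk: "h \<in> Ar C" "k \<in> Ar C" "Cod C h = Dom C e" "Cod C k = Dom C e" "Dom C h = Dom C k"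
    and eq: "e \<cdot> h = e \<cdot> k"
  have "f \<cdot> (e \<cdot> k) = g \<cdot> (e \<cdot> k)"
    using arg_cong[OF equaliser_arrows(3)[OF e], of "\<lambda>z. z \<cdot> k"] hk by simp
  moreover have "Dom C k \<in> Ob C" "e \<cdot> k \<in> hom C (Dom C k) (Dom C f)" using hk by (simp_all add: in_hom)
  ultimately have "\<exists>!l. l \<in> hom C (Dom C k) (Dom C e) \<and> e \<cdot> l = e \<cdot> k"
    using e unfolding is_equaliser_def by simp
  moreover have "h \<in> hom C (Dom C k) (Dom C e)" "k \<in> hom C (Dom C k) (Dom C e)" using hk by (simp_all add: in_hom)
  ultimately show "h = k" using eq by blast
qed (rule equaliser_arrows(1)[OF e])

lemma coequaliser_arrows:
  assumes "is_coequaliser C f g q"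
  shows "f \<in> Ar C" "g \<in> Ar C" "Dom C g = Dom C f" "Cod C g = Cod C f" "q \<in> Ar C" "Dom C q = Cod C f"
    "q \<cdot> f = q \<cdot> g"
  using assms unfolding is_coequaliser_def in_hom by blast+

lemma coequaliser_factor:
  assumes "is_coequaliser C f g q" "k \<in> Ar C" "Dom C k = Cod C f" "k \<cdot> f = k \<cdot> g"
  obtains h where "h \<in> Ar C" "Dom C h = Cod C q" "Cod C h = Cod C k" "h \<cdot> q = k"
proof -
  have "Cod C k \<in> Ob C" "k \<in> hom C (Cod C f) (Cod C k)" using assms by (simp_all add: in_hom)
  then have "\<exists>!h. h \<in> hom C (Cod C q) (Cod C k) \<and> h \<cdot> q = k"
    using assms(1,4) unfolding is_coequaliser_def by simp
  then show ?thesis using that unfolding in_hom by blast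
qed

lemma coequaliser_epi:
  assumes "is_coequaliser C f g q" "h \<in> Ar C" "k \<in> Ar C" "Dom C h = Cod C q" "Dom C k = Cod C q"
    "Cod C h = Cod C k" "h \<cdot> q = k \<cdot> q"
  shows "h = k"
proof -
  note [simp] = coequaliser_arrows(1-6)[OF assms(1)]
  have "(k \<cdot> q) \<cdot> f = (k \<cdot> q) \<cdot> g" using coequaliser_arrows(7)[OF assms(1)] assms(2-6) by simp
  moreover have "Cod C k \<in> Ob C" "k \<cdot> q \<in> hom C (Cod C f) (Cod C k)" using assms(2-6) by (simp_all add: in_hom)
  ultimately have "\<exists>!h. h \<in> hom C (Cod C q) (Cod C k) \<and> h \<cdot> q = k \<cdot> q"
    using assms(1) unfolding is_coequaliser_def by simp
  moreover have "h \<in> hom C (Cod C q) (Cod C k)" "k \<in> hom C (Cod C q) (Cod C k)" using assms by (simp_all add: in_hom)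
  ultimately show ?thesis using assms(7) by blast
qed

lemma is_coequaliserI:
  assumes "f \<in> Ar C" "g \<in> Ar C" "Dom C g = Dom C f" "Cod C g = Cod C f" "q \<in> Ar C" "Dom C q = Cod C f" "q \<cdot> f = q \<cdot> g"
    and ex: "\<And>k. k \<in> Ar C \<Longrightarrow> Dom C k = Cod C f \<Longrightarrow> k \<cdot> f = k \<cdot> g \<Longrightarrow>
      \<exists>h. h \<in> Ar C \<and> Dom C h = Cod C q \<and> Cod C h = Cod C k \<and> h \<cdot> q = k"
    and uniq: "\<And>h k. h \<in> Ar C \<Longrightarrow> k \<in> Ar C \<Longrightarrow> Dom C h = Cod C q \<Longrightarrow> Dom C k = Cod C q \<Longrightarrow>
      Cod C h = Cod C k \<Longrightarrow> h \<cdot> q = k \<cdot> q \<Longrightarrow> h = k"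
  shows "is_coequaliser C f g q"
  unfolding is_coequaliser_def
proof (intro conjI ballI impI)
  fix W k assume "k \<in> hom C (Cod C f) W" "k \<cdot> f = k \<cdot> g"
  then obtain h where h: "h \<in> hom C (Cod C q) W \<and> h \<cdot> q = k" using ex[of k] by (auto simp: in_hom)
  show "\<exists>!h. h \<in> hom C (Cod C q) W \<and> h \<cdot> q = k"
    by (rule ex1I[of _ h], rule h, rule uniq) (use h in \<open>simp_all add: in_hom\<close>)
qed (use assms(1-7) in \<open>simp_all add: in_hom\<close>)

lemma coequaliser_iso:
  assumes coeq: "is_coequaliser C f g q"
    and \<alpha>: "\<alpha> \<in> hom C X' (Dom C f)" "\<alpha>' \<in> hom C (Dom C f) X'" "\<alpha> \<cdot> \<alpha>' = Idn C (Dom C f)"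
    and \<beta>: "\<beta> \<in> hom C Y' (Cod C f)" "\<beta>' \<in> hom C (Cod C f) Y'" "\<beta> \<cdot> \<beta>' = Idn C (Cod C f)" "\<beta>' \<cdot> \<beta> = Idn C Y'"
    and \<kappa>: "\<kappa> \<in> hom C Z' (Cod C q)" "\<kappa>' \<in> hom C (Cod C q) Z'" "\<kappa> \<cdot> \<kappa>' = Idn C (Cod C q)" "\<kappa>' \<cdot> \<kappa> = Idn C Z'"
    and f': "f' \<in> hom C X' Y'" "\<beta> \<cdot> f' = f \<cdot> \<alpha>" and g': "g' \<in> hom C X' Y'" "\<beta> \<cdot> g' = g \<cdot> \<alpha>"
    and q': "q' \<in> hom C Y' Z'" "\<kappa> \<cdot> q' = q \<cdot> \<beta>"
  shows "is_coequaliser C f' g' q'"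
proof -
  define X Y Z where "X = Dom C f" and "Y = Cod C f" and "Z = Cod C q"
  have [simp]: "f \<in> Ar C" "g \<in> Ar C" "q \<in> Ar C" "Dom C f = X" "Cod C f = Y" "Dom C g = X" "Cod C g = Y" "Dom C q = Y" "Cod C q = Z"
    using coequaliser_arrows(1-6)[OF coeq] by (simp_all add: X_def Y_def Z_def)
  have [simp]: "X \<in> Ob C" "Y \<in> Ob C" "Z \<in> Ob C" using ob_simps[of f] ob_simps(2)[of q] by simp_all
  have [simp]: "\<alpha> \<in> Ar C" "Dom C \<alpha> = X'" "Cod C \<alpha> = X" "\<alpha>' \<in> Ar C" "Dom C \<alpha>' = X" "Cod C \<alpha>' = X'"
    "\<beta> \<in> Ar C" "Dom C \<beta> = Y'" "Cod C \<beta> = Y" "\<beta>' \<in> Ar C" "Dom C \<beta>' = Y" "Cod C \<beta>' = Y'"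
    "\<kappa> \<in> Ar C" "Dom C \<kappa> = Z'" "Cod C \<kappa> = Z" "\<kappa>' \<in> Ar C" "Dom C \<kappa>' = Z" "Cod C \<kappa>' = Z'"
    "f' \<in> Ar C" "Dom C f' = X'" "Cod C f' = Y'" "g' \<in> Ar C" "Dom C g' = X'" "Cod C g' = Y'"
    "q' \<in> Ar C" "Dom C q' = Y'" "Cod C q' = Z'"
    using \<alpha> \<beta> \<kappa> f' g' q' by (simp_all add: in_hom)
  have iso: "\<alpha> \<cdot> \<alpha>' = Idn C X" "\<beta> \<cdot> \<beta>' = Idn C Y" "\<beta>' \<cdot> \<beta> = Idn C Y'" "\<kappa> \<cdot> \<kappa>' = Idn C Z" "\<kappa>' \<cdot> \<kappa> = Idn C Z'"
    using \<alpha>(3) \<beta>(3,4) \<kappa>(3,4) by simp_all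
  have q'_eq: "q' = \<kappa>' \<cdot> (q \<cdot> \<beta>)"
    unfolding q'(2)[symmetric] by (simp add: comp_reduce[OF iso(5)])
  have fact: "f = \<beta> \<cdot> (f' \<cdot> \<alpha>')" "g = \<beta> \<cdot> (g' \<cdot> \<alpha>')"
    using comp_reduce[OF f'(2), of \<alpha>'] comp_reduce[OF g'(2), of \<alpha>'] by (simp_all add: iso)
  show ?thesis
  proof (rule is_coequaliserI)
    show "q' \<cdot> f' = q' \<cdot> g'"
      using comp_reduce[OF coequaliser_arrows(7)[OF coeq], of \<alpha>] by (simp add: q'_eq f'(2) g'(2))
  next
    fix k assume k [simp]: "k \<in> Ar C" and "Dom C k = Cod C f'" and kf: "k \<cdot> f' = k \<cdot> g'"
    then have [simp]: "Dom C k = Y'" by simp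
    have "(k \<cdot> \<beta>') \<cdot> f = (k \<cdot> \<beta>') \<cdot> g"
      using comp_reduce[OF kf, of \<alpha>'] unfolding fact by (simp add: comp_reduce[OF iso(3)])
    then obtain h where h [simp]: "h \<in> Ar C" "Dom C h = Z" "Cod C h = Cod C k" and hq: "h \<cdot> q = k \<cdot> \<beta>'"
      using coequaliser_factor[OF coeq, of "k \<cdot> \<beta>'"] by auto
    have "(h \<cdot> \<kappa>) \<cdot> q' = k"
      using comp_reduce[OF hq, of \<beta>] by (simp add: q'(2) iso)
    then show "\<exists>h. h \<in> Ar C \<and> Dom C h = Cod C q' \<and> Cod C h = Cod C k \<and> h \<cdot> q' = k"
      by (intro exI[of _ "h \<cdot> \<kappa>"]) simp
  next
    fix h k assume hk [simp]: "h \<in> Ar C" "k \<in> Ar C" and "Dom C h = Cod C q'" "Dom C k = Cod C q'"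
      and cod: "Cod C h = Cod C k" and eq: "h \<cdot> q' = k \<cdot> q'"
    then have [simp]: "Dom C h = Z'" "Dom C k = Z'" by simp_all
    have "(h \<cdot> \<kappa>') \<cdot> q = (k \<cdot> \<kappa>') \<cdot> q"
      using comp_reduce[OF eq, of \<beta>'] by (simp add: q'_eq iso)
    then have "h \<cdot> \<kappa>' = k \<cdot> \<kappa>'" by - (rule coequaliser_epi[OF coeq], simp_all add: cod)
    from comp_reduce[OF this, of \<kappa>] show "h = k" by (simp add: iso)
  qed simp_all
qed

lemma is_productI:
  assumes "p \<in> Ar C" "Dom C p = P" "Cod C p = A" "q \<in> Ar C" "Dom C q = P" "Cod C q = B"
    and ex: "\<And>W k l. k \<in> Ar C \<Longrightarrow> l \<in> Ar C \<Longrightarrow> Dom C k = W \<Longrightarrow> Dom C l = W \<Longrightarrow> Cod C k = A \<Longrightarrow>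
      Cod C l = B \<Longrightarrow> \<exists>h. h \<in> Ar C \<and> Dom C h = W \<and> Cod C h = P \<and> p \<cdot> h = k \<and> q \<cdot> h = l"
    and uniq: "\<And>h k. h \<in> Ar C \<Longrightarrow> k \<in> Ar C \<Longrightarrow> Dom C h = Dom C k \<Longrightarrow> Cod C h = P \<Longrightarrow> Cod C k = P \<Longrightarrow>
      p \<cdot> h = p \<cdot> k \<Longrightarrow> q \<cdot> h = q \<cdot> k \<Longrightarrow> h = k"
  shows "is_product C A B P p q"
  unfolding is_product_def
proof (intro conjI ballI impI)
  fix W k l assume "k \<in> hom C W A" "l \<in> hom C W B"
  then obtain h where h: "h \<in> hom C W P \<and> p \<cdot> h = k \<and> q \<cdot> h = l" using ex[of k l W] by (auto simp: in_hom)
  show "\<exists>!h. h \<in> hom C W P \<and> p \<cdot> h = k \<and> q \<cdot> h = l"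
    by (rule ex1I[of _ h], rule h, rule uniq) (use h in \<open>simp_all add: in_hom\<close>)
next
  show "P \<in> Ob C" using ob_simps(1)[OF assms(1)] assms(2) by simp
qed (use assms(1-6) in \<open>simp_all add: in_hom\<close>)

lemma terminal_arrow:
  assumes "is_terminal C T" "A \<in> Ob C"
  obtains f where "f \<in> Ar C" "Dom C f = A" "Cod C f = T"
  using assms unfolding is_terminal_def in_hom by blast

lemma terminal_unique:
  assumes "is_terminal C T" "f \<in> Ar C" "g \<in> Ar C" "Dom C f = Dom C g" "Cod C f = T" "Cod C g = T"
  shows "f = g"
proof -
  have "f \<in> hom C (Dom C g) T" "g \<in> hom C (Dom C g) T" "Dom C g \<in> Ob C"
    using assms by (simp_all add: in_hom)
  then show ?thesis using assms(1) unfolding is_terminal_def by blast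
qed

lemma is_terminalI:
  assumes "T \<in> Ob C" "\<And>A. A \<in> Ob C \<Longrightarrow> \<exists>f. f \<in> Ar C \<and> Dom C f = A \<and> Cod C f = T"
    and "\<And>f g. f \<in> Ar C \<Longrightarrow> g \<in> Ar C \<Longrightarrow> Dom C f = Dom C g \<Longrightarrow> Cod C f = T \<Longrightarrow> Cod C g = T \<Longrightarrow> f = g"
  shows "is_terminal C T"
  unfolding is_terminal_def
proof (intro conjI ballI)
  fix A assume "A \<in> Ob C"
  then obtain f where f: "f \<in> hom C A T" using assms(2) by (auto simp: in_hom)
  show "\<exists>!h. h \<in> hom C A T"
    by (rule ex1I[of _ f], rule f, rule assms(3)) (use f in \<open>simp_all add: in_hom\<close>)
qed (rule assms(1))

text \<open>Products are pullbacks over a terminal object, so that pullbacks and a terminal object are all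
  that has to be constructed, or preserved, in order to have finite limits.\<close>

lemma pullback_over_terminal:
  assumes T: "is_terminal C T" and fg: "Cod C f = T" "Dom C f = A" "Dom C g = B"
    and pb: "is_pullback C f g P p q"
  shows "is_product C A B P p q"
proof (rule is_productI)
  note [simp] = pullback_arrows(1,2,4-10)[OF pb] fg
  have [simp]: "Cod C g = T" using pullback_arrows(3)[OF pb] fg by simp
  show "p \<in> Ar C" "Dom C p = P" "Cod C p = A" "q \<in> Ar C" "Dom C q = P" "Cod C q = B" by simp_all
  fix W k l assume kl: "k \<in> Ar C" "l \<in> Ar C" "Dom C k = W" "Dom C l = W" "Cod C k = A" "Cod C l = B"
  have "f \<cdot> k = g \<cdot> l" by (rule terminal_unique[OF T]) (use kl in simp_all)
  then show "\<exists>h. h \<in> Ar C \<and> Dom C h = W \<and> Cod C h = P \<and> p \<cdot> h = k \<and> q \<cdot> h = l"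
    using pullback_factor[OF pb, of k l W] kl by (metis fg(2,3))
qed (rule pullback_eq[OF pb])

end

lemma product_over_terminal:
  assumes C: "category C" and T: "is_terminal C T" and f: "f \<in> hom C A T" and g: "g \<in> hom C B T"
    and P: "is_product C A B P p q"
  shows "is_pullback C f g P p q"
proof -
  interpret category C by (rule C)
  note [simp] = product_arrows[OF P]
  have [simp]: "f \<in> Ar C" "Dom C f = A" "Cod C f = T" "g \<in> Ar C" "Dom C g = B" "Cod C g = T"
    using f g by (simp_all add: in_hom)
  show ?thesis
  proof (rule is_pullbackI)
    show "Cmp C f p = Cmp C g q" by (rule terminal_unique[OF T]) simp_all
    fix W k l assume "k \<in> Ar C" "l \<in> Ar C" "Dom C k = W" "Dom C l = W" "Cod C k = Dom C f" "Cod C l = Dom C g"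
    then show "\<exists>h. h \<in> Ar C \<and> Dom C h = W \<and> Cod C h = P \<and> Cmp C p h = k \<and> Cmp C q h = l"
      using product_factor[OF P, of k l W] by auto
  qed (simp_all add: product_eq[OF P])
qed

locale lex = category +
  assumes terminal_exists: "\<exists>T. is_terminal C T"
    and ex_pullback: "f \<in> Ar C \<Longrightarrow> g \<in> Ar C \<Longrightarrow> Cod C f = Cod C g \<Longrightarrow> \<exists>P p q. is_pullback C f g P p q"

sublocale lex \<subseteq> cartesian
proof
  fix A B assume AB: "A \<in> Ob C" "B \<in> Ob C"
  obtain T where T: "is_terminal C T" using terminal_exists by blast
  obtain f g where "f \<in> Ar C" "Dom C f = A" "Cod C f = T" "g \<in> Ar C" "Dom C g = B" "Cod C g = T"
    using terminal_arrow[OF T AB(1)] terminal_arrow[OF T AB(2)] by metis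
  then show "\<exists>P p q. is_product C A B P p q"
    using pullback_over_terminal[OF T] ex_pullback[of f g] by metis
qed (rule terminal_exists)

context lex
begin

lemma pullback_chosen:
  assumes "f \<in> Ar C" "g \<in> Ar C" "Cod C f = Cod C g"
  shows "is_pullback C f g (pb_ob C f g) (pb1 C f g) (pb2 C f g)"
proof -
  have "\<exists>x. case x of (P, p, q) \<Rightarrow> is_pullback C f g P p q"
    using ex_pullback[OF assms] by auto
  from someI_ex[OF this] show ?thesis
    unfolding pb_ob_def pb1_def pb2_def chosen_pb_def by (auto split: prod.splits)
qed

lemma ex_equaliser:
  assumes "f \<in> Ar C" "g \<in> Ar C" "Dom C f = Dom C g" "Cod C f = Cod C g"
  shows "\<exists>e. is_equaliser C f g e"
proof -
  define A where "A = Dom C g"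
  note [simp] = assms(1,2)
  have [simp]: "Dom C f = A" "Dom C g = A" "A \<in> Ob C" using assms by (simp_all add: A_def)
  obtain P p q where pb: "is_pullback C \<langle>Idn C A, f\<rangle> \<langle>Idn C A, g\<rangle> P p q"
    using ex_pullback[of "\<langle>Idn C A, f\<rangle>" "\<langle>Idn C A, g\<rangle>"] assms(4) by auto
  note [simp] = pullback_arrows(4-10)[OF pb]
  have eq: "\<langle>p, f \<cdot> p\<rangle> = \<langle>q, g \<cdot> q\<rangle>" using pullback_arrows(11)[OF pb] by simp
  have pq: "p = q" by (rule pairing_inject(1)[OF eq]) (simp_all add: assms(4))
  have fp: "f \<cdot> p = g \<cdot> q" by (rule pairing_inject(2)[OF eq]) (simp_all add: assms(4))
  have "is_equaliser C f g p"
    unfolding is_equaliser_def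
  proof (intro conjI ballI impI)
    fix W k assume "k \<in> hom C W (Dom C f)" and fk: "f \<cdot> k = g \<cdot> k"
    then have [simp]: "k \<in> Ar C" "Dom C k = W" "Cod C k = A" by (simp_all add: in_hom)
    obtain h where h: "h \<in> Ar C" "Dom C h = W" "Cod C h = P" "p \<cdot> h = k"
      using pullback_factor[OF pb, of k k W] fk by auto
    show "\<exists>!h. h \<in> hom C W (Dom C p) \<and> p \<cdot> h = k"
    proof (rule ex1I[of _ h])
      fix h' assume "h' \<in> hom C W (Dom C p) \<and> p \<cdot> h' = k"
      then show "h' = h" using h pq by - (rule pullback_eq[OF pb], simp_all add: in_hom)
    qed (use h in \<open>simp add: in_hom\<close>)
  qed (use fp pq assms(4) in \<open>simp_all add: in_hom\<close>)
  then show ?thesis by blast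
qed

end

text \<open>Both shapes are taken on the natural numbers: the empty category, and the cospan
  with objects \<open>0, 1, 2\<close> and non-identity arrows \<open>3 : 0 \<rightarrow> 2\<close> and \<open>4 : 1 \<rightarrow> 2\<close>.\<close>

lemma has_finite_limits_imp_lex:
  assumes C: "category C" and lim: "has_finite_limits C"
  shows "lex C"
proof -
  interpret category C by (rule C)
  have "\<exists>T. is_terminal C T"
  proof -
    let ?J = "\<lparr>Ob = {}, Ar = {}, Dom = \<lambda>_. 0, Cod = \<lambda>_. 0, Idn = \<lambda>_. 0, Cmp = \<lambda>_ _. 0\<rparr> :: (nat, nat) cat"
    let ?F = "\<lparr>FOb = \<lambda>_. undefined, FAr = \<lambda>_. undefined\<rparr> :: (nat, nat, _, _) fctr"
    have "category ?J" by unfold_locales (simp_all add: hom_def)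
    moreover have "is_functor ?J C ?F" by (simp add: is_functor_def)
    ultimately obtain N c where "is_limit ?J C ?F N c"
      using lim[unfolded has_finite_limits_def, rule_format, of ?J ?F] by auto
    then show ?thesis unfolding is_limit_def is_cone_def is_terminal_def by (intro exI[of _ N]) auto
  qed
  moreover have "\<exists>P p q. is_pullback C f g P p q"
    if fg [simp]: "f \<in> Ar C" "g \<in> Ar C" and cod: "Cod C f = Cod C g" for f g
  proof -
    let ?d = "\<lambda>n :: nat. if n = 3 then 0 else if n = 4 then 1 else n"
      and ?c = "\<lambda>n :: nat. if n = 3 \<or> n = 4 then 2 else n"
    let ?J = "\<lparr>Ob = {0, 1, 2}, Ar = {0, 1, 2, 3, 4}, Dom = ?d, Cod = ?c, Idn = \<lambda>n. n,
      Cmp = \<lambda>n m. if n \<in> {3, 4} then n else m\<rparr> :: (nat, nat) cat"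
    let ?o = "\<lambda>n :: nat. if n = 0 then Dom C f else if n = 1 then Dom C g else Cod C g"
    let ?F = "\<lparr>FOb = ?o, FAr = \<lambda>n. if n = 3 then f else if n = 4 then g else Idn C (?o n)\<rparr>
      :: (nat, nat, _, _) fctr"
    have "category ?J" by unfold_locales (auto simp: hom_def split: if_splits)
    moreover have "is_functor ?J C ?F"
      unfolding is_functor_def using cod by (auto simp: in_hom split: if_splits)
    ultimately obtain N c where N: "is_limit ?J C ?F N c"
      using lim[unfolded has_finite_limits_def, rule_format, of ?J ?F] by auto
    have cone: "is_cone ?J C ?F M d \<longleftrightarrow> M \<in> Ob C \<and> d 0 \<in> hom C M (Dom C f) \<and> d 1 \<in> hom C M (Dom C g) \<and>
        d 2 = Cmp C f (d 0) \<and> Cmp C f (d 0) = Cmp C g (d 1)" for M d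
      unfolding is_cone_def using cod by (auto simp: in_hom)
    have Nc: "N \<in> Ob C" "c 0 \<in> hom C N (Dom C f)" "c 1 \<in> hom C N (Dom C g)"
      "c 2 = Cmp C f (c 0)" "Cmp C f (c 0) = Cmp C g (c 1)"
      using N cone unfolding is_limit_def by auto
    have "is_pullback C f g N (c 0) (c 1)"
      unfolding is_pullback_def
    proof (intro conjI ballI impI)
      fix W k l assume W: "W \<in> Ob C" and kl: "k \<in> hom C W (Dom C f)" "l \<in> hom C W (Dom C g)"
        "Cmp C f k = Cmp C g l"
      let ?e = "\<lambda>n :: nat. if n = 0 then k else if n = 1 then l else Cmp C f k"
      have "is_cone ?J C ?F W ?e" using W kl cone by simp
      then have "\<exists>!h. h \<in> hom C W N \<and> (\<forall>j \<in> Ob ?J. Cmp C (c j) h = ?e j)"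
        using N unfolding is_limit_def by blast
      moreover have "h \<in> hom C W N \<and> (\<forall>j \<in> Ob ?J. Cmp C (c j) h = ?e j) \<longleftrightarrow>
          h \<in> hom C W N \<and> Cmp C (c 0) h = k \<and> Cmp C (c 1) h = l" for h
      proof -
        have "Cmp C (c 2) h = Cmp C f k" if "h \<in> hom C W N" "Cmp C (c 0) h = k"
          using that Nc(2) unfolding Nc(4) by (simp add: in_hom)
        then show ?thesis by auto
      qed
      ultimately show "\<exists>!h. h \<in> hom C W N \<and> Cmp C (c 0) h = k \<and> Cmp C (c 1) h = l" by simp
    qed (use Nc cod in simp_all)
    then show ?thesis by blast
  qed
  ultimately show ?thesis by unfold_locales
qed

section \<open>Slices\<close>

lemma slice_simps:
  "Ob (slice C Y) = {f \<in> Ar C. Cod C f = Y}" "Dom (slice C Y) = sdom" "Cod (slice C Y) = scod"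
  "Idn (slice C Y) f = SliceAr f f (Idn C (Dom C f))"
  "Cmp (slice C Y) \<tau> \<sigma> = SliceAr (sdom \<sigma>) (scod \<tau>) (Cmp C (smap \<tau>) (smap \<sigma>))"
  by (simp_all add: slice_def)

lemma slice_ar:
  "\<sigma> \<in> Ar (slice C Y) \<longleftrightarrow> sdom \<sigma> \<in> Ar C \<and> Cod C (sdom \<sigma>) = Y \<and> scod \<sigma> \<in> Ar C \<and> Cod C (scod \<sigma>) = Y \<and>
    smap \<sigma> \<in> Ar C \<and> Dom C (smap \<sigma>) = Dom C (sdom \<sigma>) \<and> Cod C (smap \<sigma>) = Dom C (scod \<sigma>) \<and>
    Cmp C (scod \<sigma>) (smap \<sigma>) = sdom \<sigma>"
  by (auto simp: slice_def in_hom)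

lemma slice_ar_eqI: "sdom \<sigma> = sdom \<tau> \<Longrightarrow> scod \<sigma> = scod \<tau> \<Longrightarrow> smap \<sigma> = smap \<tau> \<Longrightarrow> \<sigma> = \<tau>"
  by (cases \<sigma>; cases \<tau>) simp

context category
begin

lemma slice_comp:
  assumes "\<sigma> \<in> Ar (slice C Y)" "\<tau> \<in> Ar (slice C Y)" "sdom \<tau> = scod \<sigma>"
  shows "scod \<tau> \<cdot> (smap \<tau> \<cdot> smap \<sigma>) = sdom \<sigma>"
proof -
  have "scod \<tau> \<cdot> smap \<tau> = sdom \<tau>" using assms by (simp add: slice_ar)
  from comp_reduce[OF this] show ?thesis using assms by (simp add: slice_ar)
qed

lemma slice_category: "category (slice C Y)"
  by unfold_locales (auto simp: in_hom slice_ar slice_simps slice_comp intro!: slice_ar_eqI slice_comp)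

text \<open>Products in a slice are pullbacks in the base. This lemma and the next one are the bridge
  between group objects of a slice and arrows of the base.\<close>

lemma slice_product_of_pullback:
  assumes pb: "is_pullback C f g P p q" and Y: "Cod C f = Y"
  shows "is_product (slice C Y) f g (f \<cdot> p) (SliceAr (f \<cdot> p) f p) (SliceAr (f \<cdot> p) g q)"
proof -
  let ?S = "slice C Y"
  interpret S: category "?S" by (rule slice_category)
  note [simp] = pullback_arrows(1,2,4-10)[OF pb] Y
  have [simp]: "Cod C g = Y" using pullback_arrows(3)[OF pb] Y by simp
  have eq: "g \<cdot> q = f \<cdot> p" using pullback_arrows(11)[OF pb] by simp
  show ?thesis
  proof (rule S.is_productI)
    fix w k l
    assume kl: "k \<in> Ar ?S" "l \<in> Ar ?S" "Dom ?S k = w" "Dom ?S l = w"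
      "Cod ?S k = f" "Cod ?S l = g"
    obtain h where h: "h \<in> Ar C" "Dom C h = Dom C w" "Cod C h = P" "p \<cdot> h = smap k" "q \<cdot> h = smap l"
      using pullback_factor[OF pb, of "smap k" "smap l" "Dom C w"] kl by (auto simp: slice_ar slice_simps)
    then show "\<exists>h. h \<in> Ar ?S \<and> Dom ?S h = w \<and> Cod ?S h = f \<cdot> p \<and>
        SliceAr (f \<cdot> p) f p \<cdot>\<^bsub>?S\<^esub> h = k \<and> SliceAr (f \<cdot> p) g q \<cdot>\<^bsub>?S\<^esub> h = l"
      using kl by (intro exI[of _ "SliceAr w (f \<cdot> p) h"]) (auto simp: slice_ar slice_simps intro!: slice_ar_eqI)
  next
    fix h k assume "h \<in> Ar ?S" "k \<in> Ar ?S" "Dom ?S h = Dom ?S k"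
      "Cod ?S h = f \<cdot> p" "Cod ?S k = f \<cdot> p"
      "SliceAr (f \<cdot> p) f p \<cdot>\<^bsub>?S\<^esub> h = SliceAr (f \<cdot> p) f p \<cdot>\<^bsub>?S\<^esub> k"
      "SliceAr (f \<cdot> p) g q \<cdot>\<^bsub>?S\<^esub> h = SliceAr (f \<cdot> p) g q \<cdot>\<^bsub>?S\<^esub> k"
    then show "h = k"
      by - (rule slice_ar_eqI, simp_all add: slice_ar slice_simps, rule pullback_eq[OF pb], simp_all)
  qed (use eq in \<open>simp_all add: slice_ar slice_simps\<close>)
qed

lemma pullback_of_slice_product:
  assumes P: "is_product (slice C Y) f g h \<rho> \<sigma>"
  shows "is_pullback C f g (Dom C h) (smap \<rho>) (smap \<sigma>)"
proof -
  let ?S = "slice C Y"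
  interpret S: category "?S" by (rule slice_category)
  note arr = S.product_arrows[OF P]
  have [simp]: "f \<in> Ar C" "Cod C f = Y" "g \<in> Ar C" "Cod C g = Y" "h \<in> Ar C" "Cod C h = Y"
    "smap \<rho> \<in> Ar C" "Dom C (smap \<rho>) = Dom C h" "Cod C (smap \<rho>) = Dom C f" "f \<cdot> smap \<rho> = h"
    "smap \<sigma> \<in> Ar C" "Dom C (smap \<sigma>) = Dom C h" "Cod C (smap \<sigma>) = Dom C g" "g \<cdot> smap \<sigma> = h"
    "sdom \<rho> = h" "scod \<rho> = f" "sdom \<sigma> = h" "scod \<sigma> = g"
    using arr by (auto simp: slice_ar slice_simps)
  show ?thesis
  proof (rule is_pullbackI)
    fix W k l assume kl: "k \<in> Ar C" "l \<in> Ar C" "Dom C k = W" "Dom C l = W" "Cod C k = Dom C f" "Cod C l = Dom C g"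
      "f \<cdot> k = g \<cdot> l"
    then obtain m where "m \<in> Ar ?S" "sdom m = f \<cdot> k" "scod m = h"
      "\<rho> \<cdot>\<^bsub>?S\<^esub> m = SliceAr (f \<cdot> k) f k" "\<sigma> \<cdot>\<^bsub>?S\<^esub> m = SliceAr (f \<cdot> k) g l"
      using S.product_factor[OF P, of "SliceAr (f \<cdot> k) f k" "SliceAr (f \<cdot> k) g l" "f \<cdot> k"]
      by (auto simp: slice_ar slice_simps)
    then show "\<exists>m. m \<in> Ar C \<and> Dom C m = W \<and> Cod C m = Dom C h \<and> smap \<rho> \<cdot> m = k \<and> smap \<sigma> \<cdot> m = l"
      using kl by (intro exI[of _ "smap m"]) (auto simp: slice_ar slice_simps)
  next
    fix m n assume mn: "m \<in> Ar C" "n \<in> Ar C" "Dom C m = Dom C n" "Cod C m = Dom C h" "Cod C n = Dom C h"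
      "smap \<rho> \<cdot> m = smap \<rho> \<cdot> n" "smap \<sigma> \<cdot> m = smap \<sigma> \<cdot> n"
    have "h \<cdot> l = f \<cdot> (smap \<rho> \<cdot> l)" if "l \<in> Ar C" "Cod C l = Dom C h" for l
      using that comp_reduce[of f "smap \<rho>" h l] by simp
    then have hm: "h \<cdot> m = h \<cdot> n" using mn by metis
    have "SliceAr (h \<cdot> m) h m = SliceAr (h \<cdot> n) h n"
      by (rule S.product_eq[OF P]) (use mn hm in \<open>auto simp: slice_ar slice_simps\<close>)
    then show "m = n" by simp
  qed simp_all
qed

lemma slice_productI:
  assumes "is_pullback C f g P (smap \<rho>) (smap \<sigma>)" "Cod C f = Y" "\<rho> \<in> Ar (slice C Y)"
    "sdom \<rho> = h" "scod \<rho> = f" "sdom \<sigma> = h" "scod \<sigma> = g"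
  shows "is_product (slice C Y) f g h \<rho> \<sigma>"
proof -
  have "f \<cdot> smap \<rho> = h" using assms by (auto simp: slice_ar)
  then have "SliceAr (f \<cdot> smap \<rho>) f (smap \<rho>) = \<rho>" "SliceAr (f \<cdot> smap \<rho>) g (smap \<sigma>) = \<sigma>"
    using assms by (auto intro: slice_ar_eqI)
  then show ?thesis using slice_product_of_pullback[OF assms(1,2)] \<open>f \<cdot> smap \<rho> = h\<close> by simp
qed

text \<open>The terminal objects of a slice are the isomorphisms.\<close>

lemma slice_terminalI:
  assumes f: "f \<in> hom C X Y" and k: "k \<in> hom C Y X" "f \<cdot> k = Idn C Y" "k \<cdot> f = Idn C X"
  shows "is_terminal (slice C Y) f"
proof -
  let ?S = "slice C Y"
  interpret S: category "?S" by (rule slice_category)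
  have [simp]: "f \<in> Ar C" "Dom C f = X" "Cod C f = Y" "k \<in> Ar C" "Dom C k = Y" "Cod C k = X"
    using f k by (simp_all add: in_hom)
  show ?thesis
  proof (rule S.is_terminalI)
    fix w assume "w \<in> Ob ?S"
    then show "\<exists>\<tau>. \<tau> \<in> Ar ?S \<and> Dom ?S \<tau> = w \<and> Cod ?S \<tau> = f"
      by (intro exI[of _ "SliceAr w f (k \<cdot> w)"]) (simp add: slice_ar slice_simps comp_reduce[OF k(2)])
  next
    fix m n assume mn: "m \<in> Ar ?S" "n \<in> Ar ?S" "Dom ?S m = Dom ?S n"
      "Cod ?S m = f" "Cod ?S n = f"
    have "k \<cdot> sdom m = smap m" "k \<cdot> sdom n = smap n"
      using mn comp_reduce[OF k(3), of "smap m"] comp_reduce[OF k(3), of "smap n"]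
      by (auto simp: slice_ar slice_simps)
    then show "m = n" by - (rule slice_ar_eqI, use mn in \<open>simp_all add: slice_simps\<close>)
  qed (simp add: slice_simps)
qed

lemma slice_terminal: "Y \<in> Ob C \<Longrightarrow> is_terminal (slice C Y) (Idn C Y)"
  by (rule slice_terminalI[of _ Y _ "Idn C Y"]) (simp_all add: in_hom)

lemma slice_terminalE:
  assumes T: "is_terminal (slice C Y) f"
  obtains k where "k \<in> Ar C" "Dom C k = Y" "Cod C k = Dom C f" "f \<cdot> k = Idn C Y" "k \<cdot> f = Idn C (Dom C f)"
proof -
  let ?S = "slice C Y"
  interpret S: category "?S" by (rule slice_category)
  have f [simp]: "f \<in> Ar C" "Cod C f = Y" using T by (simp_all add: is_terminal_def slice_simps)
  have Y [simp]: "Y \<in> Ob C" using ob_simps(2)[OF f(1)] by simp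
  obtain \<sigma> where "\<sigma> \<in> Ar ?S" "Dom ?S \<sigma> = Idn C Y" "Cod ?S \<sigma> = f"
    by (rule S.terminal_arrow[OF T, of "Idn C Y"]) (simp add: slice_simps)
  then obtain k where k [simp]: "k \<in> Ar C" "Dom C k = Y" "Cod C k = Dom C f" "f \<cdot> k = Idn C Y"
    by (auto simp: slice_ar slice_simps)
  have "SliceAr f f (k \<cdot> f) = SliceAr f f (Idn C (Dom C f))"
    by (rule S.terminal_unique[OF T]) (simp_all add: slice_ar slice_simps comp_reduce[OF k(4)])
  then show ?thesis using that[OF k] by simp
qed

lemma slice_monic: "monic (slice C Y) \<sigma> \<longleftrightarrow> \<sigma> \<in> Ar (slice C Y) \<and> monic C (smap \<sigma>)"
proof (intro iffI conjI)
  interpret S: category "slice C Y" by (rule slice_category)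
  assume m: "monic (slice C Y) \<sigma>"
  show \<sigma>: "\<sigma> \<in> Ar (slice C Y)" using m by (simp add: monic_def)
  show "monic C (smap \<sigma>)"
  proof (rule monicI)
    fix g h assume gh: "g \<in> Ar C" "h \<in> Ar C" "Cod C g = Dom C (smap \<sigma>)" "Cod C h = Dom C (smap \<sigma>)"
      "Dom C g = Dom C h" "smap \<sigma> \<cdot> g = smap \<sigma> \<cdot> h"
    have tri: "scod \<sigma> \<cdot> smap \<sigma> = sdom \<sigma>" using \<sigma> by (simp add: slice_ar)
    have eq: "sdom \<sigma> \<cdot> g = sdom \<sigma> \<cdot> h"
      using comp_reduce[OF tri, of g] comp_reduce[OF tri, of h] gh \<sigma> by (simp add: slice_ar)
    have "SliceAr (sdom \<sigma> \<cdot> g) (sdom \<sigma>) g = SliceAr (sdom \<sigma> \<cdot> h) (sdom \<sigma>) h"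
      by (rule S.monicD[OF m]) (use gh \<sigma> eq in \<open>simp_all add: slice_ar slice_simps\<close>)
    then show "g = h" by simp
  qed (use \<sigma> in \<open>simp add: slice_ar\<close>)
next
  interpret S: category "slice C Y" by (rule slice_category)
  assume m: "\<sigma> \<in> Ar (slice C Y) \<and> monic C (smap \<sigma>)"
  show "monic (slice C Y) \<sigma>"
  proof (rule S.monicI)
    fix g h assume gh: "g \<in> Ar (slice C Y)" "h \<in> Ar (slice C Y)" "Cod (slice C Y) g = Dom (slice C Y) \<sigma>"
      "Cod (slice C Y) h = Dom (slice C Y) \<sigma>" "Dom (slice C Y) g = Dom (slice C Y) h"
      "\<sigma> \<cdot>\<^bsub>slice C Y\<^esub> g = \<sigma> \<cdot>\<^bsub>slice C Y\<^esub> h"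
    have "smap g = smap h"
      by (rule monicD[of "smap \<sigma>"]) (use m gh in \<open>simp_all add: slice_ar slice_simps\<close>)
    then show "g = h" by - (rule slice_ar_eqI, use gh in \<open>simp_all add: slice_simps\<close>)
  qed (use m in simp)
qed

end

lemma (in lex) slice_cartesian:
  assumes "Y \<in> Ob C"
  shows "cartesian (slice C Y)"
proof -
  interpret S: category "slice C Y" by (rule slice_category)
  show ?thesis
  proof
    show "\<exists>T. is_terminal (slice C Y) T" using slice_terminal[OF assms] by blast
    fix f g assume "f \<in> Ob (slice C Y)" "g \<in> Ob (slice C Y)"
    then show "\<exists>P p q. is_product (slice C Y) f g P p q"
      using ex_pullback[of f g] slice_product_of_pullback by (fastforce simp: slice_simps)
  qed
qed

section \<open>Functors that preserve finite products\<close>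

locale product_functor = C: cartesian C + D: cartesian D
  for C :: "('o, 'm) cat" and D :: "('p, 'n) cat" and F :: "('o, 'm, 'p, 'n) fctr" +
  assumes is_functor: "is_functor C D F"
    and preserves_product: "is_product C A B P p q \<Longrightarrow>
      is_product D (FOb F A) (FOb F B) (FOb F P) (FAr F p) (FAr F q)"
    and preserves_terminal: "is_terminal C T \<Longrightarrow> is_terminal D (FOb F T)"
begin

lemma F_simps [simp]:
  shows "A \<in> Ob C \<Longrightarrow> FOb F A \<in> Ob D" "A \<in> Ob C \<Longrightarrow> FAr F (Idn C A) = Idn D (FOb F A)"
    "f \<in> Ar C \<Longrightarrow> FAr F f \<in> Ar D" "f \<in> Ar C \<Longrightarrow> Dom D (FAr F f) = FOb F (Dom C f)"
    "f \<in> Ar C \<Longrightarrow> Cod D (FAr F f) = FOb F (Cod C f)"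
  using is_functor unfolding is_functor_def by (auto simp: in_hom)

lemma F_comp:
  assumes "f \<in> Ar C" "g \<in> Ar C" "Dom C g = Cod C f"
  shows "FAr F (g \<cdot>\<^bsub>C\<^esub> f) = FAr F g \<cdot>\<^bsub>D\<^esub> FAr F f"
  using is_functor assms unfolding is_functor_def by blast

lemma F_pair_unique:
  assumes "A \<in> Ob C" "B \<in> Ob C" "h \<in> Ar D" "k \<in> Ar D" "Dom D h = Dom D k"
    "Cod D h = FOb F (A \<otimes>\<^bsub>C\<^esub> B)" "Cod D k = FOb F (A \<otimes>\<^bsub>C\<^esub> B)"
    "FAr F (pr1 C A B) \<cdot>\<^bsub>D\<^esub> h = FAr F (pr1 C A B) \<cdot>\<^bsub>D\<^esub> k"
    "FAr F (pr2 C A B) \<cdot>\<^bsub>D\<^esub> h = FAr F (pr2 C A B) \<cdot>\<^bsub>D\<^esub> k"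
  shows "h = k"
  by (rule D.product_eq[OF preserves_product[OF C.product_chosen[OF assms(1,2)]]]) (use assms in simp_all)

lemma F_pair_exists:
  assumes "A \<in> Ob C" "B \<in> Ob C" "x \<in> Ar D" "y \<in> Ar D" "Dom D x = W" "Dom D y = W"
    "Cod D x = FOb F A" "Cod D y = FOb F B"
  obtains w where "w \<in> Ar D" "Dom D w = W" "Cod D w = FOb F (A \<otimes>\<^bsub>C\<^esub> B)"
    "FAr F (pr1 C A B) \<cdot>\<^bsub>D\<^esub> w = x" "FAr F (pr2 C A B) \<cdot>\<^bsub>D\<^esub> w = y"
  using D.product_factor[OF preserves_product[OF C.product_chosen[OF assms(1,2)]] assms(3-8)] by metis

lemma gob_functor [simp]: "gob (grp_functor_ob C D F G) = FOb F (gob G)"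
  and ginv_functor: "ginv (grp_functor_ob C D F G) = FAr F (ginv G)"
  by (simp_all add: grp_functor_ob_def Let_def)

text \<open>The comparison \<open>F G \<times> F G \<rightarrow> F (G \<times> G)\<close> in the definition of the multiplication of \<open>F G\<close> exists
  and is unique because \<open>F\<close> preserves the product \<open>G \<times> G\<close>.\<close>

lemma gmul_functor:
  assumes "is_group C G"
  shows "\<exists>k. gmul (grp_functor_ob C D F G) = FAr F (gmul G) \<cdot>\<^bsub>D\<^esub> k \<and> k \<in> Ar D \<and>
    Dom D k = FOb F (gob G) \<otimes>\<^bsub>D\<^esub> FOb F (gob G) \<and> Cod D k = FOb F (gob G \<otimes>\<^bsub>C\<^esub> gob G) \<and>
    FAr F (pr1 C (gob G) (gob G)) \<cdot>\<^bsub>D\<^esub> k = pr1 D (FOb F (gob G)) (FOb F (gob G)) \<and>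
    FAr F (pr2 C (gob G) (gob G)) \<cdot>\<^bsub>D\<^esub> k = pr2 D (FOb F (gob G)) (FOb F (gob G))"
proof -
  let ?A = "gob G" let ?B = "FOb F ?A"
  have A [simp]: "?A \<in> Ob C" using assms by simp
  have "\<exists>!k. k \<in> hom D (?B \<otimes>\<^bsub>D\<^esub> ?B) (FOb F (?A \<otimes>\<^bsub>C\<^esub> ?A)) \<and>
      FAr F (pr1 C ?A ?A) \<cdot>\<^bsub>D\<^esub> k = pr1 D ?B ?B \<and> FAr F (pr2 C ?A ?A) \<cdot>\<^bsub>D\<^esub> k = pr2 D ?B ?B"
    using D.product_ex1[OF preserves_product[OF C.product_chosen[OF A A]], of "pr1 D ?B ?B" "?B \<otimes>\<^bsub>D\<^esub> ?B" "pr2 D ?B ?B"]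
    by (simp add: in_hom)
  from theI'[OF this] show ?thesis
    unfolding grp_functor_ob_def Let_def grp.sel in_hom by blast
qed

text \<open>The operations of \<open>F G\<close> on points of the form \<open>F f \<circ> w\<close>, which are all points:
  this reduces the group laws of \<open>F G\<close> to those of \<open>G\<close>.\<close>

lemma functor_mul:
  assumes G: "is_group C G" and fg: "f \<in> Ar C" "g \<in> Ar C" "Dom C f = B" "Dom C g = B"
    "Cod C f = gob G" "Cod C g = gob G"
    and w: "w \<in> Ar D" "Cod D w = FOb F B"
  shows "gmul (grp_functor_ob C D F G) \<cdot>\<^bsub>D\<^esub> \<langle>FAr F f \<cdot>\<^bsub>D\<^esub> w, FAr F g \<cdot>\<^bsub>D\<^esub> w\<rangle>\<^bsub>D\<^esub>
    = FAr F (gmul G \<cdot>\<^bsub>C\<^esub> \<langle>f, g\<rangle>\<^bsub>C\<^esub>) \<cdot>\<^bsub>D\<^esub> w"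
proof -
  let ?A = "gob G"
  note [simp] = G fg w
  obtain k where k: "gmul (grp_functor_ob C D F G) = FAr F (gmul G) \<cdot>\<^bsub>D\<^esub> k"
    and kt [simp]: "k \<in> Ar D" "Dom D k = FOb F ?A \<otimes>\<^bsub>D\<^esub> FOb F ?A" "Cod D k = FOb F (?A \<otimes>\<^bsub>C\<^esub> ?A)"
    and k1: "FAr F (pr1 C ?A ?A) \<cdot>\<^bsub>D\<^esub> k = pr1 D (FOb F ?A) (FOb F ?A)"
    and k2: "FAr F (pr2 C ?A ?A) \<cdot>\<^bsub>D\<^esub> k = pr2 D (FOb F ?A) (FOb F ?A)"
    using gmul_functor[OF G] by blast
  have pr: "FAr F (pr1 C ?A ?A) \<cdot>\<^bsub>D\<^esub> FAr F \<langle>f, g\<rangle>\<^bsub>C\<^esub> = FAr F f"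
    "FAr F (pr2 C ?A ?A) \<cdot>\<^bsub>D\<^esub> FAr F \<langle>f, g\<rangle>\<^bsub>C\<^esub> = FAr F g"
    by (simp_all add: F_comp[symmetric])
  have "k \<cdot>\<^bsub>D\<^esub> \<langle>FAr F f \<cdot>\<^bsub>D\<^esub> w, FAr F g \<cdot>\<^bsub>D\<^esub> w\<rangle>\<^bsub>D\<^esub> = FAr F \<langle>f, g\<rangle>\<^bsub>C\<^esub> \<cdot>\<^bsub>D\<^esub> w"
    by (rule F_pair_unique[of ?A ?A])
      (simp_all add: D.comp_reduce[OF k1] D.comp_reduce[OF k2] D.comp_reduce[OF pr(1)] D.comp_reduce[OF pr(2)])
  then show ?thesis by (simp add: k F_comp)
qed

text \<open>The corresponding formula for the unit: all arrows into the image of the terminal object agree.\<close>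

lemma functor_one:
  assumes G: "is_group C G"
  shows "gone (grp_functor_ob C D F G) \<in> hom D \<one>\<^bsub>D\<^esub> (FOb F (gob G))"
    and "B \<in> Ob C \<Longrightarrow> w \<in> Ar D \<Longrightarrow> Cod D w = FOb F B \<Longrightarrow> Dom D w = W \<Longrightarrow>
      gone (grp_functor_ob C D F G) \<cdot>\<^bsub>D\<^esub> bang D W = FAr F (gone G \<cdot>\<^bsub>C\<^esub> bang C B) \<cdot>\<^bsub>D\<^esub> w"
proof -
  note [simp] = G
  note T = preserves_terminal[OF C.terminal_chosen]
  have "\<exists>!k. k \<in> hom D \<one>\<^bsub>D\<^esub> (FOb F \<one>\<^bsub>C\<^esub>)" using T unfolding is_terminal_def by simp
  from theI'[OF this] obtain k where k: "gone (grp_functor_ob C D F G) = FAr F (gone G) \<cdot>\<^bsub>D\<^esub> k"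
    and [simp]: "k \<in> Ar D" "Dom D k = \<one>\<^bsub>D\<^esub>" "Cod D k = FOb F \<one>\<^bsub>C\<^esub>"
    unfolding grp_functor_ob_def Let_def grp.sel in_hom by blast
  show "gone (grp_functor_ob C D F G) \<in> hom D \<one>\<^bsub>D\<^esub> (FOb F (gob G))" by (simp add: k in_hom)
  assume [simp]: "B \<in> Ob C" "w \<in> Ar D" "Cod D w = FOb F B" "Dom D w = W"
  have [simp]: "W \<in> Ob D" using D.ob_simps(1)[of w] by simp
  have "k \<cdot>\<^bsub>D\<^esub> bang D W = FAr F (bang C B) \<cdot>\<^bsub>D\<^esub> w"
    by (rule D.terminal_unique[OF T]) simp_all
  then show "gone (grp_functor_ob C D F G) \<cdot>\<^bsub>D\<^esub> bang D W = FAr F (gone G \<cdot>\<^bsub>C\<^esub> bang C B) \<cdot>\<^bsub>D\<^esub> w"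
    by (simp add: k F_comp)
qed

lemma functor_group:
  assumes G: "is_group C G"
  shows "is_group D (grp_functor_ob C D F G)"
proof -
  let ?A = "gob G" and ?H = "grp_functor_ob C D F G"
  note [simp] = G
  obtain k where k: "gmul ?H = FAr F (gmul G) \<cdot>\<^bsub>D\<^esub> k"
    and [simp]: "k \<in> Ar D" "Dom D k = FOb F ?A \<otimes>\<^bsub>D\<^esub> FOb F ?A" "Cod D k = FOb F (?A \<otimes>\<^bsub>C\<^esub> ?A)"
    using gmul_functor[OF G] by blast
  show ?thesis
  proof (rule D.is_groupI)
    show "gmul ?H \<in> hom D (gob ?H \<otimes>\<^bsub>D\<^esub> gob ?H) (gob ?H)" by (simp add: k in_hom)
    show "gone ?H \<in> hom D \<one>\<^bsub>D\<^esub> (gob ?H)" using functor_one(1)[OF G] by simp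
  next
    fix W x y z assume "x \<in> hom D W (gob ?H)" "y \<in> hom D W (gob ?H)" "z \<in> hom D W (gob ?H)"
    then have xyz: "x \<in> Ar D" "Dom D x = W" "Cod D x = FOb F ?A" "y \<in> Ar D" "Dom D y = W" "Cod D y = FOb F ?A"
      "z \<in> Ar D" "Dom D z = W" "Cod D z = FOb F ?A" by (simp_all add: in_hom)
    let ?B = "?A \<otimes>\<^bsub>C\<^esub> (?A \<otimes>\<^bsub>C\<^esub> ?A)"
    obtain v where v: "v \<in> Ar D" "Dom D v = W" "Cod D v = FOb F (?A \<otimes>\<^bsub>C\<^esub> ?A)"
        "FAr F (pr1 C ?A ?A) \<cdot>\<^bsub>D\<^esub> v = y" "FAr F (pr2 C ?A ?A) \<cdot>\<^bsub>D\<^esub> v = z"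
      by (rule F_pair_exists[of ?A ?A y z W]) (use xyz in simp_all)
    obtain w where w [simp]: "w \<in> Ar D" "Dom D w = W" "Cod D w = FOb F ?B"
        and w1: "FAr F (pr1 C ?A (?A \<otimes>\<^bsub>C\<^esub> ?A)) \<cdot>\<^bsub>D\<^esub> w = x" and w2: "FAr F (pr2 C ?A (?A \<otimes>\<^bsub>C\<^esub> ?A)) \<cdot>\<^bsub>D\<^esub> w = v"
      by (rule F_pair_exists[of ?A "?A \<otimes>\<^bsub>C\<^esub> ?A" x v W]) (use xyz v in simp_all)
    let ?f = "pr1 C ?A (?A \<otimes>\<^bsub>C\<^esub> ?A)" and ?g = "pr1 C ?A ?A \<cdot>\<^bsub>C\<^esub> pr2 C ?A (?A \<otimes>\<^bsub>C\<^esub> ?A)"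
      and ?h = "pr2 C ?A ?A \<cdot>\<^bsub>C\<^esub> pr2 C ?A (?A \<otimes>\<^bsub>C\<^esub> ?A)"
    have x: "x = FAr F ?f \<cdot>\<^bsub>D\<^esub> w" and y: "y = FAr F ?g \<cdot>\<^bsub>D\<^esub> w" and z: "z = FAr F ?h \<cdot>\<^bsub>D\<^esub> w"
      using v(4,5) w1 w2 by (simp_all add: F_comp)
    show "gmul ?H \<cdot>\<^bsub>D\<^esub> \<langle>gmul ?H \<cdot>\<^bsub>D\<^esub> \<langle>x, y\<rangle>\<^bsub>D\<^esub>, z\<rangle>\<^bsub>D\<^esub> = gmul ?H \<cdot>\<^bsub>D\<^esub> \<langle>x, gmul ?H \<cdot>\<^bsub>D\<^esub> \<langle>y, z\<rangle>\<^bsub>D\<^esub>\<rangle>\<^bsub>D\<^esub>"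
      unfolding x y z by (simp add: functor_mul[OF G, where B = ?B] C.mul_assoc)
  next
    fix W x assume "x \<in> hom D W (gob ?H)"
    then have [simp]: "x \<in> Ar D" "Dom D x = W" "Cod D x = FOb F ?A" by (simp_all add: in_hom)
    let ?I = "Idn C ?A"
    have x: "x = FAr F ?I \<cdot>\<^bsub>D\<^esub> x" and ix: "ginv ?H \<cdot>\<^bsub>D\<^esub> x = FAr F (ginv G) \<cdot>\<^bsub>D\<^esub> x"
      by (simp_all add: ginv_functor)
    have one: "gone ?H \<cdot>\<^bsub>D\<^esub> bang D W = FAr F (gone G \<cdot>\<^bsub>C\<^esub> bang C ?A) \<cdot>\<^bsub>D\<^esub> x"
      by (rule functor_one(2)[OF G]) simp_all
    note mul = functor_mul[OF G, where B = ?A and w = x]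
    show "gmul ?H \<cdot>\<^bsub>D\<^esub> \<langle>gone ?H \<cdot>\<^bsub>D\<^esub> bang D W, x\<rangle>\<^bsub>D\<^esub> = x \<and>
      gmul ?H \<cdot>\<^bsub>D\<^esub> \<langle>x, gone ?H \<cdot>\<^bsub>D\<^esub> bang D W\<rangle>\<^bsub>D\<^esub> = x \<and>
      gmul ?H \<cdot>\<^bsub>D\<^esub> \<langle>ginv ?H \<cdot>\<^bsub>D\<^esub> x, x\<rangle>\<^bsub>D\<^esub> = gone ?H \<cdot>\<^bsub>D\<^esub> bang D W \<and>
      gmul ?H \<cdot>\<^bsub>D\<^esub> \<langle>x, ginv ?H \<cdot>\<^bsub>D\<^esub> x\<rangle>\<^bsub>D\<^esub> = gone ?H \<cdot>\<^bsub>D\<^esub> bang D W"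
      using mul[of "gone G \<cdot>\<^bsub>C\<^esub> bang C ?A" ?I] mul[of ?I "gone G \<cdot>\<^bsub>C\<^esub> bang C ?A"]
        mul[of "ginv G" ?I] mul[of ?I "ginv G"] C.mul_unit_inv[OF G, of ?I ?A]
      unfolding one ix by simp
  qed (simp_all add: ginv_functor in_hom)
qed

lemma functor_group_hom:
  assumes f: "is_group_hom C (GrpAr G H f)"
  shows "is_group_hom D (GrpAr (grp_functor_ob C D F G) (grp_functor_ob C D F H) (FAr F f))"
proof -
  note [simp] = C.group_hom_arrows[OF f]
  show ?thesis
  proof (rule D.is_group_homI)
    let ?A = "gob G"
    fix W x y assume "x \<in> hom D W (gob (grp_functor_ob C D F G))" "y \<in> hom D W (gob (grp_functor_ob C D F G))"
    then have xy: "x \<in> Ar D" "Dom D x = W" "Cod D x = FOb F ?A" "y \<in> Ar D" "Dom D y = W" "Cod D y = FOb F ?A"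
      by (simp_all add: in_hom)
    obtain w where w [simp]: "w \<in> Ar D" "Dom D w = W" "Cod D w = FOb F (?A \<otimes>\<^bsub>C\<^esub> ?A)"
        and x: "FAr F (pr1 C ?A ?A) \<cdot>\<^bsub>D\<^esub> w = x" and y: "FAr F (pr2 C ?A ?A) \<cdot>\<^bsub>D\<^esub> w = y"
      by (rule F_pair_exists[of ?A ?A x y W]) (use xy in simp_all)
    have F_reduce: "FAr F f \<cdot>\<^bsub>D\<^esub> (FAr F g \<cdot>\<^bsub>D\<^esub> w) = FAr F (f \<cdot>\<^bsub>C\<^esub> g) \<cdot>\<^bsub>D\<^esub> w"
      if "g \<in> Ar C" "Cod C g = ?A" "Dom C g = ?A \<otimes>\<^bsub>C\<^esub> ?A" for g using that by (simp add: F_comp)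
    have hom: "f \<cdot>\<^bsub>C\<^esub> gmul G = gmul H \<cdot>\<^bsub>C\<^esub> \<langle>f \<cdot>\<^bsub>C\<^esub> pr1 C ?A ?A, f \<cdot>\<^bsub>C\<^esub> pr2 C ?A ?A\<rangle>\<^bsub>C\<^esub>"
      using C.group_hom_mul[OF f, of "pr1 C ?A ?A" "pr2 C ?A ?A"] by simp
    have "gmul (grp_functor_ob C D F G) \<cdot>\<^bsub>D\<^esub> \<langle>x, y\<rangle>\<^bsub>D\<^esub> = FAr F (gmul G) \<cdot>\<^bsub>D\<^esub> w"
      unfolding x[symmetric] y[symmetric] by (simp add: functor_mul[where B = "?A \<otimes>\<^bsub>C\<^esub> ?A"])
    moreover have "gmul (grp_functor_ob C D F H) \<cdot>\<^bsub>D\<^esub> \<langle>FAr F f \<cdot>\<^bsub>D\<^esub> x, FAr F f \<cdot>\<^bsub>D\<^esub> y\<rangle>\<^bsub>D\<^esub>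
        = FAr F (f \<cdot>\<^bsub>C\<^esub> gmul G) \<cdot>\<^bsub>D\<^esub> w"
      unfolding x[symmetric] y[symmetric] hom
      by (simp add: F_reduce functor_mul[where B = "?A \<otimes>\<^bsub>C\<^esub> ?A"])
    ultimately show "FAr F f \<cdot>\<^bsub>D\<^esub> (gmul (grp_functor_ob C D F G) \<cdot>\<^bsub>D\<^esub> \<langle>x, y\<rangle>\<^bsub>D\<^esub>)
        = gmul (grp_functor_ob C D F H) \<cdot>\<^bsub>D\<^esub> \<langle>FAr F f \<cdot>\<^bsub>D\<^esub> x, FAr F f \<cdot>\<^bsub>D\<^esub> y\<rangle>\<^bsub>D\<^esub>"
      by (simp add: F_comp)
  qed (simp_all add: functor_group in_hom)
qed

end

section \<open>Base change functors between slices\<close>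

context lex
begin

lemma times_over_simps:
  "FOb (times_over C X) A = pr2 C A X"
  "FAr (times_over C X) f = SliceAr (pr2 C (Dom C f) X) (pr2 C (Cod C f) X) (f \<otimes>\<^sub>a Idn C X)"
  by (simp_all add: times_over_def)

text \<open>The functor is right adjoint to the domain functor of the slice, hence preserves products: an
  arrow into \<open>A \<times> X\<close> over \<open>X\<close> is an arrow into \<open>A\<close>.\<close>

lemma times_over_functor:
  assumes X: "X \<in> Ob C"
  shows "product_functor C (slice C X) (times_over C X)"
proof -
  let ?F = "times_over C X"
  let ?S = "slice C X"
  interpret S: cartesian "?S" by (rule slice_cartesian[OF X])
  note [simp] = X
  show ?thesis
  proof
    show "is_functor C ?S ?F"
      unfolding is_functor_def times_over_simps
      by (auto simp: slice_ar slice_simps in_hom prod_ar_def)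
  next
    fix A B P p q assume P: "is_product C A B P p q"
    note [simp] = product_arrows[OF P]
    let ?p = "p \<otimes>\<^sub>a Idn C X" and ?q = "q \<otimes>\<^sub>a Idn C X"
    have "is_pullback C (pr2 C A X) (pr2 C B X) (P \<otimes> X) ?p ?q"
    proof (rule is_pullbackI)
      fix W k l
      assume kl: "k \<in> Ar C" "l \<in> Ar C" "Dom C k = W" "Dom C l = W" "Cod C k = Dom C (pr2 C A X)"
        "Cod C l = Dom C (pr2 C B X)" and eq: "pr2 C A X \<cdot> k = pr2 C B X \<cdot> l"
      obtain h where [simp]: "h \<in> Ar C" "Dom C h = W" "Cod C h = P"
        and h: "p \<cdot> h = pr1 C A X \<cdot> k" "q \<cdot> h = pr1 C B X \<cdot> l"
        by (rule product_factor[OF P, of "pr1 C A X \<cdot> k" "pr1 C B X \<cdot> l" W]) (use kl in simp_all)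
      let ?h = "\<langle>h, pr2 C A X \<cdot> k\<rangle>"
      have "?p \<cdot> ?h = k" by (rule product_ext[of _ _ A X]) (use kl h in simp_all)
      moreover have "?q \<cdot> ?h = l" by (rule product_ext[of _ _ B X]) (use kl h eq in simp_all)
      ultimately show "\<exists>h. h \<in> Ar C \<and> Dom C h = W \<and> Cod C h = P \<otimes> X \<and> ?p \<cdot> h = k \<and> ?q \<cdot> h = l"
        using kl by (intro exI[of _ ?h]) simp
    next
      fix h k assume hk: "h \<in> Ar C" "k \<in> Ar C" "Dom C h = Dom C k" "Cod C h = P \<otimes> X" "Cod C k = P \<otimes> X"
      assume "?p \<cdot> h = ?p \<cdot> k" "?q \<cdot> h = ?q \<cdot> k"
      then have p: "\<langle>p \<cdot> (pr1 C P X \<cdot> h), pr2 C P X \<cdot> h\<rangle> = \<langle>p \<cdot> (pr1 C P X \<cdot> k), pr2 C P X \<cdot> k\<rangle>"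
        and q: "\<langle>q \<cdot> (pr1 C P X \<cdot> h), pr2 C P X \<cdot> h\<rangle> = \<langle>q \<cdot> (pr1 C P X \<cdot> k), pr2 C P X \<cdot> k\<rangle>"
        using hk by simp_all
      have "p \<cdot> (pr1 C P X \<cdot> h) = p \<cdot> (pr1 C P X \<cdot> k)" "pr2 C P X \<cdot> h = pr2 C P X \<cdot> k"
        by (rule pairing_inject[OF p], use hk in simp_all)+
      moreover have "q \<cdot> (pr1 C P X \<cdot> h) = q \<cdot> (pr1 C P X \<cdot> k)"
        by (rule pairing_inject(1)[OF q]) (use hk in simp_all)
      ultimately have "pr1 C P X \<cdot> h = pr1 C P X \<cdot> k" "pr2 C P X \<cdot> h = pr2 C P X \<cdot> k"
        by - (rule product_eq[OF P], use hk in simp_all)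
      then show "h = k" by - (rule product_ext[of _ _ P X], use hk in simp_all)
    qed simp_all
    then show "is_product ?S (FOb ?F A) (FOb ?F B) (FOb ?F P)
        (FAr ?F p) (FAr ?F q)"
      unfolding times_over_simps by (intro slice_productI) (simp_all add: slice_ar)
  next
    fix T assume T: "is_terminal C T"
    then have [simp]: "T \<in> Ob C" by (simp add: is_terminal_def)
    obtain f where [simp]: "f \<in> Ar C" "Dom C f = X" "Cod C f = T" by (rule terminal_arrow[OF T X])
    have "f \<cdot> pr2 C T X = pr1 C T X" by (rule terminal_unique[OF T]) simp_all
    then have "\<langle>f, Idn C X\<rangle> \<cdot> pr2 C T X = Idn C (T \<otimes> X)" by simp
    then show "is_terminal ?S (FOb ?F T)"
      unfolding times_over_simps
      by (intro slice_terminalI[of _ "T \<otimes> X" _ "\<langle>f, Idn C X\<rangle>"]) (simp_all add: in_hom)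
  qed
qed

text \<open>The points of \<open>P \<times> X\<close> over \<open>w\<close> are the pairs \<open>(x, w)\<close>. They are the images of the points \<open>x\<close> of
  \<open>P\<close> composed with the point \<open>(1, w)\<close> of \<open>W \<times> X\<close>, where \<open>W\<close> is the domain of \<open>w\<close>, so \<open>functor_mul\<close>
  applies.\<close>

lemma times_over_mul:
  assumes P: "is_group C P" and xy: "x \<in> Ar C" "y \<in> Ar C" "Dom C x = Dom C w" "Dom C y = Dom C w"
    "Cod C x = gob P" "Cod C y = gob P" and w: "w \<in> Ar C" "Cod C w = X"
  shows "gmul (grp_functor_ob C (slice C X) (times_over C X) P) \<cdot>\<^bsub>slice C X\<^esub>
      \<langle>SliceAr w (pr2 C (gob P) X) \<langle>x, w\<rangle>, SliceAr w (pr2 C (gob P) X) \<langle>y, w\<rangle>\<rangle>\<^bsub>slice C X\<^esub>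
    = SliceAr w (pr2 C (gob P) X) \<langle>gmul P \<cdot> \<langle>x, y\<rangle>, w\<rangle>"
proof -
  note [simp] = P xy w
  have X [simp]: "X \<in> Ob C" using ob_simps(2)[OF w(1)] w(2) by simp
  interpret F: product_functor C "slice C X" "times_over C X" by (rule times_over_functor[OF X])
  let ?w = "SliceAr w (pr2 C (Dom C w) X) \<langle>Idn C (Dom C w), w\<rangle>"
  have pt: "FAr (times_over C X) z \<cdot>\<^bsub>slice C X\<^esub> ?w = SliceAr w (pr2 C (gob P) X) \<langle>z, w\<rangle>"
    if "z \<in> Ar C" "Dom C z = Dom C w" "Cod C z = gob P" for z
    using that by (simp add: times_over_simps slice_simps)
  show ?thesis
    using F.functor_mul[OF P, of x y "Dom C w" ?w]
    by (simp add: pt) (simp add: slice_ar slice_simps times_over_simps)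
qed

lemma times_over_unit:
  assumes P: "is_group C P" and w: "w \<in> Ar C" "Cod C w = X"
  shows "gone (grp_functor_ob C (slice C X) (times_over C X) P) \<cdot>\<^bsub>slice C X\<^esub> bang (slice C X) w
    = SliceAr w (pr2 C (gob P) X) \<langle>gone P \<cdot> bang C (Dom C w), w\<rangle>"
proof -
  note [simp] = P w
  have X [simp]: "X \<in> Ob C" using ob_simps(2)[OF w(1)] w(2) by simp
  interpret F: product_functor C "slice C X" "times_over C X" by (rule times_over_functor[OF X])
  let ?w = "SliceAr w (pr2 C (Dom C w) X) \<langle>Idn C (Dom C w), w\<rangle>"
  have "gone (grp_functor_ob C (slice C X) (times_over C X) P) \<cdot>\<^bsub>slice C X\<^esub> bang (slice C X) w
    = FAr (times_over C X) (gone P \<cdot> bang C (Dom C w)) \<cdot>\<^bsub>slice C X\<^esub> ?w"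
    by (rule F.functor_one(2)[OF P]) (simp_all add: slice_ar slice_simps times_over_simps)
  then show ?thesis by (simp add: times_over_simps slice_simps)
qed

lemma pullback_functor_ar:
  assumes t: "t \<in> Ar C" and \<sigma>: "\<sigma> \<in> Ar (slice C (Cod C t))"
  obtains k where "FAr (pullback_functor C t) \<sigma> = SliceAr (pb2 C (sdom \<sigma>) t) (pb2 C (scod \<sigma>) t) k"
    "k \<in> Ar C" "Dom C k = pb_ob C (sdom \<sigma>) t" "Cod C k = pb_ob C (scod \<sigma>) t"
    "pb1 C (scod \<sigma>) t \<cdot> k = smap \<sigma> \<cdot> pb1 C (sdom \<sigma>) t" "pb2 C (scod \<sigma>) t \<cdot> k = pb2 C (sdom \<sigma>) t"
proof -
  define f g where "f = sdom \<sigma>" and "g = scod \<sigma>"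
  have [simp]: "f \<in> Ar C" "g \<in> Ar C" "Cod C f = Cod C t" "Cod C g = Cod C t" "smap \<sigma> \<in> Ar C"
    "Dom C (smap \<sigma>) = Dom C f" "Cod C (smap \<sigma>) = Dom C g" and tri: "g \<cdot> smap \<sigma> = f"
    using \<sigma> by (simp_all add: slice_ar f_def g_def)
  note [simp] = t
  note pbf = pullback_chosen[of f t, simplified] and pbg = pullback_chosen[of g t, simplified]
  note [simp] = pullback_arrows(4-10)[OF pbf] pullback_arrows(4-10)[OF pbg]
  obtain k where k: "k \<in> hom C (pb_ob C f t) (pb_ob C g t) \<and> pb1 C g t \<cdot> k = smap \<sigma> \<cdot> pb1 C f t \<and>
      pb2 C g t \<cdot> k = pb2 C f t"
    using pullback_factor[OF pbg, of "smap \<sigma> \<cdot> pb1 C f t" "pb2 C f t" "pb_ob C f t"]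
      pullback_arrows(11)[OF pbf] by (auto simp: in_hom comp_reduce[OF tri])
  have "\<exists>!k. k \<in> hom C (pb_ob C f t) (pb_ob C g t) \<and> pb1 C g t \<cdot> k = smap \<sigma> \<cdot> pb1 C f t \<and>
      pb2 C g t \<cdot> k = pb2 C f t"
    by (rule ex1I[of _ k], rule k, rule pullback_eq[OF pbg]) (use k in \<open>simp_all add: in_hom\<close>)
  note K = theI'[OF this, unfolded f_def g_def]
  show ?thesis
  proof (rule that)
    show "FAr (pullback_functor C t) \<sigma> = SliceAr (pb2 C (sdom \<sigma>) t) (pb2 C (scod \<sigma>) t)
        (THE k. k \<in> hom C (pb_ob C (sdom \<sigma>) t) (pb_ob C (scod \<sigma>) t) \<and>
          pb1 C (scod \<sigma>) t \<cdot> k = smap \<sigma> \<cdot> pb1 C (sdom \<sigma>) t \<and> pb2 C (scod \<sigma>) t \<cdot> k = pb2 C (sdom \<sigma>) t)"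
      by (simp add: pullback_functor_def)
  qed (use K in \<open>simp_all only: in_hom\<close>)
qed

lemma FOb_pullback_functor: "FOb (pullback_functor C t) f = pb2 C f t"
  by (simp add: pullback_functor_def)

text \<open>Pullback along \<open>t\<close> is right adjoint to composition with \<open>t\<close>, hence preserves products: a point
  of \<open>t\<^sup>*f\<close> over \<open>w\<close> is a point of \<open>f\<close> over \<open>t \<circ> w\<close>.\<close>

lemma pullback_functor_functor:
  assumes t: "t \<in> Ar C"
  shows "product_functor (slice C (Cod C t)) (slice C (Dom C t)) (pullback_functor C t)"
proof -
  define Y X where "Y = Cod C t" and "X = Dom C t"
  have [simp]: "t \<in> Ar C" "Cod C t = Y" "Dom C t = X" "X \<in> Ob C" "Y \<in> Ob C"
    using t by (simp_all add: X_def Y_def)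
  let ?SY = "slice C Y"
  let ?SX = "slice C X"
  interpret SY: cartesian "?SY" by (rule slice_cartesian) simp
  interpret SX: cartesian "?SX" by (rule slice_cartesian) simp
  let ?F = "pullback_functor C t"
  have pb: "is_pullback C f t (pb_ob C f t) (pb1 C f t) (pb2 C f t)" if "f \<in> Ar C" "Cod C f = Y" for f
    using that by (intro pullback_chosen) simp_all
  have arr [simp]: "pb_ob C f t \<in> Ob C" "pb1 C f t \<in> Ar C" "Dom C (pb1 C f t) = pb_ob C f t"
    "Cod C (pb1 C f t) = Dom C f" "pb2 C f t \<in> Ar C" "Dom C (pb2 C f t) = pb_ob C f t"
    "Cod C (pb2 C f t) = X" if "f \<in> Ar C" "Cod C f = Y" for f
    using pullback_arrows(4-10)[OF pb[OF that]] by simp_all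
  note sq = pullback_arrows(11)[OF pb]
  have sq': "f \<cdot> (pb1 C f t \<cdot> h) = t \<cdot> (pb2 C f t \<cdot> h)"
    if "f \<in> Ar C" "Cod C f = Y" "h \<in> Ar C" "Cod C h = pb_ob C f t" for f h
    using that by (simp add: comp_reduce[OF sq])
  have FAr: "FAr ?F \<sigma> = SliceAr (pb2 C (sdom \<sigma>) t) (pb2 C (scod \<sigma>) t) (smap (FAr ?F \<sigma>))"
    "smap (FAr ?F \<sigma>) \<in> Ar C" "Dom C (smap (FAr ?F \<sigma>)) = pb_ob C (sdom \<sigma>) t"
    "Cod C (smap (FAr ?F \<sigma>)) = pb_ob C (scod \<sigma>) t"
    "pb1 C (scod \<sigma>) t \<cdot> smap (FAr ?F \<sigma>) = smap \<sigma> \<cdot> pb1 C (sdom \<sigma>) t"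
    "pb2 C (scod \<sigma>) t \<cdot> smap (FAr ?F \<sigma>) = pb2 C (sdom \<sigma>) t"
    if \<sigma>: "\<sigma> \<in> Ar ?SY" for \<sigma>
  proof -
    obtain k where k: "FAr ?F \<sigma> = SliceAr (pb2 C (sdom \<sigma>) t) (pb2 C (scod \<sigma>) t) k"
      "k \<in> Ar C" "Dom C k = pb_ob C (sdom \<sigma>) t" "Cod C k = pb_ob C (scod \<sigma>) t"
      "pb1 C (scod \<sigma>) t \<cdot> k = smap \<sigma> \<cdot> pb1 C (sdom \<sigma>) t" "pb2 C (scod \<sigma>) t \<cdot> k = pb2 C (sdom \<sigma>) t"
      by (rule pullback_functor_ar[of t \<sigma>]) (use \<sigma> in simp_all)
    show "FAr ?F \<sigma> = SliceAr (pb2 C (sdom \<sigma>) t) (pb2 C (scod \<sigma>) t) (smap (FAr ?F \<sigma>))"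
      "smap (FAr ?F \<sigma>) \<in> Ar C" "Dom C (smap (FAr ?F \<sigma>)) = pb_ob C (sdom \<sigma>) t"
      "Cod C (smap (FAr ?F \<sigma>)) = pb_ob C (scod \<sigma>) t"
      "pb1 C (scod \<sigma>) t \<cdot> smap (FAr ?F \<sigma>) = smap \<sigma> \<cdot> pb1 C (sdom \<sigma>) t"
      "pb2 C (scod \<sigma>) t \<cdot> smap (FAr ?F \<sigma>) = pb2 C (sdom \<sigma>) t"
      using k by simp_all
  qed
  have FAr_sdom: "sdom (FAr ?F \<sigma>) = pb2 C (sdom \<sigma>) t" "scod (FAr ?F \<sigma>) = pb2 C (scod \<sigma>) t" for \<sigma>
    by (simp_all add: pullback_functor_def)
  have FAr_ar: "FAr ?F \<sigma> \<in> Ar ?SX" if \<sigma>: "\<sigma> \<in> Ar ?SY" for \<sigma>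
    using FAr[OF \<sigma>] \<sigma> by (simp add: slice_ar FAr_sdom)
  have "product_functor ?SY ?SX ?F"
  proof
    show "is_functor ?SY ?SX ?F"
      unfolding is_functor_def FOb_pullback_functor
    proof (intro conjI ballI impI)
      fix f assume "f \<in> Ob ?SY"
      then have [simp]: "f \<in> Ar C" "Cod C f = Y" by (simp_all add: slice_simps)
      show "pb2 C f t \<in> Ob ?SX" by (simp add: slice_simps)
      have I: "Idn ?SY f \<in> Ar ?SY" by (simp add: slice_ar slice_simps)
      note F = FAr[OF I, unfolded slice_simps, simplified]
      have "smap (FAr ?F (Idn ?SY f)) = Idn C (pb_ob C f t)"
        by (rule pullback_eq[OF pb[of f]]) (use F in \<open>simp_all add: slice_simps\<close>)
      then show "FAr ?F (Idn ?SY f) = Idn ?SX (pb2 C f t)"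
        by - (rule slice_ar_eqI, simp_all add: FAr_sdom slice_simps)
    next
      fix \<sigma> assume \<sigma>: "\<sigma> \<in> Ar ?SY"
      show "FAr ?F \<sigma> \<in> hom ?SX (pb2 C (Dom ?SY \<sigma>) t) (pb2 C (Cod ?SY \<sigma>) t)"
        using FAr_ar[OF \<sigma>] by (simp add: in_hom slice_simps FAr_sdom)
    next
      fix \<sigma> \<tau> assume st: "\<sigma> \<in> Ar ?SY" "\<tau> \<in> Ar ?SY" "Dom ?SY \<tau> = Cod ?SY \<sigma>"
      have ts: "\<tau> \<cdot>\<^bsub>?SY\<^esub> \<sigma> \<in> Ar ?SY" using st by simp
      define f g h where "f = sdom \<sigma>" and "g = scod \<sigma>" and "h = scod \<tau>"
      have [simp]: "sdom \<sigma> = f" "scod \<sigma> = g" "sdom \<tau> = g" "scod \<tau> = h"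
        using st by (simp_all add: f_def g_def h_def slice_simps)
      have [simp]: "f \<in> Ar C" "Cod C f = Y" "g \<in> Ar C" "Cod C g = Y" "h \<in> Ar C" "Cod C h = Y"
        "smap \<sigma> \<in> Ar C" "Dom C (smap \<sigma>) = Dom C f" "Cod C (smap \<sigma>) = Dom C g"
        "smap \<tau> \<in> Ar C" "Dom C (smap \<tau>) = Dom C g" "Cod C (smap \<tau>) = Dom C h"
        using st by (simp_all add: slice_ar)
      note F\<sigma> = FAr(2-6)[OF st(1), simplified] and F\<tau> = FAr(2-6)[OF st(2), simplified]
      note [simp] = F\<sigma> F\<tau>
      note F = FAr(2-6)[OF ts, unfolded slice_simps, simplified]
      have "smap (FAr ?F (\<tau> \<cdot>\<^bsub>?SY\<^esub> \<sigma>)) = smap (FAr ?F \<tau>) \<cdot> smap (FAr ?F \<sigma>)"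
        by (rule pullback_eq[OF pb[of h]])
          (use F in \<open>simp_all add: slice_simps comp_reduce[OF F\<tau>(4)] comp_reduce[OF F\<tau>(5)]\<close>)
      then show "FAr ?F (\<tau> \<cdot>\<^bsub>?SY\<^esub> \<sigma>) = FAr ?F \<tau> \<cdot>\<^bsub>?SX\<^esub> FAr ?F \<sigma>"
        by - (rule slice_ar_eqI, simp_all add: FAr_sdom slice_simps)
    qed
  next
    fix f g h \<rho> \<sigma> assume P: "is_product ?SY f g h \<rho> \<sigma>"
    note arrs = SY.product_arrows[OF P]
    have [simp]: "f \<in> Ar C" "Cod C f = Y" "g \<in> Ar C" "Cod C g = Y" "h \<in> Ar C" "Cod C h = Y"
      "sdom \<rho> = h" "scod \<rho> = f" "sdom \<sigma> = h" "scod \<sigma> = g"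
      "smap \<rho> \<in> Ar C" "Dom C (smap \<rho>) = Dom C h" "Cod C (smap \<rho>) = Dom C f"
      "smap \<sigma> \<in> Ar C" "Dom C (smap \<sigma>) = Dom C h" "Cod C (smap \<sigma>) = Dom C g"
      using arrs by (auto simp: slice_ar slice_simps)
    have tri: "f \<cdot> smap \<rho> = h" using arrs by (auto simp: slice_ar slice_simps)
    note F\<rho> [simp] = FAr(2-6)[OF arrs(4), simplified] and F\<sigma> [simp] = FAr(2-6)[OF arrs(7), simplified]
    note red = comp_reduce[OF F\<rho>(4)] comp_reduce[OF F\<rho>(5)] comp_reduce[OF F\<sigma>(4)] comp_reduce[OF F\<sigma>(5)]
    note base = pullback_of_slice_product[OF P]
    have "is_pullback C (pb2 C f t) (pb2 C g t) (pb_ob C h t) (smap (FAr ?F \<rho>)) (smap (FAr ?F \<sigma>))"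
    proof (rule is_pullbackI)
      fix W k l
      assume kl: "k \<in> Ar C" "l \<in> Ar C" "Dom C k = W" "Dom C l = W" "Cod C k = Dom C (pb2 C f t)"
        "Cod C l = Dom C (pb2 C g t)" and w: "pb2 C f t \<cdot> k = pb2 C g t \<cdot> l"
      obtain m where [simp]: "m \<in> Ar C" "Dom C m = W" "Cod C m = Dom C h"
        and m: "smap \<rho> \<cdot> m = pb1 C f t \<cdot> k" "smap \<sigma> \<cdot> m = pb1 C g t \<cdot> l"
        by (rule pullback_factor[OF base, of "pb1 C f t \<cdot> k" "pb1 C g t \<cdot> l" W]) (use kl w in \<open>simp_all add: sq'\<close>)
      have "h \<cdot> m = t \<cdot> (pb2 C f t \<cdot> k)"
        using comp_reduce[OF tri, of m] kl by (simp add: m sq')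
      then obtain n where n: "n \<in> Ar C" "Dom C n = W" "Cod C n = pb_ob C h t"
        "pb1 C h t \<cdot> n = m" "pb2 C h t \<cdot> n = pb2 C f t \<cdot> k"
        by - (rule pullback_factor[OF pb[of h], of m "pb2 C f t \<cdot> k" W], use kl in simp_all)
      have "smap (FAr ?F \<rho>) \<cdot> n = k" by (rule pullback_eq[OF pb[of f]]) (use kl n m in \<open>simp_all add: red\<close>)
      moreover have "smap (FAr ?F \<sigma>) \<cdot> n = l"
        by (rule pullback_eq[OF pb[of g]]) (use kl n m w in \<open>simp_all add: red\<close>)
      ultimately show "\<exists>n. n \<in> Ar C \<and> Dom C n = W \<and> Cod C n = pb_ob C h t \<and>
          smap (FAr ?F \<rho>) \<cdot> n = k \<and> smap (FAr ?F \<sigma>) \<cdot> n = l" using n by blast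
    next
      fix m n
      assume mn: "m \<in> Ar C" "n \<in> Ar C" "Dom C m = Dom C n" "Cod C m = pb_ob C h t" "Cod C n = pb_ob C h t"
        and e: "smap (FAr ?F \<rho>) \<cdot> m = smap (FAr ?F \<rho>) \<cdot> n" "smap (FAr ?F \<sigma>) \<cdot> m = smap (FAr ?F \<sigma>) \<cdot> n"
      have "smap \<rho> \<cdot> (pb1 C h t \<cdot> m) = smap \<rho> \<cdot> (pb1 C h t \<cdot> n)" and pb2: "pb2 C h t \<cdot> m = pb2 C h t \<cdot> n"
        using arg_cong[OF e(1), of "\<lambda>z. pb1 C f t \<cdot> z"] arg_cong[OF e(1), of "\<lambda>z. pb2 C f t \<cdot> z"] mn
        by (simp_all add: red)
      moreover have "smap \<sigma> \<cdot> (pb1 C h t \<cdot> m) = smap \<sigma> \<cdot> (pb1 C h t \<cdot> n)"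
        using arg_cong[OF e(2), of "\<lambda>z. pb1 C g t \<cdot> z"] mn by (simp add: red)
      ultimately have "pb1 C h t \<cdot> m = pb1 C h t \<cdot> n"
        by - (rule pullback_eq[OF base], use mn in simp_all)
      then show "m = n" using pb2 by - (rule pullback_eq[OF pb[of h]], use mn in simp_all)
    qed simp_all
    then show "is_product ?SX (FOb ?F f) (FOb ?F g) (FOb ?F h) (FAr ?F \<rho>) (FAr ?F \<sigma>)"
      unfolding FOb_pullback_functor
      by (rule slice_productI) (use FAr_ar[OF arrs(4)] in \<open>simp_all add: FAr_sdom\<close>)
  next
    fix f assume T: "is_terminal ?SY f"
    then have [simp]: "f \<in> Ar C" "Cod C f = Y" by (simp_all add: is_terminal_def slice_simps)
    obtain k where [simp]: "k \<in> Ar C" "Dom C k = Y" "Cod C k = Dom C f"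
      and k: "f \<cdot> k = Idn C Y" "k \<cdot> f = Idn C (Dom C f)"
      by (rule slice_terminalE[OF T])
    have kt: "k \<cdot> (t \<cdot> pb2 C f t) = pb1 C f t"
      using comp_reduce[OF k(2), of "pb1 C f t"] sq[of f] by simp
    obtain n where [simp]: "n \<in> Ar C" "Dom C n = X" "Cod C n = pb_ob C f t"
      and n: "pb1 C f t \<cdot> n = k \<cdot> t" "pb2 C f t \<cdot> n = Idn C X"
      by (rule pullback_factor[OF pb[of f], of "k \<cdot> t" "Idn C X" X]) (simp_all add: comp_reduce[OF k(1)])
    have "n \<cdot> pb2 C f t = Idn C (pb_ob C f t)"
      by (rule pullback_eq[OF pb[of f]]) (simp_all add: comp_reduce[OF n(1)] comp_reduce[OF n(2)] kt)
    then show "is_terminal ?SX (FOb ?F f)"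
      unfolding FOb_pullback_functor
      by (intro slice_terminalI[of _ "pb_ob C f t" _ n]) (simp_all add: in_hom n)
  qed
  then show ?thesis by simp
qed

text \<open>Multiplication in \<open>t\<^sup>*S\<close> is multiplication in \<open>S\<close> of the points lying over \<open>t \<circ> w\<close>. These are
  arrows \<open>t \<circ> w \<rightarrow> s\<close> over the codomain of \<open>t\<close>, and composing their images under \<open>t\<^sup>*\<close> with the
  universal point \<open>v\<close> of \<open>t\<^sup>*(t \<circ> w)\<close> gives back the points of \<open>t\<^sup>*S\<close>.\<close>

lemma pullback_mul:
  assumes t: "t \<in> Ar C" and S: "is_group (slice C (Cod C t)) S" and s: "gob S = s"
    and h: "h \<in> Ar C" "Cod C h = pb_ob C s t" "pb2 C s t \<cdot> h = w"
    and k: "k \<in> Ar C" "Cod C k = pb_ob C s t" "pb2 C s t \<cdot> k = w"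
    and dom: "Dom C h = Dom C w" "Dom C k = Dom C w"
  shows "pb1 C s t \<cdot> smap (gmul (grp_functor_ob (slice C (Cod C t)) (slice C (Dom C t)) (pullback_functor C t) S)
        \<cdot>\<^bsub>slice C (Dom C t)\<^esub> \<langle>SliceAr w (pb2 C s t) h, SliceAr w (pb2 C s t) k\<rangle>\<^bsub>slice C (Dom C t)\<^esub>)
    = smap (gmul S \<cdot>\<^bsub>slice C (Cod C t)\<^esub>
        \<langle>SliceAr (t \<cdot> w) s (pb1 C s t \<cdot> h), SliceAr (t \<cdot> w) s (pb1 C s t \<cdot> k)\<rangle>\<^bsub>slice C (Cod C t)\<^esub>)"
proof -
  define Y X where "Y = Cod C t" and "X = Dom C t"
  have tt [simp]: "t \<in> Ar C" "Cod C t = Y" "Dom C t = X" "X \<in> Ob C" "Y \<in> Ob C"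
    using t by (simp_all add: X_def Y_def)
  let ?F = "pullback_functor C t"
  let ?SY = "slice C Y"
  let ?SX = "slice C X"
  interpret F: product_functor "?SY" "?SX" "?F"
    using pullback_functor_functor[OF t] by simp
  have S' [simp]: "is_group ?SY S" using S by simp
  have "s \<in> Ob ?SY" using F.C.group_arrows(1)[OF S'] s by simp
  then have [simp]: "s \<in> Ar C" "Cod C s = Y" by (simp_all add: slice_simps)
  have pb: "is_pullback C f t (pb_ob C f t) (pb1 C f t) (pb2 C f t)" if "f \<in> Ar C" "Cod C f = Y" for f
    using that by (intro pullback_chosen) simp_all
  have arr [simp]: "pb_ob C f t \<in> Ob C" "pb1 C f t \<in> Ar C" "Dom C (pb1 C f t) = pb_ob C f t"
    "Cod C (pb1 C f t) = Dom C f" "pb2 C f t \<in> Ar C" "Dom C (pb2 C f t) = pb_ob C f t"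
    "Cod C (pb2 C f t) = X" if "f \<in> Ar C" "Cod C f = Y" for f
    using pullback_arrows(4-10)[OF pb[OF that]] by simp_all
  note [simp] = h k dom
  have [simp]: "w \<in> Ar C" "Cod C w = X" using comp_simps[of h "pb2 C s t"] by simp_all
  have sq: "s \<cdot> (pb1 C s t \<cdot> l) = t \<cdot> (pb2 C s t \<cdot> l)" if "l \<in> Ar C" "Cod C l = pb_ob C s t" for l
    using that by (simp add: comp_reduce[OF pullback_arrows(11)[OF pb]])
  obtain v where v [simp]: "v \<in> Ar C" "Dom C v = Dom C w" "Cod C v = pb_ob C (t \<cdot> w) t"
    "pb1 C (t \<cdot> w) t \<cdot> v = Idn C (Dom C w)" "pb2 C (t \<cdot> w) t \<cdot> v = w"
    by (rule pullback_factor[OF pb[of "t \<cdot> w"], of "Idn C (Dom C w)" w "Dom C w"]) simp_all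
  let ?v = "SliceAr w (pb2 C (t \<cdot> w) t) v"
  have v_ar [simp]: "?v \<in> Ar ?SX" "Cod ?SX ?v = FOb ?F (t \<cdot> w)"
    by (simp_all add: slice_ar slice_simps FOb_pullback_functor)
  have red: "pb1 C s t \<cdot> smap (FAr ?F \<sigma> \<cdot>\<^bsub>?SX\<^esub> ?v) = smap \<sigma>"
    "FAr ?F \<sigma> \<cdot>\<^bsub>?SX\<^esub> ?v = SliceAr w (pb2 C s t) (smap (FAr ?F \<sigma>) \<cdot> v)"
    "pb2 C s t \<cdot> smap (FAr ?F \<sigma> \<cdot>\<^bsub>?SX\<^esub> ?v) = w"
    "smap (FAr ?F \<sigma> \<cdot>\<^bsub>?SX\<^esub> ?v) \<in> hom C (Dom C w) (pb_ob C s t)"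
    if \<sigma>: "\<sigma> \<in> Ar ?SY" "sdom \<sigma> = t \<cdot> w" "scod \<sigma> = s" for \<sigma>
  proof -
    have [simp]: "smap \<sigma> \<in> Ar C" "Dom C (smap \<sigma>) = Dom C w" using \<sigma> by (simp_all add: slice_ar)
    obtain k where [simp]: "FAr ?F \<sigma> = SliceAr (pb2 C (t \<cdot> w) t) (pb2 C s t) k"
      "k \<in> Ar C" "Dom C k = pb_ob C (t \<cdot> w) t" "Cod C k = pb_ob C s t"
      and k: "pb1 C s t \<cdot> k = smap \<sigma> \<cdot> pb1 C (t \<cdot> w) t" "pb2 C s t \<cdot> k = pb2 C (t \<cdot> w) t"
      using pullback_functor_ar[of t \<sigma>] \<sigma> by auto
    show "pb1 C s t \<cdot> smap (FAr ?F \<sigma> \<cdot>\<^bsub>?SX\<^esub> ?v) = smap \<sigma>"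
      "FAr ?F \<sigma> \<cdot>\<^bsub>?SX\<^esub> ?v = SliceAr w (pb2 C s t) (smap (FAr ?F \<sigma>) \<cdot> v)"
      "pb2 C s t \<cdot> smap (FAr ?F \<sigma> \<cdot>\<^bsub>?SX\<^esub> ?v) = w"
      "smap (FAr ?F \<sigma> \<cdot>\<^bsub>?SX\<^esub> ?v) \<in> hom C (Dom C w) (pb_ob C s t)"
      by (simp_all add: slice_simps comp_reduce[OF k(1)] comp_reduce[OF k(2)] in_hom)
  qed
  have pt: "FAr ?F (SliceAr (t \<cdot> w) s (pb1 C s t \<cdot> l)) \<cdot>\<^bsub>?SX\<^esub> ?v
      = SliceAr w (pb2 C s t) l" if [simp]: "l \<in> Ar C" "Cod C l = pb_ob C s t" "pb2 C s t \<cdot> l = w" "Dom C l = Dom C w" for l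
  proof -
    let ?\<sigma> = "SliceAr (t \<cdot> w) s (pb1 C s t \<cdot> l)"
    have \<sigma>: "?\<sigma> \<in> Ar ?SY" "sdom ?\<sigma> = t \<cdot> w" "scod ?\<sigma> = s" by (simp_all add: slice_ar sq)
    have "smap (FAr ?F ?\<sigma> \<cdot>\<^bsub>?SX\<^esub> ?v) = l"
      by (rule pullback_eq[OF pb[of s]]) (use red[OF \<sigma>] in \<open>simp_all add: in_hom\<close>)
    then show ?thesis using red(2)[OF \<sigma>] by simp
  qed
  let ?h = "SliceAr (t \<cdot> w) s (pb1 C s t \<cdot> h)" and ?k = "SliceAr (t \<cdot> w) s (pb1 C s t \<cdot> k)"
  have hk: "?h \<in> Ar ?SY" "?k \<in> Ar ?SY" "Dom ?SY ?h = t \<cdot> w" "Dom ?SY ?k = t \<cdot> w"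
    "Cod ?SY ?h = gob S" "Cod ?SY ?k = gob S"
    by (simp_all add: slice_ar slice_simps sq s)
  let ?m = "gmul S \<cdot>\<^bsub>?SY\<^esub> \<langle>?h, ?k\<rangle>\<^bsub>?SY\<^esub>"
  have "?m \<in> hom ?SY (t \<cdot> w) s" using hk s by (simp add: in_hom)
  then have m: "?m \<in> Ar ?SY" "sdom ?m = t \<cdot> w" "scod ?m = s" unfolding in_hom slice_simps(2,3) by blast+
  show ?thesis
    using F.functor_mul[OF S' hk v_ar] red(1)[OF m] by (simp add: pt)
qed

end

section \<open>The stabiliser along a section\<close>

context lex
begin

text \<open>The points of \<open>P\<close> that fix a given point of \<open>T\<close> are closed under the group operations, so the equaliser carries
  a unique group structure and the definite description in the definition of the stabiliser is
  meaningful.\<close>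

lemma stabiliser_group:
  assumes act: "is_action C P T a"
  defines "\<iota> \<equiv> stab_incl C P T a" and "p \<equiv> pr2 C (gob P) T"
  shows "is_equaliser C a p \<iota>"
    and "is_group (slice C T) (stabiliser C P T a)"
    and "gob (stabiliser C P T a) = p \<cdot> \<iota>"
    and "is_group_hom (slice C T) (GrpAr (stabiliser C P T a)
      (grp_functor_ob C (slice C T) (times_over C T) P) (SliceAr (p \<cdot> \<iota>) p \<iota>))"
proof -
  note [simp] = action_el(1-5)[OF act]
  let ?E = "slice C T" and ?H = "grp_functor_ob C (slice C T) (times_over C T) P"
  interpret F: product_functor C ?E "times_over C T" by (rule times_over_functor) simp
  have H [simp]: "is_group ?E ?H" by (rule F.functor_group) simp
  have p [simp]: "p \<in> Ar C" "Dom C p = gob P \<otimes> T" "Cod C p = T" by (simp_all add: p_def)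
  show eq: "is_equaliser C a p \<iota>"
    unfolding \<iota>_def p_def stab_incl_def by (rule someI_ex, rule ex_equaliser) simp_all
  note [simp] = equaliser_arrows(1)[OF eq]
  have [simp]: "Cod C \<iota> = gob P \<otimes> T" using equaliser_arrows(2)[OF eq] by simp
  have fix_el: "a \<cdot> (\<iota> \<cdot> h) = p \<cdot> (\<iota> \<cdot> h)" if "h \<in> Ar C" "Cod C h = Dom C \<iota>" for h
    using arg_cong[OF equaliser_arrows(3)[OF eq], of "\<lambda>z. z \<cdot> h"] that by simp
  let ?i = "SliceAr (p \<cdot> \<iota>) p \<iota>"
  have i: "?i \<in> Ar ?E" "Dom ?E ?i = p \<cdot> \<iota>" "Cod ?E ?i = p" by (simp_all add: slice_ar slice_simps)
  have gobH: "gob ?H = p" by (simp add: times_over_simps p_def)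
  have mono: "monic ?E ?i"
  proof (rule F.D.monicI)
    fix g h assume gh: "g \<in> Ar ?E" "h \<in> Ar ?E" "Cod ?E g = Dom ?E ?i" "Cod ?E h = Dom ?E ?i" "Dom ?E g = Dom ?E h"
      "?i \<cdot>\<^bsub>?E\<^esub> g = ?i \<cdot>\<^bsub>?E\<^esub> h"
    then have "smap g = smap h"
      by - (rule monicD[OF equaliser_monic[OF eq]], auto simp: slice_ar slice_simps)
    then show "g = h" using gh by - (rule slice_ar_eqI, simp_all add: slice_simps)
  qed (rule i(1))
  \<comment> \<open>A point of \<open>P \<times> T\<close> over \<open>w\<close> factors through the stabiliser if and only if it fixes \<open>w\<close>.\<close>
  have factor: "\<exists>z \<in> hom ?E w (Dom ?E ?i). ?i \<cdot>\<^bsub>?E\<^esub> z = SliceAr w p \<langle>x, w\<rangle>"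
    if w [simp]: "w \<in> Ar C" "Cod C w = T" and x [simp]: "x \<in> Ar C" "Dom C x = Dom C w" "Cod C x = gob P"
      and fixed: "a \<cdot> \<langle>x, w\<rangle> = w" for w x
  proof -
    obtain h where [simp]: "h \<in> Ar C" "Dom C h = Dom C w" "Cod C h = Dom C \<iota>" and h: "\<iota> \<cdot> h = \<langle>x, w\<rangle>"
      using equaliser_factor[OF eq, of "\<langle>x, w\<rangle>"] fixed by (auto simp: p_def)
    show ?thesis
      by (rule bexI[of _ "SliceAr w (p \<cdot> \<iota>) h"]) (simp_all add: slice_ar slice_simps in_hom h p_def)
  qed
  have point: "w \<in> Ar C \<and> Cod C w = T \<and> x1 \<in> Ar C \<and> Dom C x1 = Dom C w \<and> Cod C x1 = gob P \<and>
      ?i \<cdot>\<^bsub>?E\<^esub> x = SliceAr w p \<langle>x1, w\<rangle> \<and> a \<cdot> \<langle>x1, w\<rangle> = w"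
    if x: "x \<in> hom ?E w (Dom ?E ?i)" and x1: "x1 = pr1 C (gob P) T \<cdot> (\<iota> \<cdot> smap x)" for w x x1
  proof -
    have [simp]: "w \<in> Ar C" "Cod C w = T" "smap x \<in> Ar C" "Dom C (smap x) = Dom C w" "Cod C (smap x) = Dom C \<iota>"
      "sdom x = w" "p \<cdot> (\<iota> \<cdot> smap x) = w"
      using x by (auto simp: in_hom slice_ar slice_simps)
    have "pr2 C (gob P) T \<cdot> (\<iota> \<cdot> smap x) = w" by (simp add: p_def[symmetric])
    then have "\<langle>x1, w\<rangle> = \<iota> \<cdot> smap x"
      by - (rule product_ext[of _ _ "gob P" T], simp_all add: x1)
    then show ?thesis by (simp add: slice_simps fix_el) (simp add: x1)
  qed
  have ex1: "\<exists>!S. is_group ?E S \<and> gob S = Dom ?E ?i \<and> is_group_hom ?E (GrpAr S ?H ?i)"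
  proof (rule F.D.subgroup_ex1[OF H mono])
    show "Cod ?E ?i = gob ?H" using i gobH by simp
  next
    fix w x y assume xy: "x \<in> hom ?E w (Dom ?E ?i)" "y \<in> hom ?E w (Dom ?E ?i)"
    define x1 y1 where "x1 = pr1 C (gob P) T \<cdot> (\<iota> \<cdot> smap x)" and "y1 = pr1 C (gob P) T \<cdot> (\<iota> \<cdot> smap y)"
    note X = point[OF xy(1) x1_def] and Y = point[OF xy(2) y1_def]
    have prod: "gmul ?H \<cdot>\<^bsub>?E\<^esub> \<langle>?i \<cdot>\<^bsub>?E\<^esub> x, ?i \<cdot>\<^bsub>?E\<^esub> y\<rangle>\<^bsub>?E\<^esub> = SliceAr w p \<langle>gmul P \<cdot> \<langle>x1, y1\<rangle>, w\<rangle>"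
    proof -
      have ij: "?i \<cdot>\<^bsub>?E\<^esub> x = SliceAr w p \<langle>x1, w\<rangle>" "?i \<cdot>\<^bsub>?E\<^esub> y = SliceAr w p \<langle>y1, w\<rangle>"
        using X Y by blast+
      show ?thesis
        unfolding ij unfolding p_def by (rule times_over_mul) (use X Y in \<open>(blast | simp)+\<close>)
    qed
    show "\<exists>z \<in> hom ?E w (Dom ?E ?i). ?i \<cdot>\<^bsub>?E\<^esub> z = gmul ?H \<cdot>\<^bsub>?E\<^esub> \<langle>?i \<cdot>\<^bsub>?E\<^esub> x, ?i \<cdot>\<^bsub>?E\<^esub> y\<rangle>\<^bsub>?E\<^esub>"
      unfolding prod by (rule factor) (use X Y in \<open>simp_all add: action_el(6)[OF act]\<close>)
  next
    fix w x assume x: "x \<in> hom ?E w (Dom ?E ?i)"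
    define x1 where "x1 = pr1 C (gob P) T \<cdot> (\<iota> \<cdot> smap x)"
    note X = point[OF x x1_def]
    have inv: "ginv ?H \<cdot>\<^bsub>?E\<^esub> (?i \<cdot>\<^bsub>?E\<^esub> x) = SliceAr w p \<langle>ginv P \<cdot> x1, w\<rangle>"
      using X by (simp add: F.ginv_functor times_over_simps) (simp add: slice_simps p_def)
    have "a \<cdot> \<langle>ginv P \<cdot> x1, w\<rangle> = a \<cdot> \<langle>ginv P \<cdot> x1, a \<cdot> \<langle>x1, w\<rangle>\<rangle>" using X by simp
    also have "\<dots> = a \<cdot> \<langle>gmul P \<cdot> \<langle>ginv P \<cdot> x1, x1\<rangle>, w\<rangle>"
      by (rule action_el(6)[OF act, symmetric]) (use X in simp_all)
    also have "\<dots> = w" using X by (simp add: mul_unit_inv action_el(7)[OF act])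
    finally show "\<exists>z \<in> hom ?E w (Dom ?E ?i). ?i \<cdot>\<^bsub>?E\<^esub> z = ginv ?H \<cdot>\<^bsub>?E\<^esub> (?i \<cdot>\<^bsub>?E\<^esub> x)"
      unfolding inv by - (rule factor, use X in simp_all)
  next
    define w where "w = \<one>\<^bsub>?E\<^esub>"
    have "w \<in> Ob ?E" by (simp add: w_def)
    then have w [simp]: "w \<in> Ar C" "Cod C w = T" by (simp_all add: slice_simps)
    have "bang ?E w = Idn ?E w"
      unfolding w_def by (rule F.D.bang_unique[symmetric]) simp_all
    then have "gone ?H \<cdot>\<^bsub>?E\<^esub> bang ?E w = gone ?H" by (simp add: w_def)
    then have one: "gone ?H = SliceAr w p \<langle>gone P \<cdot> bang C (Dom C w), w\<rangle>"
      using times_over_unit[of P w T] by (simp add: p_def)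
    show "\<exists>z \<in> hom ?E \<one>\<^bsub>?E\<^esub> (Dom ?E ?i). ?i \<cdot>\<^bsub>?E\<^esub> z = gone ?H"
      unfolding one w_def[symmetric] by (rule factor) (simp_all add: action_el(7)[OF act])
  qed
  have "stabiliser C P T a = (THE S. is_group ?E S \<and> gob S = Dom ?E ?i \<and> is_group_hom ?E (GrpAr S ?H ?i))"
    unfolding stabiliser_def Let_def \<iota>_def p_def grp_functor_def by (simp add: slice_simps)
  then have "is_group ?E (stabiliser C P T a) \<and> gob (stabiliser C P T a) = Dom ?E ?i \<and>
      is_group_hom ?E (GrpAr (stabiliser C P T a) ?H ?i)"
    using theI'[OF ex1] by simp
  then show "is_group ?E (stabiliser C P T a)" "gob (stabiliser C P T a) = p \<cdot> \<iota>"
    "is_group_hom ?E (GrpAr (stabiliser C P T a) ?H ?i)" using i by simp_all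
qed

text \<open>A point of \<open>t\<^sup>*S\<close> over \<open>w\<close> is a point \<open>x\<close> of \<open>P\<close> that fixes \<open>t \<circ> w\<close>, and the multiplications of
  \<open>t\<^sup>*S\<close>, of \<open>S\<close> and of \<open>P \<times> Q\<close> all are the multiplication of \<open>P\<close> on the components \<open>x\<close>. So \<open>t\<^sup>*S\<close> is
  the subgroup of \<open>P \<times> Q\<close> that consists of these points.\<close>

lemma pulled_back_stabiliser_group:
  assumes act: "is_action C P T a" and t: "t \<in> Ar C" "Dom C t = Q" "Cod C t = T"
  defines "\<iota> \<equiv> stab_incl C P T a" and "S \<equiv> stabiliser C P T a"
  defines "s \<equiv> gob S"
  defines "S' \<equiv> grp_functor_ob (slice C T) (slice C Q) (pullback_functor C t) S"
    and "j \<equiv> SliceAr (pb2 C s t) (pr2 C (gob P) Q) \<langle>pr1 C (gob P) T \<cdot> \<iota> \<cdot> pb1 C s t, pb2 C s t\<rangle>"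
  shows "is_group_hom (slice C Q) (GrpAr S' (grp_functor_ob C (slice C Q) (times_over C Q) P) j)"
    and "monic (slice C Q) j"
    and "a \<cdot> \<langle>pr1 C (gob P) Q \<cdot> smap j, t \<cdot> pb2 C s t\<rangle> = t \<cdot> pb2 C s t"
    and "\<And>w x. w \<in> Ar C \<Longrightarrow> Cod C w = Q \<Longrightarrow> x \<in> Ar C \<Longrightarrow> Dom C x = Dom C w \<Longrightarrow> Cod C x = gob P \<Longrightarrow>
      a \<cdot> \<langle>x, t \<cdot> w\<rangle> = t \<cdot> w \<Longrightarrow>
      \<exists>h \<in> hom (slice C Q) w (gob S'). j \<cdot>\<^bsub>slice C Q\<^esub> h = SliceAr w (pr2 C (gob P) Q) \<langle>x, w\<rangle>"
proof -
  note [simp] = action_el(1-5)[OF act] t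
  have [simp]: "Q \<in> Ob C" using ob_simps(1)[OF t(1)] by simp
  let ?E = "slice C Q" and ?D = "slice C T" and ?H = "grp_functor_ob C (slice C Q) (times_over C Q) P"
    and ?HT = "grp_functor_ob C (slice C T) (times_over C T) P"
  define p where "p = pr2 C (gob P) T"
  define q where "q = pr2 C (gob P) Q"
  note stab = stabiliser_group[OF act, folded S_def \<iota>_def p_def]
  interpret F: product_functor C ?E "times_over C Q" by (rule times_over_functor) simp
  interpret B: product_functor ?D ?E "pullback_functor C t"
    using pullback_functor_functor[OF t(1)] by simp
  have p [simp]: "p \<in> Ar C" "Dom C p = gob P \<otimes> T" "Cod C p = T" by (simp_all add: p_def)
  have q [simp]: "q \<in> Ar C" "Dom C q = gob P \<otimes> Q" "Cod C q = Q" by (simp_all add: q_def)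
  have [simp]: "\<iota> \<in> Ar C" "Cod C \<iota> = gob P \<otimes> T"
    using equaliser_arrows(1,2)[OF stab(1)] by simp_all
  have s: "s = p \<cdot> \<iota>" by (simp add: s_def stab(3))
  have [simp]: "s \<in> Ar C" "Dom C s = Dom C \<iota>" "Cod C s = T" by (simp_all add: s)
  define U f g where "U = pb_ob C s t" and "f = pb1 C s t" and "g = pb2 C s t"
  have pb: "is_pullback C s t U f g" unfolding U_def f_def g_def by (rule pullback_chosen) simp_all
  have [simp]: "U \<in> Ob C" "f \<in> Ar C" "Dom C f = U" "Cod C f = Dom C \<iota>" "g \<in> Ar C" "Dom C g = U" "Cod C g = Q"
    using pullback_arrows(4-10)[OF pb] by simp_all
  have sq: "p \<cdot> (\<iota> \<cdot> (f \<cdot> h)) = t \<cdot> (g \<cdot> h)" if "h \<in> Ar C" "Cod C h = U" for h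
    using comp_reduce[OF pullback_arrows(11)[OF pb], of h] that by (simp add: s)
  have sq0: "p \<cdot> (\<iota> \<cdot> f) = t \<cdot> g" using pullback_arrows(11)[OF pb] by (simp add: s)
  have fix_el: "a \<cdot> (\<iota> \<cdot> h) = p \<cdot> (\<iota> \<cdot> h)" if "h \<in> Ar C" "Cod C h = Dom C \<iota>" for h
    using arg_cong[OF equaliser_arrows(3)[OF stab(1)], of "\<lambda>z. z \<cdot> h"] that by simp
  define x0 where "x0 = pr1 C (gob P) T \<cdot> (\<iota> \<cdot> f)"
  have [simp]: "x0 \<in> Ar C" "Dom C x0 = U" "Cod C x0 = gob P" by (simp_all add: x0_def)
  have j: "j = SliceAr g q \<langle>x0, g\<rangle>"
    unfolding j_def f_def[symmetric] g_def[symmetric] q_def[symmetric] x0_def by simp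
  have \<iota>f: "\<iota> \<cdot> (f \<cdot> h) = \<langle>x0 \<cdot> h, t \<cdot> (g \<cdot> h)\<rangle>" if "h \<in> Ar C" "Cod C h = U" for h
    using that by - (rule product_ext[of _ _ "gob P" T], simp_all add: x0_def sq[unfolded p_def])
  have gobS: "gob S' = g" unfolding S'_def B.gob_functor FOb_pullback_functor g_def s_def ..
  have gobH: "gob ?H = q" by (simp add: times_over_simps q_def)
  have S' [simp]: "is_group ?E S'" unfolding S'_def by (rule B.functor_group) (rule stab(2))
  have H [simp]: "is_group ?E ?H" by (rule F.functor_group) simp
  have j_ar: "j \<in> hom ?E g q" unfolding j by (simp add: slice_ar slice_simps in_hom q_def)
  show mono: "monic ?E j"
  proof (rule F.D.monicI)
    fix h k assume hk: "h \<in> Ar ?E" "k \<in> Ar ?E" "Cod ?E h = Dom ?E j" "Cod ?E k = Dom ?E j"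
      and dom: "Dom ?E h = Dom ?E k" and eq: "j \<cdot>\<^bsub>?E\<^esub> h = j \<cdot>\<^bsub>?E\<^esub> k"
    have [simp]: "smap h \<in> Ar C" "Cod C (smap h) = U" "smap k \<in> Ar C" "Cod C (smap k) = U"
      "scod h = g" "scod k = g" using hk by (auto simp: slice_ar slice_simps j)
    have d: "Dom C (smap h) = Dom C (smap k)" using hk dom by (auto simp: slice_ar slice_simps)
    have e: "\<langle>x0 \<cdot> smap h, g \<cdot> smap h\<rangle> = \<langle>x0 \<cdot> smap k, g \<cdot> smap k\<rangle>"
      using eq by (simp add: j slice_simps)
    have e1: "x0 \<cdot> smap h = x0 \<cdot> smap k" by (rule pairing_inject(1)[OF e]) (simp_all add: d)
    have e2: "g \<cdot> smap h = g \<cdot> smap k" by (rule pairing_inject(2)[OF e]) (simp_all add: d)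
    have "\<iota> \<cdot> (f \<cdot> smap h) = \<iota> \<cdot> (f \<cdot> smap k)" by (simp add: \<iota>f e1 e2)
    then have "f \<cdot> smap h = f \<cdot> smap k"
      by (rule monicD[OF equaliser_monic[OF stab(1)]]) (simp_all add: d)
    then have "smap h = smap k" by (rule pullback_eq[OF pb, rotated 5]) (simp_all add: d e2)
    then show "h = k" using dom by - (rule slice_ar_eqI, simp_all add: slice_simps)
  qed (use j_ar in \<open>simp add: in_hom\<close>)
  show "a \<cdot> \<langle>pr1 C (gob P) Q \<cdot> smap j, t \<cdot> pb2 C s t\<rangle> = t \<cdot> pb2 C s t"
    unfolding g_def[symmetric]
  proof -
    have "\<iota> \<cdot> f = \<langle>x0, t \<cdot> g\<rangle>" using \<iota>f[of "Idn C U"] by simp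
    moreover have "a \<cdot> (\<iota> \<cdot> f) = t \<cdot> g" using fix_el[of f] sq0 by simp
    ultimately show "a \<cdot> \<langle>pr1 C (gob P) Q \<cdot> smap j, t \<cdot> g\<rangle> = t \<cdot> g" by (simp add: j)
  qed
  show "\<exists>h \<in> hom ?E w (gob S'). j \<cdot>\<^bsub>?E\<^esub> h = SliceAr w (pr2 C (gob P) Q) \<langle>x, w\<rangle>"
    if [simp]: "w \<in> Ar C" "Cod C w = Q" "x \<in> Ar C" "Dom C x = Dom C w" "Cod C x = gob P"
      and fixed: "a \<cdot> \<langle>x, t \<cdot> w\<rangle> = t \<cdot> w" for w x
  proof -
    obtain k where [simp]: "k \<in> Ar C" "Dom C k = Dom C w" "Cod C k = Dom C \<iota>" and k: "\<iota> \<cdot> k = \<langle>x, t \<cdot> w\<rangle>"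
      using equaliser_factor[OF stab(1), of "\<langle>x, t \<cdot> w\<rangle>"] fixed by (auto simp: p_def)
    have "s \<cdot> k = t \<cdot> w" by (simp add: s k) (simp add: p_def)
    then obtain h where [simp]: "h \<in> Ar C" "Dom C h = Dom C w" "Cod C h = U" and h: "f \<cdot> h = k" "g \<cdot> h = w"
      by - (rule pullback_factor[OF pb, of k w "Dom C w"], simp_all)
    have "x0 \<cdot> h = x" by (simp add: x0_def h k)
    then show ?thesis
      by (intro bexI[of _ "SliceAr w g h"]) (simp_all add: in_hom slice_ar slice_simps gobS j h q_def)
  qed
  show "is_group_hom ?E (GrpAr S' ?H j)"
  proof (rule F.D.is_group_homI)
    fix w x y assume xy: "x \<in> hom ?E w (gob S')" "y \<in> hom ?E w (gob S')"
    define h k where "h = smap x" and "k = smap y"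
    have hk: "x = SliceAr w g h" "y = SliceAr w g k"
      using xy by (auto simp: in_hom gobS slice_simps h_def k_def intro!: slice_ar_eqI)
    have [simp]: "w \<in> Ar C" "Cod C w = Q" "h \<in> Ar C" "Dom C h = Dom C w" "Cod C h = U"
      "k \<in> Ar C" "Dom C k = Dom C w" "Cod C k = U" "g \<cdot> h = w" "g \<cdot> k = w"
      using xy by (auto simp: in_hom gobS slice_simps slice_ar h_def k_def)
    let ?z = "gmul S' \<cdot>\<^bsub>?E\<^esub> \<langle>x, y\<rangle>\<^bsub>?E\<^esub>"
    have z: "?z \<in> hom ?E w g" using xy gobS by (simp add: in_hom)
    then have [simp]: "smap ?z \<in> Ar C" "Dom C (smap ?z) = Dom C w" "Cod C (smap ?z) = U" "g \<cdot> smap ?z = w"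
      "sdom ?z = w" "scod ?z = g" unfolding in_hom slice_ar slice_simps(2,3) by auto
    let ?h = "SliceAr (t \<cdot> w) s (f \<cdot> h)" and ?k = "SliceAr (t \<cdot> w) s (f \<cdot> k)"
    have f: "?h \<in> Ar ?D" "?k \<in> Ar ?D" "Dom ?D ?h = Dom ?D ?k" "Cod ?D ?h = gob S" "Cod ?D ?k = gob S"
      using sq by (simp_all add: slice_ar slice_simps s_def[symmetric]) (simp_all add: s)
    have "f \<cdot> smap ?z = smap (gmul S \<cdot>\<^bsub>?D\<^esub> \<langle>?h, ?k\<rangle>\<^bsub>?D\<^esub>)"
      using pullback_mul[of t S s h w k] stab(2)
      unfolding S'_def hk f_def[symmetric] g_def[symmetric] U_def[symmetric] s_def[symmetric] by simp
    then have "\<iota> \<cdot> (f \<cdot> smap ?z) = smap (SliceAr (p \<cdot> \<iota>) p \<iota> \<cdot>\<^bsub>?D\<^esub> (gmul S \<cdot>\<^bsub>?D\<^esub> \<langle>?h, ?k\<rangle>\<^bsub>?D\<^esub>))"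
      by (simp add: slice_simps)
    also have "\<dots> = smap (gmul ?HT \<cdot>\<^bsub>?D\<^esub>
        \<langle>SliceAr (p \<cdot> \<iota>) p \<iota> \<cdot>\<^bsub>?D\<^esub> ?h, SliceAr (p \<cdot> \<iota>) p \<iota> \<cdot>\<^bsub>?D\<^esub> ?k\<rangle>\<^bsub>?D\<^esub>)"
      unfolding B.C.group_hom_mul[OF stab(4) f] ..
    also have "SliceAr (p \<cdot> \<iota>) p \<iota> \<cdot>\<^bsub>?D\<^esub> ?h = SliceAr (t \<cdot> w) (pr2 C (gob P) T) \<langle>x0 \<cdot> h, t \<cdot> w\<rangle>"
      by (simp add: slice_simps \<iota>f) (simp add: p_def)
    also have "SliceAr (p \<cdot> \<iota>) p \<iota> \<cdot>\<^bsub>?D\<^esub> ?k = SliceAr (t \<cdot> w) (pr2 C (gob P) T) \<langle>x0 \<cdot> k, t \<cdot> w\<rangle>"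
      by (simp add: slice_simps \<iota>f) (simp add: p_def)
    also have "gmul ?HT \<cdot>\<^bsub>?D\<^esub> \<langle>SliceAr (t \<cdot> w) (pr2 C (gob P) T) \<langle>x0 \<cdot> h, t \<cdot> w\<rangle>,
        SliceAr (t \<cdot> w) (pr2 C (gob P) T) \<langle>x0 \<cdot> k, t \<cdot> w\<rangle>\<rangle>\<^bsub>?D\<^esub>
      = SliceAr (t \<cdot> w) (pr2 C (gob P) T) \<langle>gmul P \<cdot> \<langle>x0 \<cdot> h, x0 \<cdot> k\<rangle>, t \<cdot> w\<rangle>"
      by (rule times_over_mul) simp_all
    finally have "\<iota> \<cdot> (f \<cdot> smap ?z) = \<langle>gmul P \<cdot> \<langle>x0 \<cdot> h, x0 \<cdot> k\<rangle>, t \<cdot> w\<rangle>" by simp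
    then have x0z: "x0 \<cdot> smap ?z = gmul P \<cdot> \<langle>x0 \<cdot> h, x0 \<cdot> k\<rangle>" by (simp add: x0_def)
    have jx: "j \<cdot>\<^bsub>?E\<^esub> x = SliceAr w q \<langle>x0 \<cdot> h, w\<rangle>" "j \<cdot>\<^bsub>?E\<^esub> y = SliceAr w q \<langle>x0 \<cdot> k, w\<rangle>"
      by (simp_all add: j hk slice_simps)
    have "j \<cdot>\<^bsub>?E\<^esub> ?z = SliceAr w q \<langle>x0 \<cdot> smap ?z, w\<rangle>"
      unfolding j slice_simps(5)[of _ _ "SliceAr g q _"] by simp
    also have "\<dots> = gmul ?H \<cdot>\<^bsub>?E\<^esub> \<langle>j \<cdot>\<^bsub>?E\<^esub> x, j \<cdot>\<^bsub>?E\<^esub> y\<rangle>\<^bsub>?E\<^esub>"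
      unfolding jx x0z unfolding q_def by (rule times_over_mul[symmetric]) simp_all
    finally show "j \<cdot>\<^bsub>?E\<^esub> ?z = gmul ?H \<cdot>\<^bsub>?E\<^esub> \<langle>j \<cdot>\<^bsub>?E\<^esub> x, j \<cdot>\<^bsub>?E\<^esub> y\<rangle>\<^bsub>?E\<^esub>" .
  qed (use j_ar gobS gobH in simp_all)
qed

end

text \<open>The two factorisations are mutually inverse because \<open>u\<close> and \<open>j\<close> are monic, and they are
  homomorphisms by \<open>group_hom_factor\<close>.\<close>

lemma (in cartesian) equal_subgroups_iso:
  assumes u: "is_group_hom C (GrpAr G H u)" "monic C u"
    and j: "is_group_hom C (GrpAr S H j)" "monic C j"
    and f: "f \<in> hom C (gob G) (gob S)" "j \<cdot> f = u"
    and g: "g \<in> hom C (gob S) (gob G)" "u \<cdot> g = j"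
  shows "\<exists>\<phi>. iso_in (grp_cat C) G S \<phi> \<and> (\<forall>\<psi> \<in> hom C (gob G) (gob S). j \<cdot> \<psi> = u \<longleftrightarrow> \<psi> = gmap \<phi>)"
proof (intro exI conjI ballI)
  note [simp] = group_hom_arrows[OF u(1)] group_hom_arrows[OF j(1)]
  have [simp]: "f \<in> Ar C" "Dom C f = gob G" "Cod C f = gob S" "g \<in> Ar C" "Dom C g = gob S" "Cod C g = gob G"
    using f g by (simp_all add: in_hom)
  have "is_group_hom C (GrpAr G S f)" by (rule group_hom_factor[OF u(1) j f])
  moreover have "is_group_hom C (GrpAr S G g)" by (rule group_hom_factor[OF j(1) u g])
  moreover have "g \<cdot> f = Idn C (gob G)"
    by (rule monicD[OF u(2)]) (simp_all add: comp_reduce[OF g(2)] f(2))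
  moreover have "f \<cdot> g = Idn C (gob S)"
    by (rule monicD[OF j(2)]) (simp_all add: comp_reduce[OF f(2)] g(2))
  ultimately show "iso_in (grp_cat C) G S (GrpAr G S f)"
    unfolding iso_in_def by (intro conjI bexI[of _ "GrpAr S G g"]) (simp_all add: in_hom grp_cat_def)
  fix \<psi> assume "\<psi> \<in> hom C (gob G) (gob S)"
  then have [simp]: "\<psi> \<in> Ar C" "Dom C \<psi> = gob G" "Cod C \<psi> = gob S" by (simp_all add: in_hom)
  have "\<psi> = f" if "j \<cdot> \<psi> = u" by (rule monicD[OF j(2)]) (simp_all add: that f(2))
  then show "j \<cdot> \<psi> = u \<longleftrightarrow> \<psi> = gmap (GrpAr G S f)" using f(2) by auto
qed

context lex
begin

text \<open>The unit \<open>u\<close> factors through \<open>j\<close> because \<open>\<tau>(\<gamma>(g), q) = \<tau>(1, q)\<close> says that \<open>\<gamma>(g)\<close> fixes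
  \<open>t(q)\<close>. Conversely, if \<open>x\<close> fixes \<open>t(q)\<close>, then \<open>(1, q)\<close> and \<open>(x, q)\<close> have the same image under
  \<open>\<tau>\<close>, and the kernel pair provides a \<open>g\<close> over \<open>q\<close> with \<open>1 \<gamma>(g) = x\<close>.\<close>

theorem stabiliser_along_section:
  assumes act: "is_action C P T a" and Q: "Q \<in> Ob C"
    and u: "is_group_hom (slice C Q) (GrpAr G (grp_functor_ob C (slice C Q) (times_over C Q) P) u)"
      "monic (slice C Q) u"
    and \<tau>: "\<tau> \<in> hom C (gob P \<otimes> Q) T"
    and L: "L = (gmul P \<otimes>\<^sub>a Idn C Q) \<cdot> assoc C (gob P) (gob P) Q"
    and equivariant: "a \<cdot> (Idn C (gob P) \<otimes>\<^sub>a \<tau>) = \<tau> \<cdot> L"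
    and kernel_pair: "is_pullback C \<tau> \<tau> (gob P \<otimes> Dom C (gob G))
      (Idn C (gob P) \<otimes>\<^sub>a gob G) (L \<cdot> (Idn C (gob P) \<otimes>\<^sub>a smap u))"
    and t: "t = \<tau> \<cdot> \<langle>gone P \<cdot> bang C Q, Idn C Q\<rangle>"
    and s: "s = gob (stabiliser C P T a)"
    and j: "j = SliceAr (pb2 C s t) (pr2 C (gob P) Q)
      \<langle>pr1 C (gob P) T \<cdot> stab_incl C P T a \<cdot> pb1 C s t, pb2 C s t\<rangle>"
    and S: "S = grp_functor_ob (slice C T) (slice C Q) (pullback_functor C t) (stabiliser C P T a)"
  shows "\<exists>\<phi>. iso_in (grp_cat (slice C Q)) G S \<phi> \<and>
    (\<forall>\<psi> \<in> hom (slice C Q) (gob G) (gob S). j \<cdot>\<^bsub>slice C Q\<^esub> \<psi> = u \<longleftrightarrow> \<psi> = gmap \<phi>)"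
proof -
  let ?E = "slice C Q" and ?H = "grp_functor_ob C (slice C Q) (times_over C Q) P"
  define p q where "p = gob G" and "q = pr2 C (gob P) Q"
  note [simp] = action_el(1-5)[OF act] Q
  have [simp]: "\<tau> \<in> Ar C" "Dom C \<tau> = gob P \<otimes> Q" "Cod C \<tau> = T" using \<tau> by (simp_all add: in_hom)
  interpret F: product_functor C ?E "times_over C Q" by (rule times_over_functor) simp
  have t_ar [simp]: "t \<in> Ar C" "Dom C t = Q" "Cod C t = T" by (simp_all add: t)
  have t_el: "t \<cdot> w = \<tau> \<cdot> \<langle>gone P \<cdot> bang C (Dom C w), w\<rangle>" if "w \<in> Ar C" "Cod C w = Q" for w
    using that by (simp add: t)
  have L_el: "L \<cdot> \<langle>x, \<langle>y, w\<rangle>\<rangle> = \<langle>gmul P \<cdot> \<langle>x, y\<rangle>, w\<rangle>" if "x \<in> Ar C" "y \<in> Ar C" "w \<in> Ar C" "Dom C x = Dom C w"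
    "Dom C y = Dom C w" "Cod C x = gob P" "Cod C y = gob P" "Cod C w = Q" for x y w
    using that by (simp add: L)
  have [simp]: "L \<in> Ar C" "Dom C L = gob P \<otimes> (gob P \<otimes> Q)" "Cod C L = gob P \<otimes> Q" by (simp_all add: L)
  \<comment> \<open>On points: \<open>x \<cdot> t(w) = \<tau>(x, w)\<close>.\<close>
  have a_t: "a \<cdot> \<langle>x, t \<cdot> w\<rangle> = \<tau> \<cdot> \<langle>x, w\<rangle>" if xw [simp]: "x \<in> Ar C" "w \<in> Ar C" "Dom C x = Dom C w" "Cod C x = gob P" "Cod C w = Q" for x w
  proof -
    have "a \<cdot> \<langle>x, t \<cdot> w\<rangle> = (a \<cdot> (Idn C (gob P) \<otimes>\<^sub>a \<tau>)) \<cdot> \<langle>x, \<langle>gone P \<cdot> bang C (Dom C w), w\<rangle>\<rangle>"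
      by (simp add: t_el)
    also have "\<dots> = \<tau> \<cdot> \<langle>x, w\<rangle>" unfolding equivariant by (simp add: L_el mul_unit_inv)
    finally show ?thesis .
  qed
  have u_ar: "u \<in> Ar ?E" "Dom ?E u = p" "Cod ?E u = q"
    using F.D.group_hom_arrows[OF u(1)] by (simp_all add: p_def q_def times_over_simps)
  have [simp]: "p \<in> Ar C" "Cod C p = Q" "smap u \<in> Ar C" "Dom C (smap u) = Dom C p" "Cod C (smap u) = gob P \<otimes> Q"
    "sdom u = p" "scod u = q" and qu: "q \<cdot> smap u = p"
    using u_ar by (auto simp: slice_ar slice_simps q_def)
  define \<gamma> where "\<gamma> = pr1 C (gob P) Q \<cdot> smap u"
  have [simp]: "\<gamma> \<in> Ar C" "Dom C \<gamma> = Dom C p" "Cod C \<gamma> = gob P" by (simp_all add: \<gamma>_def)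
  have u_pair: "smap u = \<langle>\<gamma>, p\<rangle>"
    by (rule product_ext[of _ _ "gob P" Q]) (simp_all add: \<gamma>_def qu[unfolded q_def])
  have u_eq: "u = SliceAr p q \<langle>\<gamma>, p\<rangle>" using u_pair by - (rule slice_ar_eqI, simp_all)
  let ?r = "Idn C (gob P) \<otimes>\<^sub>a p" and ?r' = "L \<cdot> (Idn C (gob P) \<otimes>\<^sub>a smap u)"
  have r_el: "?r \<cdot> \<langle>x, g\<rangle> = \<langle>x, p \<cdot> g\<rangle>" "?r' \<cdot> \<langle>x, g\<rangle> = \<langle>gmul P \<cdot> \<langle>x, \<gamma> \<cdot> g\<rangle>, p \<cdot> g\<rangle>"
    if "x \<in> Ar C" "g \<in> Ar C" "Dom C x = Dom C g" "Cod C x = gob P" "Cod C g = Dom C p" for x g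
    using that by (simp_all add: u_pair L_el)
  note kp = kernel_pair[folded p_def]
  have "\<tau> \<cdot> \<langle>\<gamma>, p\<rangle> = t \<cdot> p"
  proof -
    let ?e = "\<langle>gone P \<cdot> bang C (Dom C p), Idn C (Dom C p)\<rangle>"
    have "\<tau> \<cdot> (?r \<cdot> ?e) = \<tau> \<cdot> (?r' \<cdot> ?e)"
      using arg_cong[OF pullback_arrows(11)[OF kp], of "\<lambda>z. z \<cdot> ?e"] by simp
    moreover have "?r \<cdot> ?e = \<langle>gone P \<cdot> bang C (Dom C p), p\<rangle>" by (subst r_el(1)) simp_all
    moreover have "?r' \<cdot> ?e = \<langle>\<gamma>, p\<rangle>" by (subst r_el(2)) (simp_all add: mul_unit_inv)
    ultimately show ?thesis by (simp add: t_el)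
  qed
  then have fixed: "a \<cdot> \<langle>\<gamma>, t \<cdot> p\<rangle> = t \<cdot> p" by (simp add: a_t)
  note stab = pulled_back_stabiliser_group[OF act t_ar, folded s, folded j S]
  obtain f where f: "f \<in> hom ?E p (gob S)" "j \<cdot>\<^bsub>?E\<^esub> f = u"
    using stab(4)[of p \<gamma>] fixed by (auto simp: u_eq q_def)
  define U w where "U = pb_ob C s t" and "w = pb2 C s t"
  have j_ar: "j \<in> Ar ?E" "Dom ?E j = gob S" "Cod ?E j = q"
    using F.D.group_hom_arrows[OF stab(1)] by (simp_all add: q_def times_over_simps)
  have [simp]: "sdom j = w" "scod j = q" by (simp_all add: j w_def q_def)
  have gobS: "gob S = w" using j_ar by (simp add: slice_simps)
  have [simp]: "w \<in> Ar C" "Cod C w = Q" "smap j \<in> Ar C" "Dom C (smap j) = Dom C w" "Cod C (smap j) = gob P \<otimes> Q"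
    and qj: "q \<cdot> smap j = w" using j_ar by (auto simp: slice_ar slice_simps q_def)
  define x where "x = pr1 C (gob P) Q \<cdot> smap j"
  have [simp]: "x \<in> Ar C" "Dom C x = Dom C w" "Cod C x = gob P" by (simp_all add: x_def)
  have j_pair: "smap j = \<langle>x, w\<rangle>"
    by (rule product_ext[of _ _ "gob P" Q]) (simp_all add: x_def qj[unfolded q_def])
  \<comment> \<open>The point \<open>(x, w)\<close> of the stabiliser gives \<open>\<tau>(1, w) = \<tau>(x, w)\<close>, hence a point of the kernel pair.\<close>
  have "\<tau> \<cdot> \<langle>gone P \<cdot> bang C (Dom C w), w\<rangle> = \<tau> \<cdot> \<langle>x, w\<rangle>"
    using stab(3)[folded w_def x_def] by (simp add: a_t) (simp add: t_el)
  then obtain v where [simp]: "v \<in> Ar C" "Dom C v = Dom C w" "Cod C v = gob P \<otimes> Dom C p"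
    and v: "?r \<cdot> v = \<langle>gone P \<cdot> bang C (Dom C w), w\<rangle>" "?r' \<cdot> v = \<langle>x, w\<rangle>"
    by - (rule pullback_factor[OF kp, of "\<langle>gone P \<cdot> bang C (Dom C w), w\<rangle>" "\<langle>x, w\<rangle>" "Dom C w"], simp_all)
  define y g where "y = pr1 C (gob P) (Dom C p) \<cdot> v" and "g = pr2 C (gob P) (Dom C p) \<cdot> v"
  have [simp]: "y \<in> Ar C" "Dom C y = Dom C w" "Cod C y = gob P" "g \<in> Ar C" "Dom C g = Dom C w" "Cod C g = Dom C p"
    by (simp_all add: y_def g_def)
  have v_pair: "v = \<langle>y, g\<rangle>" by (simp add: y_def g_def)
  have v1: "\<langle>y, p \<cdot> g\<rangle> = \<langle>gone P \<cdot> bang C (Dom C w), w\<rangle>" using v(1) unfolding v_pair by (subst (asm) r_el(1)) simp_all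
  have v2: "\<langle>gmul P \<cdot> \<langle>y, \<gamma> \<cdot> g\<rangle>, p \<cdot> g\<rangle> = \<langle>x, w\<rangle>" using v(2) unfolding v_pair by (subst (asm) r_el(2)) simp_all
  have y: "y = gone P \<cdot> bang C (Dom C w)" by (rule pairing_inject(1)[OF v1]) simp_all
  have pg: "p \<cdot> g = w" by (rule pairing_inject(2)[OF v1]) simp_all
  have "gmul P \<cdot> \<langle>y, \<gamma> \<cdot> g\<rangle> = x" by (rule pairing_inject(1)[OF v2]) simp_all
  then have \<gamma>g: "\<gamma> \<cdot> g = x" by (simp add: y mul_unit_inv)
  let ?g = "SliceAr w p g"
  have "?g \<in> hom ?E (gob S) p" by (simp add: in_hom slice_ar slice_simps gobS pg)
  moreover have "u \<cdot>\<^bsub>?E\<^esub> ?g = j"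
    by (rule slice_ar_eqI) (simp_all add: u_eq slice_simps \<gamma>g pg j_pair)
  ultimately show ?thesis
    using F.D.equal_subgroups_iso[OF u stab(1,2)] f unfolding p_def by blast
qed

end

section \<open>Functors that preserve finite limits\<close>

text \<open>A functor preserves a limit as soon as it preserves one choice of it, because functors preserve
  the isomorphism between two choices.\<close>

lemma functor_pullback_transfer:
  assumes C: "category C" and D: "category D" and F: "is_functor C D F"
    and pb: "is_pullback C f g P p q" and pb': "is_pullback C f g P' p' q'"
    and image: "is_pullback D (FAr F f) (FAr F g) (FOb F P) (FAr F p) (FAr F q)"
  shows "is_pullback D (FAr F f) (FAr F g) (FOb F P') (FAr F p') (FAr F q')"
proof -
  interpret C: category C by (rule C)
  interpret D: category D by (rule D)
  note [simp] = C.pullback_arrows(1,2,4-10)[OF pb] C.pullback_arrows(4-10)[OF pb']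
  obtain \<theta> where \<theta> [simp]: "\<theta> \<in> Ar C" "Dom C \<theta> = P'" "Cod C \<theta> = P" and p: "p \<cdot>\<^bsub>C\<^esub> \<theta> = p'" "q \<cdot>\<^bsub>C\<^esub> \<theta> = q'"
    by (rule C.pullback_factor[OF pb, of p' q' P']) (simp_all add: C.pullback_arrows(11)[OF pb'])
  obtain \<theta>' where \<theta>' [simp]: "\<theta>' \<in> Ar C" "Dom C \<theta>' = P" "Cod C \<theta>' = P'" and p': "p' \<cdot>\<^bsub>C\<^esub> \<theta>' = p" "q' \<cdot>\<^bsub>C\<^esub> \<theta>' = q"
    by (rule C.pullback_factor[OF pb', of p q P]) (simp_all add: C.pullback_arrows(11)[OF pb])
  have inv: "\<theta> \<cdot>\<^bsub>C\<^esub> \<theta>' = Idn C P"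
    by (rule C.pullback_eq[OF pb]) (simp_all add: C.comp_reduce[OF p(1)] C.comp_reduce[OF p(2)] p')
  have inv': "\<theta>' \<cdot>\<^bsub>C\<^esub> \<theta> = Idn C P'"
    by (rule C.pullback_eq[OF pb']) (simp_all add: C.comp_reduce[OF p'(1)] C.comp_reduce[OF p'(2)] p)
  have comp: "FAr F (g \<cdot>\<^bsub>C\<^esub> f) = FAr F g \<cdot>\<^bsub>D\<^esub> FAr F f" if "f \<in> Ar C" "g \<in> Ar C" "Dom C g = Cod C f" for f g
    using F that unfolding is_functor_def by blast
  have arr: "FAr F f \<in> hom D (FOb F (Dom C f)) (FOb F (Cod C f))" if "f \<in> Ar C" for f
    using F that unfolding is_functor_def by blast
  have idn: "FAr F (Idn C A) = Idn D (FOb F A)" if "A \<in> Ob C" for A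
    using F that unfolding is_functor_def by blast
  show ?thesis
  proof (rule D.pullback_iso[OF image])
    show "FAr F \<theta> \<in> hom D (FOb F P') (FOb F P)" "FAr F \<theta>' \<in> hom D (FOb F P) (FOb F P')"
      using arr[of \<theta>] arr[of \<theta>'] by simp_all
    show "FAr F \<theta> \<cdot>\<^bsub>D\<^esub> FAr F \<theta>' = Idn D (FOb F P)" "FAr F \<theta>' \<cdot>\<^bsub>D\<^esub> FAr F \<theta> = Idn D (FOb F P')"
      by (simp_all add: comp[symmetric] inv inv' idn)
    show "FAr F p' = FAr F p \<cdot>\<^bsub>D\<^esub> FAr F \<theta>" "FAr F q' = FAr F q \<cdot>\<^bsub>D\<^esub> FAr F \<theta>"
      by (simp_all add: comp[symmetric] p)
  qed
qed

locale lex_functor = C: lex C + D: lex D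
  for C :: "('o, 'm) cat" and D :: "('p, 'n) cat" and F :: "('o, 'm, 'p, 'n) fctr" +
  assumes F_functor: "is_functor C D F"
    and F_pullback: "is_pullback C f g P p q \<Longrightarrow> is_pullback D (FAr F f) (FAr F g) (FOb F P) (FAr F p) (FAr F q)"
    and F_terminal: "is_terminal C T \<Longrightarrow> is_terminal D (FOb F T)"

sublocale lex_functor \<subseteq> product_functor C D F
proof
  fix A B P p q assume P: "is_product C A B P p q"
  have [simp]: "A \<in> Ob C" "B \<in> Ob C" using C.product_arrows[OF P] by simp_all
  have bang: "FAr F (bang C X) \<in> hom D (FOb F X) (FOb F \<one>\<^bsub>C\<^esub>)" if "X \<in> Ob C" for X
  proof -
    have "FAr F (bang C X) \<in> hom D (FOb F (Dom C (bang C X))) (FOb F (Cod C (bang C X)))"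
      using F_functor C.bang_simps(1)[OF that] unfolding is_functor_def by blast
    then show ?thesis using that by simp
  qed
  have "is_pullback C (bang C A) (bang C B) P p q"
    by (rule product_over_terminal[OF C.category_axioms C.terminal_chosen C.bang_hom C.bang_hom P]) simp_all
  then show "is_product D (FOb F A) (FOb F B) (FOb F P) (FAr F p) (FAr F q)"
    by (intro D.pullback_over_terminal[OF F_terminal[OF C.terminal_chosen] _ _ _ F_pullback])
      (use bang[of A] bang[of B] in \<open>simp_all add: in_hom\<close>)
qed (fact F_functor, fact F_terminal)

context lex_functor
begin

text \<open>An arrow is monic if and only if the projections of its kernel pair are equal.\<close>

lemma preserves_monic:
  assumes f: "monic C f"
  shows "monic D (FAr F f)"
proof (rule D.monicI)
  have fAr [simp]: "f \<in> Ar C" using f by (simp add: monic_def)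
  then show "FAr F f \<in> Ar D" by simp
  obtain P p q where pb: "is_pullback C f f P p q" using C.ex_pullback[of f f] by auto
  note [simp] = C.pullback_arrows(4-10)[OF pb]
  have pq: "p = q" by (rule C.monicD[OF f C.pullback_arrows(11)[OF pb]]) simp_all
  fix g h assume gh: "g \<in> Ar D" "h \<in> Ar D" "Cod D g = Dom D (FAr F f)" "Cod D h = Dom D (FAr F f)"
    "Dom D g = Dom D h" "FAr F f \<cdot>\<^bsub>D\<^esub> g = FAr F f \<cdot>\<^bsub>D\<^esub> h"
  obtain k where "FAr F p \<cdot>\<^bsub>D\<^esub> k = g" "FAr F q \<cdot>\<^bsub>D\<^esub> k = h"
    by (rule D.pullback_factor[OF F_pullback[OF pb] gh(1,2,5) _ gh(3,4,6)]) simp_all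
  then show "g = h" by (simp add: pq)
qed

end

definition slice_functor :: "('o, 'm, 'p, 'n) fctr \<Rightarrow> ('m, 'm slice_ar, 'n, 'n slice_ar) fctr" where
  "slice_functor F = \<lparr>FOb = FAr F, FAr = (\<lambda>\<sigma>. SliceAr (FAr F (sdom \<sigma>)) (FAr F (scod \<sigma>)) (FAr F (smap \<sigma>)))\<rparr>"

lemma slice_functor_simps:
  "FOb (slice_functor F) f = FAr F f"
  "FAr (slice_functor F) \<sigma> = SliceAr (FAr F (sdom \<sigma>)) (FAr F (scod \<sigma>)) (FAr F (smap \<sigma>))"
  by (simp_all add: slice_functor_def)

text \<open>Applied to the levels of graphs, this carries a graph of groups over \<open>Q\<close> to group objects of \<open>C\<close>
  over the edges and over the vertices of \<open>Q\<close>.\<close>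

lemma (in lex_functor) slice_product_functor:
  assumes Y: "Y \<in> Ob C"
  shows "product_functor (slice C Y) (slice D (FOb F Y)) (slice_functor F)"
proof -
  interpret S: cartesian "slice C Y" by (rule C.slice_cartesian[OF Y])
  interpret R: cartesian "slice D (FOb F Y)" by (rule D.slice_cartesian) (simp add: Y)
  show ?thesis
  proof
    show "is_functor (slice C Y) (slice D (FOb F Y)) (slice_functor F)"
      unfolding is_functor_def slice_functor_simps
      by (intro conjI ballI impI) (auto simp: slice_ar slice_simps in_hom F_comp[symmetric])
  next
    fix f g h \<rho> \<sigma> assume P: "is_product (slice C Y) f g h \<rho> \<sigma>"
    have [simp]: "f \<in> Ar C" "Cod C f = Y" "g \<in> Ar C" "Cod C g = Y" "h \<in> Ar C" "Cod C h = Y"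
      "sdom \<rho> = h" "scod \<rho> = f" "sdom \<sigma> = h" "scod \<sigma> = g" "smap \<rho> \<in> Ar C" "Cod C (smap \<rho>) = Dom C f"
      and h: "f \<cdot>\<^bsub>C\<^esub> smap \<rho> = h"
      using S.product_arrows[OF P] by (auto simp: slice_ar slice_simps)
    have "is_pullback D (FAr F f) (FAr F g) (FOb F (Dom C h)) (FAr F (smap \<rho>)) (FAr F (smap \<sigma>))"
      by (rule F_pullback) (rule C.pullback_of_slice_product[OF P])
    from D.slice_product_of_pullback[OF this, of "FOb F Y"]
    show "is_product (slice D (FOb F Y)) (FOb (slice_functor F) f) (FOb (slice_functor F) g) (FOb (slice_functor F) h)
        (FAr (slice_functor F) \<rho>) (FAr (slice_functor F) \<sigma>)"
      by (simp add: slice_functor_simps F_comp[symmetric] h)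
  next
    fix f assume T: "is_terminal (slice C Y) f"
    then have f [simp]: "f \<in> Ar C" "Cod C f = Y" by (simp_all add: is_terminal_def slice_simps)
    obtain k where [simp]: "k \<in> Ar C" "Dom C k = Y" "Cod C k = Dom C f"
      and k: "f \<cdot>\<^bsub>C\<^esub> k = Idn C Y" "k \<cdot>\<^bsub>C\<^esub> f = Idn C (Dom C f)"
      by (rule C.slice_terminalE[OF T])
    show "is_terminal (slice D (FOb F Y)) (FOb (slice_functor F) f)"
      unfolding slice_functor_simps
      by (rule D.slice_terminalI[of _ "FOb F (Dom C f)" _ "FAr F k"])
        (use Y in \<open>simp_all add: in_hom F_comp[symmetric] k\<close>)
  qed
qed

section \<open>Limits and colimits of graphs are computed levelwise\<close>

text \<open>The Boolean parameter lets edges and vertices share their proofs.\<close>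

definition level :: "bool \<Rightarrow> (('o, 'm) graph, ('o, 'm) graph_ar, 'o, 'm) fctr" where
  "level b = (if b then \<lparr>FOb = edges, FAr = emap\<rparr> else \<lparr>FOb = verts, FAr = vmap\<rparr>)"

lemma level_simps:
  "FOb (level True) = edges" "FAr (level True) = emap" "FOb (level False) = verts" "FAr (level False) = vmap"
  by (simp_all add: level_def)

lemma graph_simps:
  "Ob (graph_cat C) = {X. is_graph C X}" "Dom (graph_cat C) = grdom" "Cod (graph_cat C) = grcod"
  "Idn (graph_cat C) X = GraphAr X X (Idn C (edges X)) (Idn C (verts X))"
  "Cmp (graph_cat C) g f = GraphAr (grdom f) (grcod g) (Cmp C (emap g) (emap f)) (Cmp C (vmap g) (vmap f))"
  by (simp_all add: graph_cat_def)

lemma graph_ar: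
  "f \<in> Ar (graph_cat C) \<longleftrightarrow> is_graph C (grdom f) \<and> is_graph C (grcod f) \<and>
     emap f \<in> Ar C \<and> Dom C (emap f) = edges (grdom f) \<and> Cod C (emap f) = edges (grcod f) \<and>
     vmap f \<in> Ar C \<and> Dom C (vmap f) = verts (grdom f) \<and> Cod C (vmap f) = verts (grcod f) \<and>
     Cmp C (d0 (grcod f)) (emap f) = Cmp C (vmap f) (d0 (grdom f)) \<and>
     Cmp C (d1 (grcod f)) (emap f) = Cmp C (vmap f) (d1 (grdom f))"
  by (auto simp: graph_cat_def in_hom)

lemma is_graph:
  "is_graph C X \<longleftrightarrow> edges X \<in> Ob C \<and> verts X \<in> Ob C \<and>
     d0 X \<in> Ar C \<and> Dom C (d0 X) = edges X \<and> Cod C (d0 X) = verts X \<and>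
     d1 X \<in> Ar C \<and> Dom C (d1 X) = edges X \<and> Cod C (d1 X) = verts X"
  by (auto simp: is_graph_def in_hom)

lemma graph_ar_eqI:
  "grdom f = grdom g \<Longrightarrow> grcod f = grcod g \<Longrightarrow> emap f = emap g \<Longrightarrow> vmap f = vmap g \<Longrightarrow> f = g"
  by (cases f; cases g) simp

context category
begin

lemma graph_ar_comp:
  assumes "f \<in> Ar (graph_cat C)" "g \<in> Ar (graph_cat C)" "grdom g = grcod f"
  shows "d0 (grcod g) \<cdot> (emap g \<cdot> emap f) = vmap g \<cdot> (vmap f \<cdot> d0 (grdom f))"
    "d1 (grcod g) \<cdot> (emap g \<cdot> emap f) = vmap g \<cdot> (vmap f \<cdot> d1 (grdom f))"
proof -
  have "d0 (grcod g) \<cdot> emap g = vmap g \<cdot> d0 (grdom g)" "d1 (grcod g) \<cdot> emap g = vmap g \<cdot> d1 (grdom g)"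
    using assms(2) by (simp_all add: graph_ar)
  from comp_reduce[OF this(1), of "emap f"] comp_reduce[OF this(2), of "emap f"]
  show "d0 (grcod g) \<cdot> (emap g \<cdot> emap f) = vmap g \<cdot> (vmap f \<cdot> d0 (grdom f))"
    "d1 (grcod g) \<cdot> (emap g \<cdot> emap f) = vmap g \<cdot> (vmap f \<cdot> d1 (grdom f))"
    using assms by (simp_all add: graph_ar is_graph)
qed

lemma graph_category: "category (graph_cat C)"
proof
  fix f g :: "('o, 'm) graph_ar" and X Y Z
  assume "f \<in> hom (graph_cat C) X Y" "g \<in> hom (graph_cat C) Y Z"
  then show "g \<cdot>\<^bsub>graph_cat C\<^esub> f \<in> hom (graph_cat C) X Z"
    using graph_ar_comp[of f g] by (auto simp: in_hom graph_ar graph_simps is_graph)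
qed (auto simp: in_hom graph_ar graph_simps is_graph intro!: graph_ar_eqI)

lemma level_functor: "is_functor (graph_cat C) C (level b)"
  unfolding is_functor_def by (cases b) (auto simp: level_simps graph_simps graph_ar is_graph in_hom)

text \<open>The factorisations through the pullbacks of edges and of vertices commute with \<open>d0\<close> and \<open>d1\<close>,
  since both sides agree after the projections of the pullback of vertices.\<close>

lemma levelwise_pullback:
  assumes arrows: "f \<in> Ar (graph_cat C)" "g \<in> Ar (graph_cat C)" "p \<in> Ar (graph_cat C)" "q \<in> Ar (graph_cat C)"
    "grcod f = grcod g" "grdom p = P" "grcod p = grdom f" "grdom q = P" "grcod q = grdom g"
    and E: "is_pullback C (emap f) (emap g) (edges P) (emap p) (emap q)"
    and V: "is_pullback C (vmap f) (vmap g) (verts P) (vmap p) (vmap q)"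
  shows "is_pullback (graph_cat C) f g P p q"
proof -
  let ?D = "graph_cat C"
  interpret G: category "?D" by (rule graph_category)
  note [simp] = arrows(5-9)
  have P: "is_graph C P" using arrows(3) by (simp add: graph_ar)
  show ?thesis
  proof (rule G.is_pullbackI)
    show "f \<cdot>\<^bsub>?D\<^esub> p = g \<cdot>\<^bsub>?D\<^esub> q"
      using pullback_arrows(11)[OF E] pullback_arrows(11)[OF V] by (simp add: graph_simps)
  next
    fix W k l
    assume kl: "k \<in> Ar ?D" "l \<in> Ar ?D" "Dom ?D k = W" "Dom ?D l = W"
      "Cod ?D k = Dom ?D f" "Cod ?D l = Dom ?D g"
      "f \<cdot>\<^bsub>?D\<^esub> k = g \<cdot>\<^bsub>?D\<^esub> l"
    have [simp]: "grdom k = W" "grdom l = W" "grcod k = grdom f" "grcod l = grdom g"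
      using kl by (simp_all add: graph_simps)
    note F = arrows(1-4)[unfolded graph_ar is_graph, simplified] kl(1,2)[unfolded graph_ar is_graph, simplified]
    have eq: "emap f \<cdot> emap k = emap g \<cdot> emap l" "vmap f \<cdot> vmap k = vmap g \<cdot> vmap l"
      using kl(7) by (simp_all add: graph_simps)
    obtain hE where hE: "hE \<in> Ar C" "Dom C hE = edges W" "Cod C hE = edges P" "emap p \<cdot> hE = emap k" "emap q \<cdot> hE = emap l"
      by (rule pullback_factor[OF E, of "emap k" "emap l" "edges W"]) (use F eq in simp_all)
    obtain hV where hV: "hV \<in> Ar C" "Dom C hV = verts W" "Cod C hV = verts P" "vmap p \<cdot> hV = vmap k" "vmap q \<cdot> hV = vmap l"
      by (rule pullback_factor[OF V, of "vmap k" "vmap l" "verts W"]) (use F eq in simp_all)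
    have sq: "vmap r \<cdot> (d \<cdot> hE) = vmap r \<cdot> (hV \<cdot> d')"
      if r: "vmap r \<cdot> d = d'' \<cdot> emap r" "emap r \<cdot> hE = m" "vmap r \<cdot> hV = n" "d'' \<cdot> m = n \<cdot> d'"
        and t: "vmap r \<in> Ar C" "emap r \<in> Ar C" "d \<in> Ar C" "d' \<in> Ar C" "d'' \<in> Ar C" "Dom C d = edges P" "Cod C d = verts P"
          "Dom C (vmap r) = verts P" "Dom C (emap r) = edges P" "Cod C (emap r) = Dom C d''"
          "Dom C d' = edges W" "Cod C d' = verts W" for r d d' d'' m n
      using comp_reduce[OF r(1), of hE] comp_reduce[OF r(3), of d'] r hE(1-3) hV(1-3) t by simp
    have "d0 P \<cdot> hE = hV \<cdot> d0 W"
      by (rule pullback_eq[OF V])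
        (use F hE hV P[unfolded is_graph] sq[of p "d0 P" "d0 (grdom f)" "emap k" "vmap k" "d0 W"]
          sq[of q "d0 P" "d0 (grdom g)" "emap l" "vmap l" "d0 W"] in simp_all)
    moreover have "d1 P \<cdot> hE = hV \<cdot> d1 W"
      by (rule pullback_eq[OF V])
        (use F hE hV P[unfolded is_graph] sq[of p "d1 P" "d1 (grdom f)" "emap k" "vmap k" "d1 W"]
          sq[of q "d1 P" "d1 (grdom g)" "emap l" "vmap l" "d1 W"] in simp_all)
    ultimately show "\<exists>h. h \<in> Ar ?D \<and> Dom ?D h = W \<and> Cod ?D h = P \<and>
        p \<cdot>\<^bsub>?D\<^esub> h = k \<and> q \<cdot>\<^bsub>?D\<^esub> h = l"
      using hE hV F P by (intro exI[of _ "GraphAr W P hE hV"] conjI graph_ar_eqI) (simp_all add: graph_simps graph_ar is_graph)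
  next
    fix h k assume hk: "h \<in> Ar ?D" "k \<in> Ar ?D" "Dom ?D h = Dom ?D k"
      "Cod ?D h = P" "Cod ?D k = P"
      "p \<cdot>\<^bsub>?D\<^esub> h = p \<cdot>\<^bsub>?D\<^esub> k" "q \<cdot>\<^bsub>?D\<^esub> h = q \<cdot>\<^bsub>?D\<^esub> k"
    have "emap h = emap k" by (rule pullback_eq[OF E]) (use hk in \<open>simp_all add: graph_simps graph_ar\<close>)
    moreover have "vmap h = vmap k" by (rule pullback_eq[OF V]) (use hk in \<open>simp_all add: graph_simps graph_ar\<close>)
    ultimately show "h = k" by - (rule graph_ar_eqI, use hk in \<open>simp_all add: graph_simps\<close>)
  qed (use arrows in \<open>simp_all add: graph_simps\<close>)
qed

end

context lex
begin

text \<open>The structure maps of the pullback graph are induced by those of the two given graphs.\<close>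

lemma levelwise_pullback_exists:
  assumes fg: "f \<in> Ar (graph_cat C)" "g \<in> Ar (graph_cat C)" "grcod f = grcod g"
  shows "\<exists>P p q. is_pullback (graph_cat C) f g P p q \<and>
    is_pullback C (emap f) (emap g) (edges P) (emap p) (emap q) \<and>
    is_pullback C (vmap f) (vmap g) (verts P) (vmap p) (vmap q)"
proof -
  let ?D = "graph_cat C"
  let ?X = "grdom f" and ?Y = "grdom g" and ?Z = "grcod g"
  note [simp] = fg(3)
  note F [simp] = fg(1,2)[unfolded graph_ar is_graph, simplified]
  obtain PE pE qE where E: "is_pullback C (emap f) (emap g) PE pE qE"
    using ex_pullback[of "emap f" "emap g"] by auto
  obtain PV pV qV where V: "is_pullback C (vmap f) (vmap g) PV pV qV"
    using ex_pullback[of "vmap f" "vmap g"] by auto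
  note [simp] = pullback_arrows(4-10)[OF E] pullback_arrows(4-10)[OF V]
  have lift: "\<exists>d. d \<in> Ar C \<and> Dom C d = PE \<and> Cod C d = PV \<and> pV \<cdot> d = x \<cdot> pE \<and> qV \<cdot> d = y \<cdot> qE"
    if d: "x \<in> Ar C" "Dom C x = edges ?X" "Cod C x = verts ?X" "y \<in> Ar C" "Dom C y = edges ?Y" "Cod C y = verts ?Y"
      "z \<in> Ar C" "Dom C z = edges ?Z" "Cod C z = verts ?Z"
      and sq: "vmap f \<cdot> x = z \<cdot> emap f" "vmap g \<cdot> y = z \<cdot> emap g" for x y z
  proof -
    have "vmap f \<cdot> (x \<cdot> pE) = vmap g \<cdot> (y \<cdot> qE)"
      using comp_reduce[OF sq(1), of pE] comp_reduce[OF sq(2), of qE] d pullback_arrows(11)[OF E] by simp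
    then obtain h where "h \<in> Ar C" "Dom C h = PE" "Cod C h = PV" "pV \<cdot> h = x \<cdot> pE" "qV \<cdot> h = y \<cdot> qE"
      by - (rule pullback_factor[OF V, of "x \<cdot> pE" "y \<cdot> qE" PE], use d in simp_all)
    then show ?thesis by blast
  qed
  obtain e0 where e0: "e0 \<in> Ar C" "Dom C e0 = PE" "Cod C e0 = PV" "pV \<cdot> e0 = d0 ?X \<cdot> pE" "qV \<cdot> e0 = d0 ?Y \<cdot> qE"
    using lift[of "d0 ?X" "d0 ?Y" "d0 ?Z"] F by metis
  obtain e1 where e1: "e1 \<in> Ar C" "Dom C e1 = PE" "Cod C e1 = PV" "pV \<cdot> e1 = d1 ?X \<cdot> pE" "qV \<cdot> e1 = d1 ?Y \<cdot> qE"
    using lift[of "d1 ?X" "d1 ?Y" "d1 ?Z"] F by metis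
  let ?P = "Graph PE PV e0 e1"
  have "is_pullback ?D f g ?P (GraphAr ?P ?X pE pV) (GraphAr ?P ?Y qE qV)"
    by (rule levelwise_pullback) (use fg E V e0 e1 in \<open>simp_all add: graph_ar is_graph\<close>)
  with E V show ?thesis
    by (intro exI[of _ ?P] exI[of _ "GraphAr ?P ?X pE pV"] exI[of _ "GraphAr ?P ?Y qE qV"]) simp
qed

lemma level_pullback:
  assumes pb: "is_pullback (graph_cat C) f g P p q"
  shows "is_pullback C (FAr (level b) f) (FAr (level b) g) (FOb (level b) P) (FAr (level b) p) (FAr (level b) q)"
proof -
  interpret G: category "graph_cat C" by (rule graph_category)
  have "f \<in> Ar (graph_cat C)" "g \<in> Ar (graph_cat C)" "grcod f = grcod g"
    using G.pullback_arrows(1-3)[OF pb] by (simp_all add: graph_simps)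
  from levelwise_pullback_exists[OF this] obtain P' p' q' where pb': "is_pullback (graph_cat C) f g P' p' q'"
    and E: "is_pullback C (emap f) (emap g) (edges P') (emap p') (emap q')"
    and V: "is_pullback C (vmap f) (vmap g) (verts P') (vmap p') (vmap q')" by blast
  show ?thesis
    by (rule functor_pullback_transfer[OF graph_category category_axioms level_functor pb' pb])
      (use E V in \<open>cases b; simp add: level_simps\<close>)
qed

lemma const_graph_terminal:
  assumes T: "is_terminal C T"
  shows "is_terminal (graph_cat C) (const_graph C T)"
proof -
  let ?D = "graph_cat C"
  interpret G: category "?D" by (rule graph_category)
  have [simp]: "T \<in> Ob C" using T by (simp add: is_terminal_def)
  show ?thesis
  proof (rule G.is_terminalI)
    show "const_graph C T \<in> Ob ?D" by (simp add: graph_simps is_graph const_graph_def)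
    fix X assume "X \<in> Ob ?D"
    then have X [simp]: "is_graph C X" by (simp add: graph_simps)
    note [simp] = X[unfolded is_graph]
    obtain e where [simp]: "e \<in> Ar C" "Dom C e = edges X" "Cod C e = T" by (rule terminal_arrow[OF T, of "edges X"]) simp_all
    obtain v where [simp]: "v \<in> Ar C" "Dom C v = verts X" "Cod C v = T" by (rule terminal_arrow[OF T, of "verts X"]) simp_all
    have "e = v \<cdot> d0 X" "e = v \<cdot> d1 X" by (rule terminal_unique[OF T]; simp)+
    then show "\<exists>f. f \<in> Ar ?D \<and> Dom ?D f = X \<and> Cod ?D f = const_graph C T"
      by (intro exI[of _ "GraphAr X (const_graph C T) e v"]) (simp add: graph_ar graph_simps is_graph const_graph_def)
  next
    fix f g assume fg: "f \<in> Ar ?D" "g \<in> Ar ?D" "Dom ?D f = Dom ?D g"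
      "Cod ?D f = const_graph C T" "Cod ?D g = const_graph C T"
    have "emap f = emap g" by (rule terminal_unique[OF T]) (use fg in \<open>simp_all add: graph_ar graph_simps const_graph_def\<close>)
    moreover have "vmap f = vmap g"
      by (rule terminal_unique[OF T]) (use fg in \<open>simp_all add: graph_ar graph_simps const_graph_def\<close>)
    ultimately show "f = g" by - (rule graph_ar_eqI, use fg in \<open>simp_all add: graph_simps\<close>)
  qed
qed

lemma graph_lex: "lex (graph_cat C)"
proof -
  let ?D = "graph_cat C"
  interpret G: category "?D" by (rule graph_category)
  show ?thesis
  proof
    show "\<exists>T. is_terminal ?D T" using const_graph_terminal[OF terminal_chosen] by blast
    fix f g assume "f \<in> Ar ?D" "g \<in> Ar ?D" "Cod ?D f = Cod ?D g"
    then show "\<exists>P p q. is_pullback ?D f g P p q"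
      using levelwise_pullback_exists[of f g] by (auto simp: graph_simps)
  qed
qed

text \<open>For the terminal object: any terminal graph is isomorphic to the constant one.\<close>

lemma level_lex_functor: "lex_functor (graph_cat C) C (level b)"
proof -
  let ?D = "graph_cat C"
  interpret G: lex "?D" by (rule graph_lex)
  show ?thesis
  proof
    fix X assume X: "is_terminal ?D X"
    let ?T = "const_graph C \<one>"
    note T = const_graph_terminal[OF terminal_chosen]
    have ob: "X \<in> Ob ?D" "?T \<in> Ob ?D" using X T by (simp_all add: is_terminal_def)
    obtain k where k: "k \<in> Ar ?D" "Dom ?D k = ?T" "Cod ?D k = X"
      by (rule G.terminal_arrow[OF X ob(2)])
    obtain l where l: "l \<in> Ar ?D" "Dom ?D l = X" "Cod ?D l = ?T"
      by (rule G.terminal_arrow[OF T ob(1)])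
    have kl: "k \<cdot>\<^bsub>?D\<^esub> l = Idn ?D X"
      by (rule G.terminal_unique[OF X]) (use k l ob in simp_all)
    define X' k' l' where "X' = FOb (level b) X" and "k' = FAr (level b) k" and "l' = FAr (level b) l"
    have [simp]: "k' \<in> Ar C" "Dom C k' = \<one>" "Cod C k' = X'" "l' \<in> Ar C" "Dom C l' = X'" "Cod C l' = \<one>" "X' \<in> Ob C"
      and kl': "k' \<cdot> l' = Idn C X'"
      using k l kl ob unfolding X'_def k'_def l'_def
      by (cases b; simp add: level_simps graph_simps graph_ar is_graph const_graph_def; fail)+
    have "is_terminal C X'"
    proof (rule is_terminalI)
      fix A assume "A \<in> Ob C"
      then show "\<exists>f. f \<in> Ar C \<and> Dom C f = A \<and> Cod C f = X'" by (intro exI[of _ "k' \<cdot> bang C A"]) simp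
    next
      fix f g assume fg: "f \<in> Ar C" "g \<in> Ar C" "Dom C f = Dom C g" "Cod C f = X'" "Cod C g = X'"
      have "l' \<cdot> f = l' \<cdot> g" by (rule terminal_unique[OF terminal_chosen]) (use fg in simp_all)
      then have "k' \<cdot> (l' \<cdot> f) = k' \<cdot> (l' \<cdot> g)" by simp
      then show "f = g" using fg by (simp add: comp_reduce[OF kl'])
    qed simp
    then show "is_terminal C (FOb (level b) X)" by (simp add: X'_def)
  qed (rule level_functor, rule level_pullback)
qed

lemma const_lex_functor: "lex_functor C (graph_cat C) (const_functor C)"
proof -
  let ?D = "graph_cat C"
  interpret G: lex "?D" by (rule graph_lex)
  show ?thesis
  proof
    show "is_functor C ?D (const_functor C)"
      unfolding is_functor_def const_functor_def
      by (auto simp: graph_simps graph_ar is_graph const_graph_def in_hom)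
  next
    fix f g P p q assume pb: "is_pullback C f g P p q"
    note [simp] = pullback_arrows(1,2,4-10)[OF pb] and eq = pullback_arrows(3)[OF pb]
    show "is_pullback ?D (FAr (const_functor C) f) (FAr (const_functor C) g) (FOb (const_functor C) P)
        (FAr (const_functor C) p) (FAr (const_functor C) q)"
      by (rule levelwise_pullback)
        (use pb eq in \<open>simp_all add: const_functor_def graph_ar is_graph const_graph_def\<close>)
  next
    fix T assume "is_terminal C T"
    then show "is_terminal ?D (FOb (const_functor C) T)"
      by (simp add: const_functor_def const_graph_terminal)
  qed
qed

end

context category
begin

text \<open>Here compatibility with \<open>d0\<close> and \<open>d1\<close> is tested on the epimorphism \<open>emap q\<close>.\<close>

lemma levelwise_coequaliser:
  assumes arrows: "f \<in> Ar (graph_cat C)" "g \<in> Ar (graph_cat C)" "q \<in> Ar (graph_cat C)"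
    "grdom g = grdom f" "grcod g = grcod f" "grdom q = grcod f"
    and E: "is_coequaliser C (emap f) (emap g) (emap q)" and V: "is_coequaliser C (vmap f) (vmap g) (vmap q)"
  shows "is_coequaliser (graph_cat C) f g q"
proof -
  let ?D = "graph_cat C"
  interpret G: category "?D" by (rule graph_category)
  note [simp] = arrows(4-6)
  note F [simp] = arrows(1-3)[unfolded graph_ar is_graph, simplified]
  show ?thesis
  proof (rule G.is_coequaliserI)
    show "q \<cdot>\<^bsub>?D\<^esub> f = q \<cdot>\<^bsub>?D\<^esub> g"
      using coequaliser_arrows(7)[OF E] coequaliser_arrows(7)[OF V] by (simp add: graph_simps)
  next
    fix k assume k: "k \<in> Ar ?D" "Dom ?D k = Cod ?D f"
      "k \<cdot>\<^bsub>?D\<^esub> f = k \<cdot>\<^bsub>?D\<^esub> g"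
    have [simp]: "grdom k = grcod f" using k by (simp add: graph_simps)
    note K [simp] = k(1)[unfolded graph_ar is_graph, simplified]
    have eq: "emap k \<cdot> emap f = emap k \<cdot> emap g" "vmap k \<cdot> vmap f = vmap k \<cdot> vmap g"
      using k(3) by (simp_all add: graph_simps)
    obtain hE where [simp]: "hE \<in> Ar C" "Dom C hE = edges (grcod q)" "Cod C hE = edges (grcod k)" and hE: "hE \<cdot> emap q = emap k"
      using coequaliser_factor[OF E, of "emap k"] eq by auto
    obtain hV where [simp]: "hV \<in> Ar C" "Dom C hV = verts (grcod q)" "Cod C hV = verts (grcod k)" and hV: "hV \<cdot> vmap q = vmap k"
      using coequaliser_factor[OF V, of "vmap k"] eq by auto
    have "d0 (grcod k) \<cdot> hE = hV \<cdot> d0 (grcod q)"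
      by (rule coequaliser_epi[OF E]) (simp_all add: hE comp_reduce[OF hV])
    moreover have "d1 (grcod k) \<cdot> hE = hV \<cdot> d1 (grcod q)"
      by (rule coequaliser_epi[OF E]) (simp_all add: hE comp_reduce[OF hV])
    ultimately show "\<exists>h. h \<in> Ar ?D \<and> Dom ?D h = Cod ?D q \<and>
        Cod ?D h = Cod ?D k \<and> h \<cdot>\<^bsub>?D\<^esub> q = k"
      by (intro exI[of _ "GraphAr (grcod q) (grcod k) hE hV"] conjI graph_ar_eqI)
        (simp_all add: graph_simps graph_ar is_graph hE hV)
  next
    fix h k assume hk: "h \<in> Ar ?D" "k \<in> Ar ?D" "Dom ?D h = Cod ?D q"
      "Dom ?D k = Cod ?D q" "Cod ?D h = Cod ?D k"
      "h \<cdot>\<^bsub>?D\<^esub> q = k \<cdot>\<^bsub>?D\<^esub> q"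
    have "emap h = emap k" by (rule coequaliser_epi[OF E]) (use hk in \<open>simp_all add: graph_simps graph_ar\<close>)
    moreover have "vmap h = vmap k" by (rule coequaliser_epi[OF V]) (use hk in \<open>simp_all add: graph_simps graph_ar\<close>)
    ultimately show "h = k" by - (rule graph_ar_eqI, use hk in \<open>simp_all add: graph_simps\<close>)
  qed (use arrows in \<open>simp_all add: graph_simps\<close>)
qed

lemma levelwise_coequaliser_exists:
  assumes coeq: "has_coequalisers C"
    and fg: "f \<in> Ar (graph_cat C)" "g \<in> Ar (graph_cat C)" "grdom g = grdom f" "grcod g = grcod f"
  shows "\<exists>q. is_coequaliser (graph_cat C) f g q \<and> is_coequaliser C (emap f) (emap g) (emap q) \<and>
    is_coequaliser C (vmap f) (vmap g) (vmap q)"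
proof -
  let ?X = "grdom f" and ?Y = "grcod f"
  note [simp] = fg(3,4)
  note F [simp] = fg(1,2)[unfolded graph_ar is_graph, simplified]
  have ex: "\<exists>q. is_coequaliser C x y q" if "x \<in> Ar C" "y \<in> Ar C" "Dom C y = Dom C x" "Cod C y = Cod C x" for x y
    using coeq[unfolded has_coequalisers_def, rule_format, of "Dom C x" "Cod C x" x y] that by (simp add: in_hom)
  obtain qE where E: "is_coequaliser C (emap f) (emap g) qE" using ex[of "emap f" "emap g"] by auto
  obtain qV where V: "is_coequaliser C (vmap f) (vmap g) qV" using ex[of "vmap f" "vmap g"] by auto
  have [simp]: "qE \<in> Ar C" "Dom C qE = edges ?Y" "qV \<in> Ar C" "Dom C qV = verts ?Y"
    using coequaliser_arrows(5,6)[OF E] coequaliser_arrows(5,6)[OF V] by simp_all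
  have descend: "\<exists>e. e \<in> Ar C \<and> Dom C e = Cod C qE \<and> Cod C e = Cod C qV \<and> e \<cdot> qE = qV \<cdot> y"
    if [simp]: "y \<in> Ar C" "Dom C y = edges ?Y" "Cod C y = verts ?Y" "x \<in> Ar C" "Dom C x = edges ?X" "Cod C x = verts ?X"
      and sq: "y \<cdot> emap f = vmap f \<cdot> x" "y \<cdot> emap g = vmap g \<cdot> x" for x y
  proof -
    have "(qV \<cdot> y) \<cdot> emap f = (qV \<cdot> y) \<cdot> emap g"
      using comp_reduce[OF coequaliser_arrows(7)[OF V], of x] by (simp add: sq)
    then show ?thesis using coequaliser_factor[OF E, of "qV \<cdot> y"] by auto
  qed
  obtain e0 where e0: "e0 \<in> Ar C" "Dom C e0 = Cod C qE" "Cod C e0 = Cod C qV" "e0 \<cdot> qE = qV \<cdot> d0 ?Y"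
    using descend[of "d0 ?Y" "d0 ?X"] F by metis
  obtain e1 where e1: "e1 \<in> Ar C" "Dom C e1 = Cod C qE" "Cod C e1 = Cod C qV" "e1 \<cdot> qE = qV \<cdot> d1 ?Y"
    using descend[of "d1 ?Y" "d1 ?X"] F by metis
  let ?q = "GraphAr ?Y (Graph (Cod C qE) (Cod C qV) e0 e1) qE qV"
  have "is_coequaliser (graph_cat C) f g ?q"
    by (rule levelwise_coequaliser) (use fg E V e0 e1 in \<open>simp_all add: graph_ar is_graph\<close>)
  with E V show ?thesis by (intro exI[of _ ?q]) simp
qed

lemma level_coequaliser:
  assumes coeq: "has_coequalisers C" and q: "is_coequaliser (graph_cat C) f g q"
  shows "is_coequaliser C (FAr (level b) f) (FAr (level b) g) (FAr (level b) q)"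
proof -
  let ?D = "graph_cat C"
  interpret G: category "?D" by (rule graph_category)
  note arr [simp] = G.coequaliser_arrows(1-6)[OF q]
  obtain r where r: "is_coequaliser ?D f g r" "is_coequaliser C (emap f) (emap g) (emap r)"
      "is_coequaliser C (vmap f) (vmap g) (vmap r)"
    using levelwise_coequaliser_exists[OF coeq, of f g] arr(1-4) by (auto simp: graph_simps)
  note arr' [simp] = G.coequaliser_arrows(5,6)[OF r(1)]
  obtain k where k [simp]: "k \<in> Ar ?D" "Dom ?D k = Cod ?D r"
      "Cod ?D k = Cod ?D q" and kr: "k \<cdot>\<^bsub>?D\<^esub> r = q"
    by (rule G.coequaliser_factor[OF r(1), of q]) (simp_all add: G.coequaliser_arrows(7)[OF q])
  obtain l where l [simp]: "l \<in> Ar ?D" "Dom ?D l = Cod ?D q"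
      "Cod ?D l = Cod ?D r" and lq: "l \<cdot>\<^bsub>?D\<^esub> q = r"
    by (rule G.coequaliser_factor[OF q, of r]) (simp_all add: G.coequaliser_arrows(7)[OF r(1)])
  have kl: "k \<cdot>\<^bsub>?D\<^esub> l = Idn ?D (Cod ?D q)"
    by (rule G.coequaliser_epi[OF q]) (simp_all add: kr lq)
  have lk: "l \<cdot>\<^bsub>?D\<^esub> k = Idn ?D (Cod ?D r)"
    by (rule G.coequaliser_epi[OF r(1)]) (simp_all add: kr lq)
  let ?F = "level b :: (('o, 'm) graph, ('o, 'm) graph_ar, 'o, 'm) fctr"
  have comp: "FAr ?F (g \<cdot>\<^bsub>?D\<^esub> f) = FAr ?F g \<cdot> FAr ?F f"
    if "f \<in> Ar ?D" "g \<in> Ar ?D" "Dom ?D g = Cod ?D f" for f g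
    using level_functor[of b] that unfolding is_functor_def by blast
  have arr: "FAr ?F f \<in> hom C (FOb ?F (Dom ?D f)) (FOb ?F (Cod ?D f))" if "f \<in> Ar ?D" for f
    using level_functor[of b] that unfolding is_functor_def by blast
  have idn: "FAr ?F (Idn ?D A) = Idn C (FOb ?F A)" "FOb ?F A \<in> Ob C" if "A \<in> Ob ?D" for A
    using level_functor[of b] that unfolding is_functor_def by blast+
  have Fr: "is_coequaliser C (FAr ?F f) (FAr ?F g) (FAr ?F r)"
    using r(2,3) by (cases b) (simp_all add: level_simps)
  have dom [simp]: "FAr ?F h \<in> Ar C" "Dom C (FAr ?F h) = FOb ?F (Dom ?D h)"
    "Cod C (FAr ?F h) = FOb ?F (Cod ?D h)" if "h \<in> Ar ?D" for h
    using arr[OF that] by (simp_all add: in_hom)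
  show ?thesis
    by (rule coequaliser_iso[OF Fr, of "Idn C (FOb ?F (Dom ?D f))" _ "Idn C (FOb ?F (Dom ?D f))"
          "Idn C (FOb ?F (Cod ?D f))" _ "Idn C (FOb ?F (Cod ?D f))" "FAr ?F l"
          "FOb ?F (Cod ?D q)" "FAr ?F k"])
      (simp_all add: in_hom idn comp[symmetric] kl lk lq)
qed

end

text \<open>Coequalisers and products of graphs are levelwise, so the assumption passes from \<open>C\<close> to graphs.
  The levels of a chosen product of graphs are products of the levels but not the chosen ones, hence
  the comparison isomorphisms \<open>\<theta>\<close>.\<close>

lemma (in lex) graph_products_preserve_coequalisers:
  assumes coeq: "has_coequalisers C" and pres: "products_preserve_coequalisers C"
  shows "products_preserve_coequalisers (graph_cat C)"
  unfolding products_preserve_coequalisers_def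
proof (intro ballI allI impI)
  fix A f g q assume A: "A \<in> Ob (graph_cat C)" and q: "is_coequaliser (graph_cat C) f g q"
  interpret G: lex "graph_cat C" by (rule graph_lex)
  let ?D = "graph_cat C"
  let ?I = "Idn ?D A"
  define X Y Z where "X = Dom ?D f" and "Y = Cod ?D f" and "Z = Cod ?D q"
  have [simp]: "f \<in> Ar ?D" "g \<in> Ar ?D" "q \<in> Ar ?D" "Dom ?D f = X" "Cod ?D f = Y" "Dom ?D g = X" "Cod ?D g = Y" "Dom ?D q = Y" "Cod ?D q = Z"
    using G.coequaliser_arrows(1-6)[OF q] by (simp_all add: X_def Y_def Z_def)
  have [simp]: "X \<in> Ob ?D" "Y \<in> Ob ?D" "Z \<in> Ob ?D" using G.ob_simps[of f] G.ob_simps(2)[of q] by simp_all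
  note [simp] = A
  have level: "is_coequaliser C (FAr (level b) (?I \<otimes>\<^sub>a\<^bsub>?D\<^esub> f)) (FAr (level b) (?I \<otimes>\<^sub>a\<^bsub>?D\<^esub> g)) (FAr (level b) (?I \<otimes>\<^sub>a\<^bsub>?D\<^esub> q))" for b
  proof -
    interpret F: lex_functor ?D C "level b" by (rule level_lex_functor)
    let ?F = "level b :: (('o, 'm) graph, ('o, 'm) graph_ar, 'o, 'm) fctr"
    let ?A = "FOb ?F A"
    let ?\<theta> = "\<lambda>B. \<langle>FAr ?F (pr1 ?D A B), FAr ?F (pr2 ?D A B)\<rangle>"
    have iso: "\<exists>\<theta>'. \<theta>' \<in> Ar C \<and> Dom C \<theta>' = ?A \<otimes> FOb ?F B \<and> Cod C \<theta>' = FOb ?F (A \<otimes>\<^bsub>?D\<^esub> B) \<and>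
        ?\<theta> B \<cdot> \<theta>' = Idn C (?A \<otimes> FOb ?F B) \<and> \<theta>' \<cdot> ?\<theta> B = Idn C (FOb ?F (A \<otimes>\<^bsub>?D\<^esub> B))" if [simp]: "B \<in> Ob ?D" for B
    proof -
      obtain w where w [simp]: "w \<in> Ar C" "Dom C w = ?A \<otimes> FOb ?F B" "Cod C w = FOb ?F (A \<otimes>\<^bsub>?D\<^esub> B)"
        and pr: "FAr ?F (pr1 ?D A B) \<cdot> w = pr1 C ?A (FOb ?F B)" "FAr ?F (pr2 ?D A B) \<cdot> w = pr2 C ?A (FOb ?F B)"
        by (rule F.F_pair_exists[of A B "pr1 C ?A (FOb ?F B)" "pr2 C ?A (FOb ?F B)" "?A \<otimes> FOb ?F B"]) simp_all
      have "w \<cdot> ?\<theta> B = Idn C (FOb ?F (A \<otimes>\<^bsub>?D\<^esub> B))"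
        by (rule F.F_pair_unique[of A B]) (simp_all add: comp_reduce[OF pr(1)] comp_reduce[OF pr(2)])
      then show ?thesis by (intro exI[of _ w]) (simp add: pr)
    qed
    have nat: "?\<theta> (Cod ?D h) \<cdot> FAr ?F (?I \<otimes>\<^sub>a\<^bsub>?D\<^esub> h) = (Idn C ?A \<otimes>\<^sub>a FAr ?F h) \<cdot> ?\<theta> (Dom ?D h)" if [simp]: "h \<in> Ar ?D" for h
    proof -
      have "FAr ?F (pr1 ?D A (Cod ?D h)) \<cdot> FAr ?F (?I \<otimes>\<^sub>a\<^bsub>?D\<^esub> h) = FAr ?F (pr1 ?D A (Dom ?D h))"
        "FAr ?F (pr2 ?D A (Cod ?D h)) \<cdot> FAr ?F (?I \<otimes>\<^sub>a\<^bsub>?D\<^esub> h) = FAr ?F h \<cdot> FAr ?F (pr2 ?D A (Dom ?D h))"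
        by (simp_all add: F.F_comp[symmetric])
      then show ?thesis by simp
    qed
    obtain x y z where x: "x \<in> Ar C" "Dom C x = ?A \<otimes> FOb ?F X" "Cod C x = FOb ?F (A \<otimes>\<^bsub>?D\<^esub> X)"
        "?\<theta> X \<cdot> x = Idn C (?A \<otimes> FOb ?F X)" "x \<cdot> ?\<theta> X = Idn C (FOb ?F (A \<otimes>\<^bsub>?D\<^esub> X))"
      and y: "y \<in> Ar C" "Dom C y = ?A \<otimes> FOb ?F Y" "Cod C y = FOb ?F (A \<otimes>\<^bsub>?D\<^esub> Y)"
        "?\<theta> Y \<cdot> y = Idn C (?A \<otimes> FOb ?F Y)" "y \<cdot> ?\<theta> Y = Idn C (FOb ?F (A \<otimes>\<^bsub>?D\<^esub> Y))"
      and z: "z \<in> Ar C" "Dom C z = ?A \<otimes> FOb ?F Z" "Cod C z = FOb ?F (A \<otimes>\<^bsub>?D\<^esub> Z)"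
        "?\<theta> Z \<cdot> z = Idn C (?A \<otimes> FOb ?F Z)" "z \<cdot> ?\<theta> Z = Idn C (FOb ?F (A \<otimes>\<^bsub>?D\<^esub> Z))"
      using iso[of X] iso[of Y] iso[of Z] by auto
    have "is_coequaliser C (Idn C ?A \<otimes>\<^sub>a FAr ?F f) (Idn C ?A \<otimes>\<^sub>a FAr ?F g) (Idn C ?A \<otimes>\<^sub>a FAr ?F q)"
      using pres level_coequaliser[OF coeq q, of b] unfolding products_preserve_coequalisers_def by simp
    then show ?thesis
      by (rule coequaliser_iso[where \<alpha> = "?\<theta> X" and \<alpha>' = x and \<beta> = "?\<theta> Y" and \<beta>' = y and \<kappa> = "?\<theta> Z" and \<kappa>' = z
            and X' = "FOb ?F (A \<otimes>\<^bsub>?D\<^esub> X)" and Y' = "FOb ?F (A \<otimes>\<^bsub>?D\<^esub> Y)" and Z' = "FOb ?F (A \<otimes>\<^bsub>?D\<^esub> Z)"])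
        (use x y z nat[of f] nat[of g] nat[of q] in \<open>simp_all add: in_hom del: prod_ar_pairing prod_ar_comp pairing_comp\<close>)
  qed
  show "is_coequaliser ?D (?I \<otimes>\<^sub>a\<^bsub>?D\<^esub> f) (?I \<otimes>\<^sub>a\<^bsub>?D\<^esub> g) (?I \<otimes>\<^sub>a\<^bsub>?D\<^esub> q)"
  proof (rule levelwise_coequaliser)
    have "Dom ?D (?I \<otimes>\<^sub>a\<^bsub>?D\<^esub> g) = Dom ?D (?I \<otimes>\<^sub>a\<^bsub>?D\<^esub> f)" "Cod ?D (?I \<otimes>\<^sub>a\<^bsub>?D\<^esub> g) = Cod ?D (?I \<otimes>\<^sub>a\<^bsub>?D\<^esub> f)"
      "Dom ?D (?I \<otimes>\<^sub>a\<^bsub>?D\<^esub> q) = Cod ?D (?I \<otimes>\<^sub>a\<^bsub>?D\<^esub> f)" by simp_all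
    then show "grdom (?I \<otimes>\<^sub>a\<^bsub>?D\<^esub> g) = grdom (?I \<otimes>\<^sub>a\<^bsub>?D\<^esub> f)" "grcod (?I \<otimes>\<^sub>a\<^bsub>?D\<^esub> g) = grcod (?I \<otimes>\<^sub>a\<^bsub>?D\<^esub> f)"
      "grdom (?I \<otimes>\<^sub>a\<^bsub>?D\<^esub> q) = grcod (?I \<otimes>\<^sub>a\<^bsub>?D\<^esub> f)" unfolding graph_simps(2,3) by blast+
  qed (use level[of True] level[of False] in \<open>simp_all add: level_simps\<close>)
qed

section \<open>The standard graph\<close>

text \<open>Since \<open>P \<times> -\<close> and \<open>P \<times> (P \<times> -)\<close> preserve the coequaliser, the arrow \<open>\<tau> \<circ> l\<close> descends to
  \<open>P \<times> T\<close>, and the action laws may be checked after the epimorphisms \<open>1 \<times> (1 \<times> \<tau>)\<close> and \<open>\<tau>\<close>.\<close>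

lemma (in cartesian) quotient_action:
  assumes pres: "products_preserve_coequalisers C"
    and l: "is_action C P Y l" and \<tau>: "is_coequaliser C r r' \<tau>" "Cod C r = Y"
    and compatible: "\<tau> \<cdot> (l \<cdot> (Idn C (gob P) \<otimes>\<^sub>a r)) = \<tau> \<cdot> (l \<cdot> (Idn C (gob P) \<otimes>\<^sub>a r'))"
  defines "a \<equiv> (THE a. a \<in> hom C (gob P \<otimes> Cod C \<tau>) (Cod C \<tau>) \<and> a \<cdot> (Idn C (gob P) \<otimes>\<^sub>a \<tau>) = \<tau> \<cdot> l)"
  shows "is_action C P (Cod C \<tau>) a" and "a \<cdot> (Idn C (gob P) \<otimes>\<^sub>a \<tau>) = \<tau> \<cdot> l"
proof -
  let ?I = "Idn C (gob P)"
  define T where "T = Cod C \<tau>"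
  note [simp] = action_el(1-5)[OF l]
  have [simp]: "r \<in> Ar C" "r' \<in> Ar C" "Dom C r' = Dom C r" "Cod C r = Y" "Cod C r' = Y" "\<tau> \<in> Ar C" "Dom C \<tau> = Y" "Cod C \<tau> = T"
    using coequaliser_arrows(1-6)[OF \<tau>(1)] \<tau>(2) by (simp_all add: T_def)
  have [simp]: "T \<in> Ob C" using ob_simps(2)[of \<tau>] by simp
  have coeq1: "is_coequaliser C (?I \<otimes>\<^sub>a r) (?I \<otimes>\<^sub>a r') (?I \<otimes>\<^sub>a \<tau>)"
    using pres \<tau>(1) unfolding products_preserve_coequalisers_def by simp
  then have coeq2: "is_coequaliser C (?I \<otimes>\<^sub>a (?I \<otimes>\<^sub>a r)) (?I \<otimes>\<^sub>a (?I \<otimes>\<^sub>a r')) (?I \<otimes>\<^sub>a (?I \<otimes>\<^sub>a \<tau>))"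
    using pres unfolding products_preserve_coequalisers_def by simp
  have "(\<tau> \<cdot> l) \<cdot> (?I \<otimes>\<^sub>a r) = (\<tau> \<cdot> l) \<cdot> (?I \<otimes>\<^sub>a r')"
    using compatible by (simp del: prod_ar_comp)
  then obtain b where b: "b \<in> hom C (gob P \<otimes> T) T \<and> b \<cdot> (?I \<otimes>\<^sub>a \<tau>) = \<tau> \<cdot> l"
    using coequaliser_factor[OF coeq1, of "\<tau> \<cdot> l"] by (auto simp: in_hom)
  have "\<exists>!b. b \<in> hom C (gob P \<otimes> T) T \<and> b \<cdot> (?I \<otimes>\<^sub>a \<tau>) = \<tau> \<cdot> l"
    by (rule ex1I[of _ b], rule b, rule coequaliser_epi[OF coeq1]) (use b in \<open>simp_all add: in_hom\<close>)
  from theI'[OF this] have a: "a \<in> hom C (gob P \<otimes> T) T" "a \<cdot> (?I \<otimes>\<^sub>a \<tau>) = \<tau> \<cdot> l"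
    by (simp_all add: a_def)
  then show "a \<cdot> (Idn C (gob P) \<otimes>\<^sub>a \<tau>) = \<tau> \<cdot> l" by simp
  have [simp]: "a \<in> Ar C" "Dom C a = gob P \<otimes> T" "Cod C a = T" using a(1) by (simp_all add: in_hom)
  have a_el: "a \<cdot> \<langle>x, \<tau> \<cdot> z\<rangle> = \<tau> \<cdot> (l \<cdot> \<langle>x, z\<rangle>)"
    if "x \<in> Ar C" "z \<in> Ar C" "Dom C x = Dom C z" "Cod C x = gob P" "Cod C z = Y" for x z
    using arg_cong[OF a(2), of "\<lambda>h. h \<cdot> \<langle>x, z\<rangle>"] that by simp
  let ?W = "gob P \<otimes> (gob P \<otimes> Y)"
  let ?x = "pr1 C (gob P) (gob P \<otimes> Y)" and ?y = "pr1 C (gob P) Y \<cdot> pr2 C (gob P) (gob P \<otimes> Y)"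
    and ?z = "pr2 C (gob P) Y \<cdot> pr2 C (gob P) (gob P \<otimes> Y)"
  have \<tau>2: "?I \<otimes>\<^sub>a (?I \<otimes>\<^sub>a \<tau>) = \<langle>?x, \<langle>?y, \<tau> \<cdot> ?z\<rangle>\<rangle>" unfolding prod_ar_def by simp
  have "a \<cdot> (gmul P \<otimes>\<^sub>a Idn C T) \<cdot> assoc C (gob P) (gob P) T = a \<cdot> (?I \<otimes>\<^sub>a a)"
  proof (rule coequaliser_epi[OF coeq2])
    have "a \<cdot> (gmul P \<otimes>\<^sub>a Idn C T) \<cdot> assoc C (gob P) (gob P) T \<cdot> (?I \<otimes>\<^sub>a (?I \<otimes>\<^sub>a \<tau>)) = a \<cdot> \<langle>gmul P \<cdot> \<langle>?x, ?y\<rangle>, \<tau> \<cdot> ?z\<rangle>"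
      unfolding \<tau>2 by simp
    also have "\<dots> = \<tau> \<cdot> (l \<cdot> \<langle>gmul P \<cdot> \<langle>?x, ?y\<rangle>, ?z\<rangle>)" by (rule a_el) simp_all
    also have "\<dots> = \<tau> \<cdot> (l \<cdot> \<langle>?x, l \<cdot> \<langle>?y, ?z\<rangle>\<rangle>)" by (subst action_el(6)[OF l]) simp_all
    also have "\<dots> = a \<cdot> \<langle>?x, a \<cdot> \<langle>?y, \<tau> \<cdot> ?z\<rangle>\<rangle>" by (subst a_el, simp_all)+
    also have "\<dots> = a \<cdot> (?I \<otimes>\<^sub>a a) \<cdot> (?I \<otimes>\<^sub>a (?I \<otimes>\<^sub>a \<tau>))" unfolding \<tau>2 by simp
    finally show "a \<cdot> (gmul P \<otimes>\<^sub>a Idn C T) \<cdot> assoc C (gob P) (gob P) T \<cdot> (?I \<otimes>\<^sub>a (?I \<otimes>\<^sub>a \<tau>))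
        = a \<cdot> (?I \<otimes>\<^sub>a a) \<cdot> (?I \<otimes>\<^sub>a (?I \<otimes>\<^sub>a \<tau>))" .
  qed simp_all
  moreover have "a \<cdot> \<langle>gone P \<cdot> bang C T, Idn C T\<rangle> = Idn C T"
  proof (rule coequaliser_epi[OF \<tau>(1)])
    show "a \<cdot> \<langle>gone P \<cdot> bang C T, Idn C T\<rangle> \<cdot> \<tau> = Idn C T \<cdot> \<tau>"
      using a_el[of "gone P \<cdot> bang C Y" "Idn C Y"] action_el(7)[OF l, of "Idn C Y" Y] by simp
  qed simp_all
  ultimately show "is_action C P (Cod C \<tau>) a" unfolding is_action_def by (simp add: in_hom del: assoc_simp)
qed

lemma (in cartesian) left_translation:
  assumes P: "is_group C P" and Q: "Q \<in> Ob C"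
  defines "L \<equiv> (gmul P \<otimes>\<^sub>a Idn C Q) \<cdot> assoc C (gob P) (gob P) Q"
  shows "is_action C P (gob P \<otimes> Q) L"
    and "\<And>x y w. x \<in> Ar C \<Longrightarrow> y \<in> Ar C \<Longrightarrow> w \<in> Ar C \<Longrightarrow> Dom C x = Dom C w \<Longrightarrow> Dom C y = Dom C w \<Longrightarrow>
      Cod C x = gob P \<Longrightarrow> Cod C y = gob P \<Longrightarrow> Cod C w = Q \<Longrightarrow> L \<cdot> \<langle>x, \<langle>y, w\<rangle>\<rangle> = \<langle>gmul P \<cdot> \<langle>x, y\<rangle>, w\<rangle>"
proof -
  note [simp] = P Q
  show el: "L \<cdot> \<langle>x, \<langle>y, w\<rangle>\<rangle> = \<langle>gmul P \<cdot> \<langle>x, y\<rangle>, w\<rangle>" if "x \<in> Ar C" "y \<in> Ar C" "w \<in> Ar C" "Dom C x = Dom C w"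
    "Dom C y = Dom C w" "Cod C x = gob P" "Cod C y = gob P" "Cod C w = Q" for x y w
    using that by (simp add: L_def)
  have [simp]: "L \<in> Ar C" "Dom C L = gob P \<otimes> (gob P \<otimes> Q)" "Cod C L = gob P \<otimes> Q" by (simp_all add: L_def)
  have pair: "\<exists>y w. z = \<langle>y, w\<rangle> \<and> y \<in> Ar C \<and> Dom C y = W \<and> Cod C y = gob P \<and> w \<in> Ar C \<and> Dom C w = W \<and> Cod C w = Q"
    if "z \<in> hom C W (gob P \<otimes> Q)" for z W
    using that by (intro exI[of _ "pr1 C (gob P) Q \<cdot> z"] exI[of _ "pr2 C (gob P) Q \<cdot> z"]) (simp add: in_hom)
  show "is_action C P (gob P \<otimes> Q) L"
  proof (rule is_actionI)
    fix W g h z assume gh: "g \<in> hom C W (gob P)" "h \<in> hom C W (gob P)" and z: "z \<in> hom C W (gob P \<otimes> Q)"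
    from pair[OF z] gh show "L \<cdot> \<langle>gmul P \<cdot> \<langle>g, h\<rangle>, z\<rangle> = L \<cdot> \<langle>g, L \<cdot> \<langle>h, z\<rangle>\<rangle>"
      by (auto simp: in_hom el mul_assoc)
  next
    fix W z assume z: "z \<in> hom C W (gob P \<otimes> Q)"
    have "W \<in> Ob C" using hom_obD[OF z] by simp
    with pair[OF z] show "L \<cdot> \<langle>gone P \<cdot> bang C W, z\<rangle> = z"
      by (auto simp: in_hom el mul_unit_inv)
  qed (simp_all add: in_hom)
qed

text \<open>Over \<open>Q\<close> the object \<open>P \<times> G\<close> is the product of \<open>G\<close> with \<open>P \<times> Q\<close>, one arrow of the pair is
  the projection to \<open>P \<times> Q\<close>, and the other is its product with \<open>u\<close> in the group \<open>P \<times> Q\<close>. The functor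
  \<open>F\<close> preserves this description, so \<open>translation_kernel_pair\<close> applies in the slice of \<open>D\<close> over
  \<open>F Q\<close>. The slice only serves to obtain a kernel pair: it is transferred to \<open>F \<tau>\<close>, which coequalises
  the pair in \<open>D\<close>.\<close>

lemma (in lex_functor) standard_kernel_pair:
  assumes Q: "Q \<in> Ob C" and P: "is_group C P"
    and u: "is_group_hom (slice C Q) (GrpAr G (grp_functor_ob C (slice C Q) (times_over C Q) P) u)"
      "monic (slice C Q) u"
    and exact: "action_barr_exact (slice D (FOb F Q))"
    and L: "L = (gmul P \<otimes>\<^sub>a\<^bsub>C\<^esub> Idn C Q) \<cdot>\<^bsub>C\<^esub> assoc C (gob P) (gob P) Q"
    and r: "r = Idn C (gob P) \<otimes>\<^sub>a\<^bsub>C\<^esub> gob G" and r': "r' = L \<cdot>\<^bsub>C\<^esub> (Idn C (gob P) \<otimes>\<^sub>a\<^bsub>C\<^esub> smap u)"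
    and \<tau>: "is_coequaliser D (FAr F r) (FAr F r') (FAr F \<tau>)"
  shows "is_pullback D (FAr F \<tau>) (FAr F \<tau>) (FOb F (gob P \<otimes>\<^bsub>C\<^esub> Dom C (gob G))) (FAr F r) (FAr F r')"
proof -
  let ?E = "slice C Q" and ?E' = "slice D (FOb F Q)" and ?H = "grp_functor_ob C (slice C Q) (times_over C Q) P"
  let ?S = "slice_functor F"
  define p q where "p = gob G" and "q = pr2 C (gob P) Q"
  note [simp] = Q P
  interpret T: product_functor C ?E "times_over C Q" by (rule C.times_over_functor) simp
  interpret S: product_functor ?E ?E' ?S by (rule slice_product_functor) simp
  have u_ar: "u \<in> Ar ?E" "Dom ?E u = p" "Cod ?E u = q"
    using T.D.group_hom_arrows[OF u(1)] by (simp_all add: p_def q_def C.times_over_simps)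
  have [simp]: "q \<in> Ar C" "Dom C q = gob P \<otimes>\<^bsub>C\<^esub> Q" "Cod C q = Q" by (simp_all add: q_def)
  have [simp]: "p \<in> Ar C" "Cod C p = Q" "smap u \<in> Ar C" "Dom C (smap u) = Dom C p" "Cod C (smap u) = gob P \<otimes>\<^bsub>C\<^esub> Q"
    "sdom u = p" "scod u = q" and qu: "q \<cdot>\<^bsub>C\<^esub> smap u = p"
    using u_ar by (auto simp: slice_ar slice_simps q_def)
  define \<gamma> where "\<gamma> = pr1 C (gob P) Q \<cdot>\<^bsub>C\<^esub> smap u"
  have [simp]: "\<gamma> \<in> Ar C" "Dom C \<gamma> = Dom C p" "Cod C \<gamma> = gob P" by (simp_all add: \<gamma>_def)
  have u_pair: "smap u = \<langle>\<gamma>, p\<rangle>\<^bsub>C\<^esub>"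
    by (rule C.product_ext[of _ _ "gob P" Q]) (simp_all add: \<gamma>_def qu[unfolded q_def])
  have u_eq: "u = SliceAr p q \<langle>\<gamma>, p\<rangle>\<^bsub>C\<^esub>" using u_pair by - (rule slice_ar_eqI, simp_all)
  let ?M = "gob P \<otimes>\<^bsub>C\<^esub> Dom C p" let ?p1 = "pr1 C (gob P) (Dom C p)" and ?p2 = "pr2 C (gob P) (Dom C p)"
  define R where "R = p \<cdot>\<^bsub>C\<^esub> ?p2"
  have [simp]: "R \<in> Ar C" "Dom C R = ?M" "Cod C R = Q" by (simp_all add: R_def)
  have r_eq: "r = \<langle>?p1, R\<rangle>\<^bsub>C\<^esub>" by (simp add: r p_def[symmetric] prod_ar_def R_def)
  have r'_eq: "r' = \<langle>gmul P \<cdot>\<^bsub>C\<^esub> \<langle>?p1, \<gamma> \<cdot>\<^bsub>C\<^esub> ?p2\<rangle>\<^bsub>C\<^esub>, R\<rangle>\<^bsub>C\<^esub>"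
    by (simp add: r' L prod_ar_def R_def u_pair)
  have [simp]: "r \<in> Ar C" "Dom C r = ?M" "Cod C r = gob P \<otimes>\<^bsub>C\<^esub> Q" "r' \<in> Ar C" "Dom C r' = ?M" "Cod C r' = gob P \<otimes>\<^bsub>C\<^esub> Q"
    and qr: "q \<cdot>\<^bsub>C\<^esub> r = R" "q \<cdot>\<^bsub>C\<^esub> r' = R"
    by (simp_all add: r_eq r'_eq q_def)
  define \<rho> \<sigma> where "\<rho> = SliceAr R p ?p2" and "\<sigma> = SliceAr R q r"
  have pb: "is_pullback C p q ?M ?p2 r"
  proof (rule C.is_pullbackI)
    fix W k l assume kl: "k \<in> Ar C" "l \<in> Ar C" "Dom C k = W" "Dom C l = W" "Cod C k = Dom C p" "Cod C l = Dom C q"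
      "p \<cdot>\<^bsub>C\<^esub> k = q \<cdot>\<^bsub>C\<^esub> l"
    let ?h = "\<langle>pr1 C (gob P) Q \<cdot>\<^bsub>C\<^esub> l, k\<rangle>\<^bsub>C\<^esub>"
    have "r \<cdot>\<^bsub>C\<^esub> ?h = l"
      by (rule C.product_ext[of _ _ "gob P" Q]) (use kl in \<open>simp_all add: r_eq R_def q_def\<close>)
    then show "\<exists>h. h \<in> Ar C \<and> Dom C h = W \<and> Cod C h = ?M \<and> ?p2 \<cdot>\<^bsub>C\<^esub> h = k \<and> r \<cdot>\<^bsub>C\<^esub> h = l"
      using kl by (intro exI[of _ ?h]) simp
  next
    fix h k assume hk: "h \<in> Ar C" "k \<in> Ar C" "Dom C h = Dom C k" "Cod C h = ?M" "Cod C k = ?M"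
      "?p2 \<cdot>\<^bsub>C\<^esub> h = ?p2 \<cdot>\<^bsub>C\<^esub> k" "r \<cdot>\<^bsub>C\<^esub> h = r \<cdot>\<^bsub>C\<^esub> k"
    have eq: "\<langle>?p1 \<cdot>\<^bsub>C\<^esub> h, R \<cdot>\<^bsub>C\<^esub> h\<rangle>\<^bsub>C\<^esub> = \<langle>?p1 \<cdot>\<^bsub>C\<^esub> k, R \<cdot>\<^bsub>C\<^esub> k\<rangle>\<^bsub>C\<^esub>"
      using hk(1-5,7) by (simp add: r_eq)
    have "?p1 \<cdot>\<^bsub>C\<^esub> h = ?p1 \<cdot>\<^bsub>C\<^esub> k" by (rule C.pairing_inject(1)[OF eq]) (use hk in simp_all)
    then show "h = k" by - (rule C.product_ext[of _ _ "gob P" "Dom C p"], use hk in simp_all)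
  qed (simp_all add: qr, simp add: R_def)
  have prod: "is_product ?E p q R \<rho> \<sigma>"
    using C.slice_product_of_pullback[OF pb, of Q] by (simp add: \<rho>_def \<sigma>_def R_def)
  have mul: "gmul ?H \<cdot>\<^bsub>?E\<^esub> \<langle>\<sigma>, u \<cdot>\<^bsub>?E\<^esub> \<rho>\<rangle>\<^bsub>?E\<^esub> = SliceAr R q r'"
  proof -
    have "u \<cdot>\<^bsub>?E\<^esub> \<rho> = SliceAr R q \<langle>\<gamma> \<cdot>\<^bsub>C\<^esub> ?p2, R\<rangle>\<^bsub>C\<^esub>" by (simp add: u_eq \<rho>_def slice_simps) (simp add: R_def)
    then show ?thesis
      unfolding \<sigma>_def r_eq r'_eq q_def by (simp only:) (rule C.times_over_mul; simp)
  qed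
  note prod_ar = T.D.product_arrows[OF prod]
  have hom': "is_group_hom ?E' (GrpAr (grp_functor_ob ?E ?E' ?S G) (grp_functor_ob ?E ?E' ?S ?H) (FAr ?S u))"
    by (rule S.functor_group_hom[OF u(1)])
  have "monic D (FAr F (smap u))"
    using u(2) by (intro preserves_monic) (simp add: C.slice_monic)
  then have mono': "monic ?E' (FAr ?S u)"
    using S.F_simps(3)[OF u_ar(1)] by (simp add: D.slice_monic slice_functor_simps)
  have prod': "is_product ?E' (gob (grp_functor_ob ?E ?E' ?S G)) (gob (grp_functor_ob ?E ?E' ?S ?H)) (FAr F R) (FAr ?S \<rho>) (FAr ?S \<sigma>)"
    using S.preserves_product[OF prod] by (simp add: p_def[symmetric] q_def[symmetric] C.times_over_simps slice_functor_simps)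
  have mul': "gmul (grp_functor_ob ?E ?E' ?S ?H) \<cdot>\<^bsub>?E'\<^esub> \<langle>FAr ?S \<sigma>, FAr ?S u \<cdot>\<^bsub>?E'\<^esub> FAr ?S \<rho>\<rangle>\<^bsub>?E'\<^esub> = FAr ?S (SliceAr R q r')"
  proof -
    have H: "is_group ?E ?H" by (rule T.functor_group) simp
    have gobH: "gob ?H = q" by (simp add: C.times_over_simps q_def)
    have id: "Idn ?E' (FOb ?S R) \<in> Ar ?E'" "Cod ?E' (Idn ?E' (FOb ?S R)) = FOb ?S R"
      using prod_ar(1) by simp_all
    have "gmul (grp_functor_ob ?E ?E' ?S ?H) \<cdot>\<^bsub>?E'\<^esub>
        \<langle>FAr ?S \<sigma> \<cdot>\<^bsub>?E'\<^esub> Idn ?E' (FOb ?S R), FAr ?S (u \<cdot>\<^bsub>?E\<^esub> \<rho>) \<cdot>\<^bsub>?E'\<^esub> Idn ?E' (FOb ?S R)\<rangle>\<^bsub>?E'\<^esub>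
      = FAr ?S (gmul ?H \<cdot>\<^bsub>?E\<^esub> \<langle>\<sigma>, u \<cdot>\<^bsub>?E\<^esub> \<rho>\<rangle>\<^bsub>?E\<^esub>) \<cdot>\<^bsub>?E'\<^esub> Idn ?E' (FOb ?S R)"
      by (rule S.functor_mul[OF H _ _ _ _ _ _ id]) (use prod_ar u_ar gobH in simp_all)
    moreover have "SliceAr R q r' \<in> Ar ?E" "Dom ?E (SliceAr R q r') = R"
      using qr by (simp_all add: slice_ar slice_simps)
    ultimately show ?thesis
      using prod_ar u_ar by (simp add: mul S.F_comp)
  qed
  obtain c where c: "is_coequaliser ?E' (FAr ?S \<sigma>) (FAr ?S (SliceAr R q r')) c"
    and kp: "is_pullback ?E' c c (FAr F R) (FAr ?S \<sigma>) (FAr ?S (SliceAr R q r'))"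
    using S.D.translation_kernel_pair[OF exact hom' mono' prod'] unfolding mul' by blast
  have FR: "FAr F q \<cdot>\<^bsub>D\<^esub> FAr F r = FAr F R" "FAr F q \<cdot>\<^bsub>D\<^esub> FAr F r' = FAr F R"
    by (simp_all add: F_comp[symmetric] qr)
  have c_ar: "c \<in> Ar ?E'" "sdom c = FAr F q" and c_eq: "smap c \<cdot>\<^bsub>D\<^esub> FAr F r = smap c \<cdot>\<^bsub>D\<^esub> FAr F r'"
    using S.D.coequaliser_arrows(5-7)[OF c] by (simp_all add: \<sigma>_def slice_functor_simps slice_simps)
  have [simp]: "smap c \<in> Ar D" "Dom D (smap c) = FOb F (gob P \<otimes>\<^bsub>C\<^esub> Q)" "Cod D (smap c) = Dom D (scod c)" "scod c \<in> Ar D"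
    "Cod D (scod c) = FOb F Q"
    and tri: "scod c \<cdot>\<^bsub>D\<^esub> smap c = FAr F q"
    using c_ar by (auto simp: slice_ar)
  have [simp]: "FAr F \<tau> \<in> Ar D" "Dom D (FAr F \<tau>) = FOb F (gob P \<otimes>\<^bsub>C\<^esub> Q)"
    using D.coequaliser_arrows(5,6)[OF \<tau>] by simp_all
  \<comment> \<open>The coequaliser \<open>c\<close> over \<open>F Q\<close> factors through \<open>F \<tau>\<close>, so \<open>F \<tau>\<close> identifies at most the points that \<open>c\<close> identifies.\<close>
  obtain d where d [simp]: "d \<in> Ar D" "Dom D d = Cod D (FAr F \<tau>)" and d\<tau>: "d \<cdot>\<^bsub>D\<^esub> FAr F \<tau> = smap c"
    using D.coequaliser_factor[OF \<tau>, of "smap c"] c_eq by auto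
  show ?thesis
    unfolding p_def[symmetric]
  proof (rule D.is_pullbackI)
    show "FAr F \<tau> \<cdot>\<^bsub>D\<^esub> FAr F r = FAr F \<tau> \<cdot>\<^bsub>D\<^esub> FAr F r'" by (rule D.coequaliser_arrows(7)[OF \<tau>])
  next
    fix W k l assume kl: "k \<in> Ar D" "l \<in> Ar D" "Dom D k = W" "Dom D l = W" "Cod D k = Dom D (FAr F \<tau>)"
      "Cod D l = Dom D (FAr F \<tau>)" "FAr F \<tau> \<cdot>\<^bsub>D\<^esub> k = FAr F \<tau> \<cdot>\<^bsub>D\<^esub> l"
    have ckl: "smap c \<cdot>\<^bsub>D\<^esub> k = smap c \<cdot>\<^bsub>D\<^esub> l"
      using D.comp_reduce[OF d\<tau>, of k] D.comp_reduce[OF d\<tau>, of l] kl by simp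
    have wkl: "FAr F q \<cdot>\<^bsub>D\<^esub> k = FAr F q \<cdot>\<^bsub>D\<^esub> l"
      using D.comp_reduce[OF tri, of k] D.comp_reduce[OF tri, of l] kl ckl by simp
    let ?w = "FAr F q \<cdot>\<^bsub>D\<^esub> k"
    obtain h where "h \<in> Ar ?E'" "Dom ?E' h = ?w" "Cod ?E' h = FAr F R"
      "FAr ?S \<sigma> \<cdot>\<^bsub>?E'\<^esub> h = SliceAr ?w (FAr F q) k" "FAr ?S (SliceAr R q r') \<cdot>\<^bsub>?E'\<^esub> h = SliceAr ?w (FAr F q) l"
      by (rule S.D.pullback_factor[OF kp, of "SliceAr ?w (FAr F q) k" "SliceAr ?w (FAr F q) l" ?w])
        (use kl ckl wkl c_ar in \<open>simp_all add: slice_ar slice_simps\<close>)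
    then show "\<exists>h. h \<in> Ar D \<and> Dom D h = W \<and> Cod D h = FOb F ?M \<and> FAr F r \<cdot>\<^bsub>D\<^esub> h = k \<and> FAr F r' \<cdot>\<^bsub>D\<^esub> h = l"
      using kl by (intro exI[of _ "smap h"]) (auto simp: slice_ar slice_simps slice_functor_simps \<sigma>_def)
  next
    fix h k assume hk: "h \<in> Ar D" "k \<in> Ar D" "Dom D h = Dom D k" "Cod D h = FOb F ?M" "Cod D k = FOb F ?M"
      "FAr F r \<cdot>\<^bsub>D\<^esub> h = FAr F r \<cdot>\<^bsub>D\<^esub> k" "FAr F r' \<cdot>\<^bsub>D\<^esub> h = FAr F r' \<cdot>\<^bsub>D\<^esub> k"
    have w: "FAr F R \<cdot>\<^bsub>D\<^esub> h = FAr F R \<cdot>\<^bsub>D\<^esub> k"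
      using D.comp_reduce[OF FR(1), of h] D.comp_reduce[OF FR(1), of k] hk by simp
    have "SliceAr (FAr F R \<cdot>\<^bsub>D\<^esub> h) (FAr F R) h = SliceAr (FAr F R \<cdot>\<^bsub>D\<^esub> k) (FAr F R) k"
      by (rule S.D.pullback_eq[OF kp]) (use hk w in \<open>simp_all add: slice_ar slice_simps slice_functor_simps \<sigma>_def\<close>)
    then show "h = k" by simp
  qed simp_all
qed

text \<open>Left and right translations commute: \<open>\<tau>(x (y \<gamma>(g)), q) = \<tau>((x y) \<gamma>(g), q) = \<tau>(x y, q)\<close>.\<close>

lemma (in cartesian) translation_compatible:
  assumes P: "is_group C P" and Q: "Q \<in> Ob C"
    and p: "p \<in> Ar C" "Cod C p = Q" and v: "v \<in> Ar C" "Dom C v = Dom C p" "Cod C v = gob P \<otimes> Q"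
      "pr2 C (gob P) Q \<cdot> v = p"
    and L: "L = (gmul P \<otimes>\<^sub>a Idn C Q) \<cdot> assoc C (gob P) (gob P) Q"
    and r: "r = Idn C (gob P) \<otimes>\<^sub>a p" and r': "r' = L \<cdot> (Idn C (gob P) \<otimes>\<^sub>a v)"
    and \<tau>: "\<tau> \<in> Ar C" "Dom C \<tau> = gob P \<otimes> Q" "\<tau> \<cdot> r = \<tau> \<cdot> r'"
  shows "\<tau> \<cdot> (L \<cdot> (Idn C (gob P) \<otimes>\<^sub>a r)) = \<tau> \<cdot> (L \<cdot> (Idn C (gob P) \<otimes>\<^sub>a r'))"
proof -
  let ?I = "Idn C (gob P)" and ?M = "Dom C p"
  note [simp] = P Q p v(1-3) \<tau>(1,2)
  note L_el = left_translation(2)[OF P Q, folded L]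
  have [simp]: "L \<in> Ar C" "Dom C L = gob P \<otimes> (gob P \<otimes> Q)" "Cod C L = gob P \<otimes> Q" by (simp_all add: L)
  define \<gamma> where "\<gamma> = pr1 C (gob P) Q \<cdot> v"
  have [simp]: "\<gamma> \<in> Ar C" "Dom C \<gamma> = ?M" "Cod C \<gamma> = gob P" by (simp_all add: \<gamma>_def)
  have v_pair: "v = \<langle>\<gamma>, p\<rangle>"
    by (rule product_ext[of _ _ "gob P" Q]) (simp_all add: \<gamma>_def v(4))
  let ?x = "pr1 C (gob P) (gob P \<otimes> ?M)" and ?y = "pr1 C (gob P) ?M \<cdot> pr2 C (gob P) (gob P \<otimes> ?M)"
    and ?g = "pr2 C (gob P) ?M \<cdot> pr2 C (gob P) (gob P \<otimes> ?M)"
  let ?h = "\<langle>gmul P \<cdot> \<langle>?x, ?y\<rangle>, ?g\<rangle>"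
  have [simp]: "r \<in> Ar C" "Dom C r = gob P \<otimes> ?M" "Cod C r = gob P \<otimes> Q" "r' \<in> Ar C" "Dom C r' = gob P \<otimes> ?M" "Cod C r' = gob P \<otimes> Q"
    by (simp_all add: r r')
  have "L \<cdot> (?I \<otimes>\<^sub>a r) = r \<cdot> ?h"
    unfolding r prod_ar_def by (simp add: L_el)
  moreover have "L \<cdot> (?I \<otimes>\<^sub>a r') = r' \<cdot> ?h"
    unfolding r' prod_ar_def v_pair by (simp add: L_el mul_assoc)
  ultimately show ?thesis using comp_reduce[OF \<tau>(3), of ?h] by simp
qed

theorem proposition4p6:
  fixes C :: "('o, 'm) cat"
    and Q :: "('o, 'm) graph"
    and colim :: "(('o, 'm) graph_of_groups, ('o, 'm) graph_of_groups_ar,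
                   ('o, 'm) grp, ('o, 'm) grp_ar) fctr"
    and \<eta> :: "('o, 'm) graph_of_groups \<Rightarrow> ('o, 'm) graph_of_groups_ar"
    and \<G> :: "('o, 'm) graph_of_groups"
  assumes "category C"
    and "has_finite_limits C"
    and "has_coequalisers C"
    and "products_preserve_coequalisers C"
    and "Q \<in> Ob (graph_cat C)"
    and "adjunction (grp_cat (graph_over C Q)) (grp_cat C) colim (diagonal_functor C Q) \<eta>"
    and "\<G> \<in> Ob (grp_cat (graph_over C Q))"
    and "locally_action_barr_exact C"
    and "monic (graph_over C Q) (gmap (\<eta> \<G>))"
  shows "let \<pi> = FOb colim \<G>;
             S = pulled_back_stabiliser C Q \<pi> (\<eta> \<G>);
             j = pulled_back_incl C Q \<pi> (\<eta> \<G>)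
         in \<exists>\<phi>. iso_in (grp_cat (graph_over C Q)) \<G> S \<phi> \<and>
               (\<forall>\<psi> \<in> hom (graph_over C Q) (gob \<G>) (gob S).
                  j \<cdot>\<^bsub>graph_over C Q\<^esub> \<psi> = gmap (\<eta> \<G>) \<longleftrightarrow> \<psi> = gmap \<phi>)"
proof -
  let ?D = "graph_cat C" and ?E = "graph_over C Q"
  interpret C: lex C by (rule has_finite_limits_imp_lex) fact+
  interpret D: lex ?D by (rule C.graph_lex)
  interpret K: lex_functor C ?D "const_functor C" by (rule C.const_lex_functor)
  interpret T: product_functor ?D ?E "times_over ?D Q" by (rule D.times_over_functor) fact
  note [simp] = assms(5)
  define \<pi> where "\<pi> = FOb colim \<G>"
  define P where "P = const_group C \<pi>"
  define u where "u = gmap (\<eta> \<G>)"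
  let ?H = "grp_functor_ob ?D ?E (times_over ?D Q) P"
  have P_eq: "P = grp_functor_ob C ?D (const_functor C) \<pi>"
    by (simp add: P_def const_group_def grp_functor_def)
  have "\<pi> \<in> Ob (grp_cat C)"
    using assms(6,7) unfolding adjunction_def is_functor_def \<pi>_def by blast
  then have P [simp]: "is_group ?D P"
    unfolding P_eq by (intro K.functor_group) (simp add: grp_cat_def)
  have "\<eta> \<G> \<in> hom (grp_cat ?E) \<G> (FOb (diagonal_functor C Q) \<pi>)"
    using assms(6,7) unfolding adjunction_def \<pi>_def by blast
  then have \<eta>: "is_group_hom ?E (\<eta> \<G>)" "gdom (\<eta> \<G>) = \<G>" "gcod (\<eta> \<G>) = ?H"
    by (simp_all add: in_hom grp_cat_def diagonal_functor_def functor_comp_def grp_functor_def P_eq)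
  then have "GrpAr \<G> ?H u = \<eta> \<G>" by (cases "\<eta> \<G>") (simp add: u_def)
  then have u: "is_group_hom ?E (GrpAr \<G> ?H u)" "monic ?E u" using \<eta>(1) assms(9) by (simp_all only: u_def)
  define p where "p = gob \<G>"
  have u_ar: "u \<in> Ar ?E" "Dom ?E u = p" "Cod ?E u = pr2 ?D (gob P) Q"
    using T.D.group_hom_arrows[OF u(1)] by (simp_all add: p_def D.times_over_simps)
  then have [simp]: "p \<in> Ar ?D" "Cod ?D p = Q" "smap u \<in> Ar ?D" "Dom ?D (smap u) = Dom ?D p"
      "Cod ?D (smap u) = gob P \<otimes>\<^bsub>?D\<^esub> Q"
    and qu: "pr2 ?D (gob P) Q \<cdot>\<^bsub>?D\<^esub> smap u = p"
    by (auto simp: slice_ar slice_simps)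
  define L where "L = left_mult C Q \<pi>"
  have L: "L = (gmul P \<otimes>\<^sub>a\<^bsub>?D\<^esub> Idn ?D Q) \<cdot>\<^bsub>?D\<^esub> assoc ?D (gob P) (gob P) Q"
    by (simp add: L_def left_mult_def Let_def P_def)
  have [simp]: "L \<in> Ar ?D" "Dom ?D L = gob P \<otimes>\<^bsub>?D\<^esub> (gob P \<otimes>\<^bsub>?D\<^esub> Q)" "Cod ?D L = gob P \<otimes>\<^bsub>?D\<^esub> Q"
    by (simp_all add: L)
  define r r' where "r = Idn ?D (gob P) \<otimes>\<^sub>a\<^bsub>?D\<^esub> p" and "r' = L \<cdot>\<^bsub>?D\<^esub> (Idn ?D (gob P) \<otimes>\<^sub>a\<^bsub>?D\<^esub> smap u)"
  have r_ar: "r \<in> Ar ?D" "r' \<in> Ar ?D" "Dom ?D r' = Dom ?D r" "Cod ?D r' = Cod ?D r" "Cod ?D r = gob P \<otimes>\<^bsub>?D\<^esub> Q"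
    "Dom ?D r = gob P \<otimes>\<^bsub>?D\<^esub> Dom ?D p"
    by (simp_all add: r_def r'_def)
  define \<tau> where "\<tau> = std_quot C Q \<pi> (\<eta> \<G>)"
  have "\<tau> = (SOME \<tau>. is_coequaliser ?D r r' \<tau>)"
    unfolding \<tau>_def std_quot_def Let_def r_def r'_def L_def p_def u_def P_def \<eta>(2) ..
  moreover have "\<exists>\<tau>. is_coequaliser ?D r r' \<tau>"
    using C.levelwise_coequaliser_exists[OF assms(3), of r r'] r_ar by (auto simp: graph_simps)
  ultimately have \<tau>: "is_coequaliser ?D r r' \<tau>" by (simp add: someI_ex)
  have \<tau>_ar [simp]: "\<tau> \<in> Ar ?D" "Dom ?D \<tau> = gob P \<otimes>\<^bsub>?D\<^esub> Q"
    using D.coequaliser_arrows(5,6)[OF \<tau>] r_ar by simp_all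
  define a where "a = std_action C Q \<pi> (\<eta> \<G>)"
  have a_eq: "a = (THE a. a \<in> hom ?D (gob P \<otimes>\<^bsub>?D\<^esub> Cod ?D \<tau>) (Cod ?D \<tau>) \<and>
      a \<cdot>\<^bsub>?D\<^esub> (Idn ?D (gob P) \<otimes>\<^sub>a\<^bsub>?D\<^esub> \<tau>) = \<tau> \<cdot>\<^bsub>?D\<^esub> L)"
    unfolding a_def std_action_def Let_def std_graph_def \<tau>_def P_def L_def ..
  have "\<tau> \<cdot>\<^bsub>?D\<^esub> (L \<cdot>\<^bsub>?D\<^esub> (Idn ?D (gob P) \<otimes>\<^sub>a\<^bsub>?D\<^esub> r)) = \<tau> \<cdot>\<^bsub>?D\<^esub> (L \<cdot>\<^bsub>?D\<^esub> (Idn ?D (gob P) \<otimes>\<^sub>a\<^bsub>?D\<^esub> r'))"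
    by (rule D.translation_compatible[where p = p and v = "smap u" and Q = Q])
      (simp_all add: L r_def r'_def qu D.coequaliser_arrows(7)[OF \<tau>, unfolded r_def r'_def L] del: D.assoc_simp D.prod_ar_comp)
  note a = D.quotient_action[OF C.graph_products_preserve_coequalisers[OF assms(3,4)]
      D.left_translation(1)[OF P assms(5), folded L] \<tau> r_ar(5) this, folded a_eq]
  have exact: "action_barr_exact (slice C (FOb (level b) Q))" for b
    using assms(5,8) unfolding locally_action_barr_exact_def by (cases b) (simp_all add: level_simps graph_simps is_graph)
  have level_kp: "is_pullback C (FAr (level b) \<tau>) (FAr (level b) \<tau>) (FOb (level b) (gob P \<otimes>\<^bsub>?D\<^esub> Dom ?D p))
      (FAr (level b) r) (FAr (level b) r')" for b
    unfolding p_def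
    by (rule lex_functor.standard_kernel_pair[OF C.level_lex_functor assms(5) P u exact L])
      (simp_all add: r_def r'_def p_def C.level_coequaliser[OF assms(3) \<tau>, unfolded r_def r'_def p_def])
  have "is_pullback ?D \<tau> \<tau> (gob P \<otimes>\<^bsub>?D\<^esub> Dom ?D p) r r'"
  proof (rule C.levelwise_pullback)
    show "grdom r = gob P \<otimes>\<^bsub>?D\<^esub> Dom ?D p" "grcod r = grdom \<tau>" "grdom r' = gob P \<otimes>\<^bsub>?D\<^esub> Dom ?D p" "grcod r' = grdom \<tau>"
      using r_ar \<tau>_ar unfolding graph_simps(2,3) by simp_all
  qed (use r_ar level_kp[of True] level_kp[of False] in \<open>simp_all add: level_simps\<close>)
  note kp = this[unfolded r_def r'_def p_def]
  have "\<tau> \<in> hom ?D (gob P \<otimes>\<^bsub>?D\<^esub> Q) (Cod ?D \<tau>)" by (simp add: in_hom)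
  note result = D.stabiliser_along_section[OF a(1) assms(5) u this L a(2) kp refl refl refl refl]
  have t: "std_section C Q \<pi> (\<eta> \<G>) = \<tau> \<cdot>\<^bsub>?D\<^esub> \<langle>gone P \<cdot>\<^bsub>?D\<^esub> bang ?D Q, Idn ?D Q\<rangle>\<^bsub>?D\<^esub>"
    by (simp only: std_section_def Let_def \<tau>_def P_def)
  show ?thesis
    using result
    unfolding Let_def pulled_back_stabiliser_def pulled_back_incl_def grp_functor_def
      \<pi>_def[symmetric] P_def[symmetric] u_def[symmetric] a_def[symmetric] t std_graph_def \<tau>_def[symmetric]
    by simp
qed

end
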